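(* Let $\Bbbk$ be a field and let $A$ be a noetherian Poisson algebra over $\Bbbk$. If $A$ or its reduced Poisson algebra $A_{red}=A/N(A)$ has artinian Poisson center, then $A$ is strongly Poisson cancellative. As a consequence, any artinian Poisson algebra over $\Bbbk$ is strongly Poisson cancellative.
   Context: A Poisson algebra over $\Bbbk$ is a commutative $\Bbbk$-algebra $A$ with a $\Bbbk$-bilinear bracket $\{\,,\}$ making $A$ a Lie algebra and such that $\{a,-\}$ is a $\Bbbk$-derivation of $A$ for every $a\in A$. Noetherian and artinian refer to the underlying commutative ring. The Poisson center of $A$ is $\mathcal Z_P(A)=\{z\in A:\{z,a\}=0 \text{ for all } a\in A\}$. $N(A)$ denotes the nilradical of $A$, i.e. the intersection of all prime ideals of $A$, which consists of all nilpotent elements. The reduced Poisson algebra of $A$ is $A_{red}=A/N(A)$, with bracket $\{a+N(A),b+N(A)\}=\{a,b\}+N(A)$. The polynomial algebra $A[t_1,\dots,t_n]$ carries the Poisson bracket extending that of $A$ for which all $t_i$ are Poisson central. An isomorphism of Poisson algebras is a bijective algebra homomorphism preserving the brackets. $A$ is strongly Poisson cancellative if for every $n\ge1$ and every Poisson algebra $B$ over $\Bbbk$, an isomorphism of Poisson algebras $A[t_1,\dots,t_n]\cong B[t_1,\dots,t_n]$ implies $A\cong B$ as Poisson algebras. *)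

theory Defs
  imports "HOL-Algebra.Algebra"
begin

section \<open>Poisson algebras\<close>

record ('k, 'a) poisson_alg = "('k, 'a) module" +
  pbracket :: "['a, 'a] \<Rightarrow> 'a"  (\<open>\<lbrace>_,/ _\<rbrace>\<index>\<close>)

locale poisson_algebra = K?: field K + A?: algebra K A
    for K :: "('k, 'm) ring_scheme" (structure)
    and A :: "('k, 'a, 'n) poisson_alg_scheme" (structure) +
  assumes pbracket_closed:
      "\<lbrakk>a \<in> carrier A; b \<in> carrier A\<rbrakk> \<Longrightarrow> \<lbrace>a, b\<rbrace>\<^bsub>A\<^esub> \<in> carrier A"
    and pbracket_add_left:
      "\<lbrakk>a \<in> carrier A; b \<in> carrier A; c \<in> carrier A\<rbrakk> \<Longrightarrow>
        \<lbrace>a \<oplus>\<^bsub>A\<^esub> b, c\<rbrace>\<^bsub>A\<^esub> = \<lbrace>a, c\<rbrace>\<^bsub>A\<^esub> \<oplus>\<^bsub>A\<^esub> \<lbrace>b, c\<rbrace>\<^bsub>A\<^esub>"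
    and pbracket_add_right:
      "\<lbrakk>a \<in> carrier A; b \<in> carrier A; c \<in> carrier A\<rbrakk> \<Longrightarrow>
        \<lbrace>a, b \<oplus>\<^bsub>A\<^esub> c\<rbrace>\<^bsub>A\<^esub> = \<lbrace>a, b\<rbrace>\<^bsub>A\<^esub> \<oplus>\<^bsub>A\<^esub> \<lbrace>a, c\<rbrace>\<^bsub>A\<^esub>"
    and pbracket_smult_left:
      "\<lbrakk>k \<in> carrier K; a \<in> carrier A; b \<in> carrier A\<rbrakk> \<Longrightarrow>
        \<lbrace>k \<odot>\<^bsub>A\<^esub> a, b\<rbrace>\<^bsub>A\<^esub> = k \<odot>\<^bsub>A\<^esub> \<lbrace>a, b\<rbrace>\<^bsub>A\<^esub>"
    and pbracket_smult_right:
      "\<lbrakk>k \<in> carrier K; a \<in> carrier A; b \<in> carrier A\<rbrakk> \<Longrightarrow>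
        \<lbrace>a, k \<odot>\<^bsub>A\<^esub> b\<rbrace>\<^bsub>A\<^esub> = k \<odot>\<^bsub>A\<^esub> \<lbrace>a, b\<rbrace>\<^bsub>A\<^esub>"
    and pbracket_self:
      "a \<in> carrier A \<Longrightarrow> \<lbrace>a, a\<rbrace>\<^bsub>A\<^esub> = \<zero>\<^bsub>A\<^esub>"
    and pbracket_jacobi:
      "\<lbrakk>a \<in> carrier A; b \<in> carrier A; c \<in> carrier A\<rbrakk> \<Longrightarrow>
        \<lbrace>a, \<lbrace>b, c\<rbrace>\<^bsub>A\<^esub>\<rbrace>\<^bsub>A\<^esub> \<oplus>\<^bsub>A\<^esub> \<lbrace>b, \<lbrace>c, a\<rbrace>\<^bsub>A\<^esub>\<rbrace>\<^bsub>A\<^esub> \<oplus>\<^bsub>A\<^esub> \<lbrace>c, \<lbrace>a, b\<rbrace>\<^bsub>A\<^esub>\<rbrace>\<^bsub>A\<^esub> = \<zero>\<^bsub>A\<^esub>"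
    and pbracket_leibniz:
      "\<lbrakk>a \<in> carrier A; b \<in> carrier A; c \<in> carrier A\<rbrakk> \<Longrightarrow>
        \<lbrace>a, b \<otimes>\<^bsub>A\<^esub> c\<rbrace>\<^bsub>A\<^esub> = \<lbrace>a, b\<rbrace>\<^bsub>A\<^esub> \<otimes>\<^bsub>A\<^esub> c \<oplus>\<^bsub>A\<^esub> b \<otimes>\<^bsub>A\<^esub> \<lbrace>a, c\<rbrace>\<^bsub>A\<^esub>"

definition poisson_iso ::
    "('k, 'm) ring_scheme \<Rightarrow> ('k, 'a, 'n) poisson_alg_scheme \<Rightarrow>
     ('k, 'b, 'o) poisson_alg_scheme \<Rightarrow> ('a \<Rightarrow> 'b) set"
  where "poisson_iso K A B =
    {h \<in> ring_iso A B.
      (\<forall>k \<in> carrier K. \<forall>a \<in> carrier A. h (k \<odot>\<^bsub>A\<^esub> a) = k \<odot>\<^bsub>B\<^esub> h a) \<and>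
      (\<forall>a \<in> carrier A. \<forall>b \<in> carrier A. h \<lbrace>a, b\<rbrace>\<^bsub>A\<^esub> = \<lbrace>h a, h b\<rbrace>\<^bsub>B\<^esub>)}"

definition poisson_isomorphic ::
    "('k, 'm) ring_scheme \<Rightarrow> ('k, 'a, 'n) poisson_alg_scheme \<Rightarrow>
     ('k, 'b, 'o) poisson_alg_scheme \<Rightarrow> bool"
  where "poisson_isomorphic K A B \<longleftrightarrow> poisson_iso K A B \<noteq> {}"


section \<open>Artinian rings, Poisson center, reduced Poisson algebra\<close>

locale artinian_ring = ring +
  assumes descending_chain:
    "\<lbrakk>\<And>i::nat. ideal (I i) R; \<And>i. I (Suc i) \<subseteq> I i\<rbrakk> \<Longrightarrow> \<exists>n. \<forall>i\<ge>n. I i = I n"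

definition poisson_center :: "('k, 'a, 'n) poisson_alg_scheme \<Rightarrow> 'a set"
  where "poisson_center A = {z \<in> carrier A. \<forall>a \<in> carrier A. \<lbrace>z, a\<rbrace>\<^bsub>A\<^esub> = \<zero>\<^bsub>A\<^esub>}"

definition poisson_center_ring ::
    "('k, 'a, 'n) poisson_alg_scheme \<Rightarrow> ('k, 'a, 'n) poisson_alg_scheme"
  where "poisson_center_ring A = A\<lparr>carrier := poisson_center A\<rparr>"

text \<open>Intersecting with the carrier only matters for the zero ring, which has no prime ideal.\<close>

definition nilradical :: "('a, 'm) ring_scheme \<Rightarrow> 'a set"
  where "nilradical R = carrier R \<inter> \<Inter>{P. primeideal P R}"

text \<open>
  Scalar multiplication and bracket on cosets are defined in the style of \<^const>\<open>rcoset_mult\<close>, as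
  unions over all representatives.

  In characteristic 0 the nilradical \<open>N\<close> is stable under all maps \<open>\<lbrace>_, b\<rbrace>\<close>, so the union defining
  the bracket is the single coset \<open>N + \<lbrace>a, b\<rbrace>\<close> (lemma \<open>reduced_poisson_bracket\<close> below).
  In positive characteristic \<open>N\<close> need not be stable, and then the reduced Poisson algebra does not
  exist. In that case its \<^const>\<open>poisson_center\<close>, as computed here, is empty and in particular not
  a ring (lemma \<open>reduced_poisson_center_empty\<close>), so that \<open>artinian_ring\<close> is false for it.
\<close>

definition reduced_poisson :: "('k, 'a, 'n) poisson_alg_scheme \<Rightarrow> ('k, 'a set) poisson_alg"
  where "reduced_poisson A = (let N = nilradical A; Q = A Quot N in
    \<lparr>carrier = carrier Q, monoid.mult = monoid.mult Q, one = one Q, ring.zero = ring.zero Q, ring.add = ring.add Q,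
     smult = (\<lambda>k U. \<Union>a\<in>U. N +>\<^bsub>A\<^esub> (k \<odot>\<^bsub>A\<^esub> a)),
     pbracket = (\<lambda>U V. \<Union>a\<in>U. \<Union>b\<in>V. N +>\<^bsub>A\<^esub> \<lbrace>a, b\<rbrace>\<^bsub>A\<^esub>)\<rparr>)"

lemma ideal_nilradical:
  assumes "cring R"
  shows "ideal (nilradical R) R"
proof -
  interpret cring R by fact
  have "ideal (\<Inter>(insert (carrier R) {P. primeideal P R})) R"
    by (rule i_Intersect) (auto simp: oneideal primeideal.axioms(1))
  then show ?thesis by (simp add: nilradical_def)
qed

context poisson_algebra
begin

lemma pbracket_zero_left:
  assumes "b \<in> carrier A" shows "\<lbrace>\<zero>\<^bsub>A\<^esub>, b\<rbrace>\<^bsub>A\<^esub> = \<zero>\<^bsub>A\<^esub>"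
proof -
  have "\<lbrace>\<zero>\<^bsub>A\<^esub>, b\<rbrace>\<^bsub>A\<^esub> \<oplus>\<^bsub>A\<^esub> \<lbrace>\<zero>\<^bsub>A\<^esub>, b\<rbrace>\<^bsub>A\<^esub> = \<lbrace>\<zero>\<^bsub>A\<^esub>, b\<rbrace>\<^bsub>A\<^esub>"
    using pbracket_add_left[of "\<zero>\<^bsub>A\<^esub>" "\<zero>\<^bsub>A\<^esub>" b] assms by simp
  then show ?thesis
    using A.M.add.l_cancel_one assms pbracket_closed by force
qed

lemma pbracket_antisym:
  assumes "a \<in> carrier A" "b \<in> carrier A"
  shows "\<lbrace>a, b\<rbrace>\<^bsub>A\<^esub> = \<ominus>\<^bsub>A\<^esub> \<lbrace>b, a\<rbrace>\<^bsub>A\<^esub>"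
proof -
  have "\<lbrace>a \<oplus>\<^bsub>A\<^esub> b, a \<oplus>\<^bsub>A\<^esub> b\<rbrace>\<^bsub>A\<^esub>
      = (\<lbrace>a, a\<rbrace>\<^bsub>A\<^esub> \<oplus>\<^bsub>A\<^esub> \<lbrace>b, a\<rbrace>\<^bsub>A\<^esub>) \<oplus>\<^bsub>A\<^esub> (\<lbrace>a, b\<rbrace>\<^bsub>A\<^esub> \<oplus>\<^bsub>A\<^esub> \<lbrace>b, b\<rbrace>\<^bsub>A\<^esub>)"
    using assms by (simp add: pbracket_add_left pbracket_add_right)
  then have "\<lbrace>a, b\<rbrace>\<^bsub>A\<^esub> \<oplus>\<^bsub>A\<^esub> \<lbrace>b, a\<rbrace>\<^bsub>A\<^esub> = \<lbrace>a \<oplus>\<^bsub>A\<^esub> b, a \<oplus>\<^bsub>A\<^esub> b\<rbrace>\<^bsub>A\<^esub>"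
    using assms by (simp add: pbracket_self pbracket_closed A.M.add.m_comm)
  also have "\<dots> = \<zero>\<^bsub>A\<^esub>" using assms by (simp add: pbracket_self)
  finally show ?thesis
    using assms by (metis pbracket_closed A.M.minus_equality)
qed

lemma reduced_poisson_bracket:
  assumes stable: "\<And>x y. \<lbrakk>x \<in> nilradical A; y \<in> carrier A\<rbrakk> \<Longrightarrow> \<lbrace>x, y\<rbrace>\<^bsub>A\<^esub> \<in> nilradical A"
    and ab: "a \<in> carrier A" "b \<in> carrier A"
  shows "\<lbrace>nilradical A +>\<^bsub>A\<^esub> a, nilradical A +>\<^bsub>A\<^esub> b\<rbrace>\<^bsub>reduced_poisson A\<^esub>
         = nilradical A +>\<^bsub>A\<^esub> \<lbrace>a, b\<rbrace>\<^bsub>A\<^esub>"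
proof -
  let ?N = "nilradical A"
  interpret N: ideal ?N A by (rule ideal_nilradical) (rule M_cring)
  have coset: "?N +>\<^bsub>A\<^esub> \<lbrace>x, y\<rbrace>\<^bsub>A\<^esub> = ?N +>\<^bsub>A\<^esub> \<lbrace>a, b\<rbrace>\<^bsub>A\<^esub>"
    if xy: "x \<in> ?N +>\<^bsub>A\<^esub> a" "y \<in> ?N +>\<^bsub>A\<^esub> b" for x y
  proof -
    obtain p where p: "p \<in> ?N" "x = p \<oplus>\<^bsub>A\<^esub> a" using xy(1) by (auto simp: a_r_coset_def')
    obtain q where q: "q \<in> ?N" "y = q \<oplus>\<^bsub>A\<^esub> b" using xy(2) by (auto simp: a_r_coset_def')
    have pq: "p \<in> carrier A" "q \<in> carrier A" using p q N.a_Hcarr by auto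
    have "\<lbrace>a, q\<rbrace>\<^bsub>A\<^esub> \<in> ?N"
      using pbracket_antisym[OF ab(1) pq(2)] stable[OF q(1) ab(1)] by (simp add: N.a_inv_closed)
    moreover have "\<lbrace>p, y\<rbrace>\<^bsub>A\<^esub> \<in> ?N" using stable p(1) q(2) pq ab by simp
    moreover have "\<lbrace>x, y\<rbrace>\<^bsub>A\<^esub> = (\<lbrace>p, y\<rbrace>\<^bsub>A\<^esub> \<oplus>\<^bsub>A\<^esub> \<lbrace>a, q\<rbrace>\<^bsub>A\<^esub>) \<oplus>\<^bsub>A\<^esub> \<lbrace>a, b\<rbrace>\<^bsub>A\<^esub>"
    proof -
      have y: "y \<in> carrier A" using q(2) pq ab by simp
      have "\<lbrace>x, y\<rbrace>\<^bsub>A\<^esub> = \<lbrace>p, y\<rbrace>\<^bsub>A\<^esub> \<oplus>\<^bsub>A\<^esub> \<lbrace>a, y\<rbrace>\<^bsub>A\<^esub>"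
        unfolding p(2) by (intro pbracket_add_left pq ab y)
      moreover have "\<lbrace>a, y\<rbrace>\<^bsub>A\<^esub> = \<lbrace>a, q\<rbrace>\<^bsub>A\<^esub> \<oplus>\<^bsub>A\<^esub> \<lbrace>a, b\<rbrace>\<^bsub>A\<^esub>"
        unfolding q(2) by (intro pbracket_add_right pq ab)
      ultimately show ?thesis
        by (simp add: A.M.add.m_assoc pbracket_closed pq ab y)
    qed
    ultimately have "\<lbrace>x, y\<rbrace>\<^bsub>A\<^esub> \<in> ?N +>\<^bsub>A\<^esub> \<lbrace>a, b\<rbrace>\<^bsub>A\<^esub>"
      unfolding a_r_coset_def' using N.a_closed by blast
    then show ?thesis
      by (intro N.a_repr_independence'[symmetric] pbracket_closed ab)
  qed
  have "a \<in> ?N +>\<^bsub>A\<^esub> a" "b \<in> ?N +>\<^bsub>A\<^esub> b" using ab N.a_rcos_self by auto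
  moreover have "\<lbrace>?N +>\<^bsub>A\<^esub> a, ?N +>\<^bsub>A\<^esub> b\<rbrace>\<^bsub>reduced_poisson A\<^esub>
      = (\<Union>x \<in> ?N +>\<^bsub>A\<^esub> a. \<Union>y \<in> ?N +>\<^bsub>A\<^esub> b. ?N +>\<^bsub>A\<^esub> \<lbrace>a, b\<rbrace>\<^bsub>A\<^esub>)"
    unfolding reduced_poisson_def Let_def poisson_alg.simps by (intro SUP_cong refl coset)
  ultimately show ?thesis by blast
qed

lemma reduced_poisson_center_empty:
  assumes x: "x \<in> nilradical A" and y: "y \<in> carrier A" and xy: "\<lbrace>x, y\<rbrace>\<^bsub>A\<^esub> \<notin> nilradical A"
  shows "poisson_center (reduced_poisson A) = {}"
proof (rule ccontr)
  let ?N = "nilradical A"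
  interpret N: ideal ?N A by (rule ideal_nilradical) (rule M_cring)
  assume "poisson_center (reduced_poisson A) \<noteq> {}"
  then obtain U where U: "U \<in> carrier (A Quot ?N)"
    and central: "\<And>V. V \<in> carrier (A Quot ?N) \<Longrightarrow> (\<Union>a\<in>U. \<Union>b\<in>V. ?N +>\<^bsub>A\<^esub> \<lbrace>a, b\<rbrace>\<^bsub>A\<^esub>) = ?N"
    by (auto simp: poisson_center_def reduced_poisson_def Let_def FactRing_def)
  obtain a where a: "a \<in> carrier A" "U = ?N +>\<^bsub>A\<^esub> a"
    using U by (auto simp: FactRing_simps)
  have xA: "x \<in> carrier A" using x N.a_Hcarr by auto
  have V: "?N +>\<^bsub>A\<^esub> y \<in> carrier (A Quot ?N)" using y by (auto simp: FactRing_simps)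
  have *: "\<lbrace>u, y\<rbrace>\<^bsub>A\<^esub> \<in> ?N" if u: "u \<in> U" "u \<in> carrier A" for u
  proof -
    have "\<lbrace>u, y\<rbrace>\<^bsub>A\<^esub> \<in> ?N +>\<^bsub>A\<^esub> \<lbrace>u, y\<rbrace>\<^bsub>A\<^esub>" using u y pbracket_closed N.a_rcos_self by auto
    moreover have "y \<in> ?N +>\<^bsub>A\<^esub> y" using y N.a_rcos_self by auto
    ultimately show ?thesis using central[OF V] u(1) by blast
  qed
  have "\<lbrace>a, y\<rbrace>\<^bsub>A\<^esub> \<in> ?N" using * a N.a_rcos_self by auto
  moreover have "\<lbrace>x \<oplus>\<^bsub>A\<^esub> a, y\<rbrace>\<^bsub>A\<^esub> \<in> ?N"
    using * a x xA by (auto simp: a_r_coset_def')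
  ultimately have "\<lbrace>x \<oplus>\<^bsub>A\<^esub> a, y\<rbrace>\<^bsub>A\<^esub> \<ominus>\<^bsub>A\<^esub> \<lbrace>a, y\<rbrace>\<^bsub>A\<^esub> \<in> ?N"
    by (simp add: a_minus_def N.a_closed N.a_inv_closed)
  moreover have "\<lbrace>x \<oplus>\<^bsub>A\<^esub> a, y\<rbrace>\<^bsub>A\<^esub> \<ominus>\<^bsub>A\<^esub> \<lbrace>a, y\<rbrace>\<^bsub>A\<^esub> = \<lbrace>x, y\<rbrace>\<^bsub>A\<^esub>"
    using a xA y
    by (simp add: pbracket_add_left pbracket_closed a_minus_def A.M.add.m_assoc A.M.r_neg)
  ultimately show False using xy by simp
qed

end


section \<open>Polynomial extensions and cancellation\<close>

text \<open>
  Polynomials in \<open>t\<^sub>0, \<dots>, t\<^sub>n\<^sub>-\<^sub>1\<close> over \<open>A\<close> are the indexed polynomials of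
  \<open>HOL-Algebra.Indexed_Polynomials\<close>: a monomial is a multiset of indices, a polynomial is its
  coefficient function. As the variables are Poisson central, the bracket is determined by
  \<open>\<lbrace>a t\<^sup>u, b t\<^sup>v\<rbrace> = \<lbrace>a, b\<rbrace> t\<^sup>u\<^sup>+\<^sup>v\<close>.
\<close>

definition mpoly_conv ::
    "('a, 'm) ring_scheme \<Rightarrow> ('a \<Rightarrow> 'a \<Rightarrow> 'a) \<Rightarrow>
     ('c multiset \<Rightarrow> 'a) \<Rightarrow> ('c multiset \<Rightarrow> 'a) \<Rightarrow> 'c multiset \<Rightarrow> 'a"
  where "mpoly_conv R f P Q = (\<lambda>m. \<Oplus>\<^bsub>R\<^esub>u \<in> {u. u \<subseteq># m}. f (P u) (Q (m - u)))"

definition poisson_poly ::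
    "('k, 'a, 'n) poisson_alg_scheme \<Rightarrow> nat \<Rightarrow> ('k, nat multiset \<Rightarrow> 'a) poisson_alg"
  where "poisson_poly A n =
    \<lparr>carrier = ring.indexed_pset A {..<n} (carrier A),
     monoid.mult = mpoly_conv A (monoid.mult A),
     one = ring.indexed_const A \<one>\<^bsub>A\<^esub>,
     ring.zero = ring.indexed_const A \<zero>\<^bsub>A\<^esub>,
     ring.add = ring.indexed_padd A,
     smult = (\<lambda>k P m. k \<odot>\<^bsub>A\<^esub> P m),
     pbracket = mpoly_conv A (pbracket A)\<rparr>"

context poisson_algebra
begin

lemma poisson_poly_bracket_const:
  assumes "a \<in> carrier A" "b \<in> carrier A"
  shows "\<lbrace>ring.indexed_const A a, ring.indexed_const A b\<rbrace>\<^bsub>poisson_poly A n\<^esub>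
         = ring.indexed_const A \<lbrace>a, b\<rbrace>\<^bsub>A\<^esub>"
proof
  fix m :: "nat multiset"
  interpret A: cring A by (rule M_cring)
  have "{u. u \<subseteq># m} \<subseteq> mset ` {xs. set xs \<subseteq> set_mset m \<and> length xs \<le> size m}"
  proof
    fix u assume "u \<in> {u. u \<subseteq># m}"
    moreover obtain xs where "u = mset xs" by (metis ex_mset)
    ultimately show "u \<in> mset ` {xs. set xs \<subseteq> set_mset m \<and> length xs \<le> size m}"
      using set_mset_mono[of u m] size_mset_mono[of u m] by auto
  qed
  then have fin: "finite {u. u \<subseteq># m}"
    using finite_lists_length_le[of "set_mset m" "size m"] finite_surj by auto
  have z: "\<lbrace>a, \<zero>\<^bsub>A\<^esub>\<rbrace>\<^bsub>A\<^esub> = \<zero>\<^bsub>A\<^esub>"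
    using pbracket_antisym[of a "\<zero>\<^bsub>A\<^esub>"] pbracket_zero_left[of a] assms by simp
  have "(\<Oplus>\<^bsub>A\<^esub>u \<in> {u. u \<subseteq># m}. \<lbrace>ring.indexed_const A a u, ring.indexed_const A b (m - u)\<rbrace>\<^bsub>A\<^esub>)
      = (\<Oplus>\<^bsub>A\<^esub>u \<in> {u. u \<subseteq># m}. if {#} = u then ring.indexed_const A \<lbrace>a, b\<rbrace>\<^bsub>A\<^esub> m else \<zero>\<^bsub>A\<^esub>)"
    using assms z
    by (intro A.M.finsum_cong')
      (auto simp: A.indexed_const_def pbracket_zero_left pbracket_closed)
  also have "\<dots> = ring.indexed_const A \<lbrace>a, b\<rbrace>\<^bsub>A\<^esub> m"
    using assms fin
    by (subst A.M.finsum_singleton)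
      (auto simp: A.indexed_const_def pbracket_closed)
  finally show "\<lbrace>ring.indexed_const A a, ring.indexed_const A b\<rbrace>\<^bsub>poisson_poly A n\<^esub> m
      = ring.indexed_const A \<lbrace>a, b\<rbrace>\<^bsub>A\<^esub> m"
    by (simp add: poisson_poly_def mpoly_conv_def)
qed

lemma pbracket_one_left:
  assumes "b \<in> carrier A" shows "\<lbrace>\<one>\<^bsub>A\<^esub>, b\<rbrace>\<^bsub>A\<^esub> = \<zero>\<^bsub>A\<^esub>"
proof -
  have c: "\<lbrace>b, \<one>\<^bsub>A\<^esub>\<rbrace>\<^bsub>A\<^esub> \<in> carrier A" using assms by (simp add: pbracket_closed)
  have "\<lbrace>b, \<one>\<^bsub>A\<^esub>\<rbrace>\<^bsub>A\<^esub> = \<lbrace>b, \<one>\<^bsub>A\<^esub>\<rbrace>\<^bsub>A\<^esub> \<oplus>\<^bsub>A\<^esub> \<lbrace>b, \<one>\<^bsub>A\<^esub>\<rbrace>\<^bsub>A\<^esub>"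
    using pbracket_leibniz[of b "\<one>\<^bsub>A\<^esub>" "\<one>\<^bsub>A\<^esub>"] assms c by simp
  then have "\<lbrace>b, \<one>\<^bsub>A\<^esub>\<rbrace>\<^bsub>A\<^esub> = \<zero>\<^bsub>A\<^esub>" using c A.M.add.l_cancel_one by metis
  then show ?thesis using pbracket_antisym[of "\<one>\<^bsub>A\<^esub>" b] assms by simp
qed

lemma poisson_poly_var_central:
  assumes "P \<in> carrier (poisson_poly A n)" "i < n"
  shows "ring.indexed_var A i \<in> carrier (poisson_poly A n)"
    and "\<lbrace>ring.indexed_var A i, P\<rbrace>\<^bsub>poisson_poly A n\<^esub> = \<zero>\<^bsub>poisson_poly A n\<^esub>"
proof -
  interpret A: cring A by (rule M_cring)
  show "ring.indexed_var A i \<in> carrier (poisson_poly A n)"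
    using assms(2) unfolding A.indexed_var_def
    by (auto simp: poisson_poly_def intro!: A.indexed_pset.indexed_pmult A.indexed_pset.indexed_const)
  have P: "P m \<in> carrier A" for m
    using assms(1) A.indexed_pset_in_carrier[of "carrier A" P] A.carrier_coeffE
    by (auto simp: poisson_poly_def)
  have "\<lbrace>ring.indexed_var A i u, P v\<rbrace>\<^bsub>A\<^esub> = \<zero>\<^bsub>A\<^esub>" for u v
    by (auto simp: A.indexed_var_def A.indexed_pmult_def A.indexed_const_def P
        pbracket_zero_left pbracket_one_left)
  then show "\<lbrace>ring.indexed_var A i, P\<rbrace>\<^bsub>poisson_poly A n\<^esub> = \<zero>\<^bsub>poisson_poly A n\<^esub>"
    by (auto simp: poisson_poly_def mpoly_conv_def A.indexed_const_def)
qed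

end

text \<open>
  The type argument carries the elements of the algebras \<open>B\<close>; leaving it a type variable in a
  theorem makes \<open>B\<close> range over all Poisson algebras.
\<close>

definition strongly_poisson_cancellative ::
    "('k, 'm) ring_scheme \<Rightarrow> ('k, 'a, 'n) poisson_alg_scheme \<Rightarrow> 'b itself \<Rightarrow> bool"
  where "strongly_poisson_cancellative K A (_ :: 'b itself) \<longleftrightarrow>
    (\<forall>n\<ge>1. \<forall>B :: ('k, 'b) poisson_alg.
      poisson_algebra K B \<longrightarrow>
      poisson_isomorphic K (poisson_poly A n) (poisson_poly B n) \<longrightarrow>
      poisson_isomorphic K A B)"

end

theory Submission
  imports Defs "HOL-Library.Multiset_Order"
begin

text \<open>
  Let \<open>h\<close> be an isomorphism from \<open>A[t\<^sub>1, \<dots>, t\<^sub>n]\<close> to \<open>B[t\<^sub>1, \<dots>, t\<^sub>n]\<close> and \<open>s\<^sub>i = h t\<^sub>i\<close>. All that has to be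
  shown is that the \<open>s\<^sub>i\<close> are coordinates of \<open>B[t]\<close>, that is, \<open>B[t] = B[s]\<close>; then \<open>A\<close>, the quotient of
  \<open>A[t]\<close> by the ideal of the \<open>t\<^sub>i\<close>, is isomorphic to \<open>B\<close>, the quotient of \<open>B[s]\<close> by the ideal of the
  \<open>s\<^sub>i\<close>, as Poisson algebras.

  Each of the artinian conditions implies that every Poisson central \<open>a \<in> A\<close> is von Neumann regular
  up to nilpotents: \<open>a - a\<^sup>2 c\<close> is nilpotent for some \<open>c \<in> A\<close>, because the chain of ideals generated by the
  powers of \<open>a\<close>, or of its image in \<open>A\<^sub>r\<^sub>e\<^sub>d\<close>, becomes stationary (\<open>center_regular_mod_nil\<close>). Over a
  domain, a polynomial \<open>f\<close> with \<open>f = f\<^sup>2 g\<close> is \<open>0\<close> or a unit, hence constant. Applied modulo all prime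
  ideals of \<open>B\<close>, this shows that \<open>h a\<close> is an element of \<open>B\<close> up to nilpotent coefficients
  (\<open>regular_constant_mod_nil\<close>).

  The variables \<open>t\<^sub>i\<close> of \<open>B[t]\<close> are Poisson central. So the polynomial \<open>h\<^sup>-\<^sup>1 t\<^sub>i\<close> has Poisson central
  coefficients, and applying \<open>h\<close> to it expresses \<open>t\<^sub>i\<close> as a polynomial in the \<open>s\<^sub>i\<close> over \<open>B\<close>, up to
  nilpotent coefficients. Only finitely many nilpotents of \<open>B\<close> occur, and Nakayama's lemma removes them
  (\<open>subring_eq_carrier_mod_nil\<close>). Hence the \<open>s\<^sub>i\<close> generate \<open>B[t]\<close>.

  It remains to see that \<open>n\<close> generators of \<open>B[t\<^sub>1, \<dots>, t\<^sub>n]\<close> are coordinates, or rather the consequence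
  that \<open>B\<close> meets the ideal generated by the \<open>s\<^sub>i\<close> in \<open>0\<close> (\<open>constant_in_generator_ideal_zero\<close>). Comparing
  linear parts, generation yields a left inverse of the matrix of linear coefficients of the \<open>s\<^sub>i\<close>.
  Over a commutative ring this is a two-sided inverse (\<open>matrix_right_inverse\<close>), so an affine change of
  the generators makes them \<open>t\<^sub>i\<close> plus terms of higher degree, and substituting such polynomials for the
  variables is injective (\<open>unipotent_substitution_inj\<close>).
\<close>

section \<open>The polynomial ring as a ring of convolutions\<close>

text \<open>The commutative ring underlying \<^const>\<open>poisson_poly\<close>, split off because most of the argument
  concerns rings only.\<close>

definition mpoly :: "('a, 'm) ring_scheme \<Rightarrow> nat \<Rightarrow> (nat multiset \<Rightarrow> 'a) ring"
  where "mpoly R n =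
    \<lparr>carrier = ring.indexed_pset R {..<n} (carrier R),
     monoid.mult = mpoly_conv R (monoid.mult R),
     one = ring.indexed_const R \<one>\<^bsub>R\<^esub>,
     ring.zero = ring.indexed_const R \<zero>\<^bsub>R\<^esub>,
     ring.add = ring.indexed_padd R\<rparr>"

lemma finite_submultisets: "finite {u. u \<subseteq># m}"
proof -
  have "{u. u \<subseteq># m} \<subseteq> mset ` {xs. set xs \<subseteq> set_mset m \<and> length xs \<le> size m}"
  proof
    fix u assume "u \<in> {u. u \<subseteq># m}"
    moreover obtain xs where "u = mset xs" by (metis ex_mset)
    ultimately show "u \<in> mset ` {xs. set xs \<subseteq> set_mset m \<and> length xs \<le> size m}"
      using set_mset_mono[of u m] size_mset_mono[of u m] by auto
  qed
  then show ?thesis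
    using finite_lists_length_le[of "set_mset m" "size m"] finite_surj by auto
qed

context cring
begin

lemma mpoly_pset_coeff: "p \<in> indexed_pset I (carrier R) \<Longrightarrow> carrier_coeff p"
  using indexed_pset_in_carrier by blast

text \<open>The product and the bracket of polynomials are convolutions of the product and the bracket of
  coefficients. Being biadditive is what the two operations on coefficients have in common, and it
  is enough to compute convolutions along the generation of polynomials by constants, sums and
  multiplication by variables.\<close>

definition biadditive :: "('a \<Rightarrow> 'a \<Rightarrow> 'a) \<Rightarrow> bool"
  where "biadditive f \<longleftrightarrow>
    (\<forall>a\<in>carrier R. \<forall>b\<in>carrier R. f a b \<in> carrier R) \<and>
    (\<forall>a\<in>carrier R. \<forall>b\<in>carrier R. \<forall>c\<in>carrier R.
      f (a \<oplus> b) c = f a c \<oplus> f b c \<and> f a (b \<oplus> c) = f a b \<oplus> f a c)"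

lemma biadditive_mult: "biadditive (\<otimes>)"
  by (auto simp: biadditive_def l_distr r_distr)

context
  fixes f assumes f: "biadditive f"
begin

lemma biadditive_closed: "a \<in> carrier R \<Longrightarrow> b \<in> carrier R \<Longrightarrow> f a b \<in> carrier R"
  using f by (auto simp: biadditive_def)

lemma biadditive_zero:
  assumes "a \<in> carrier R" shows "f \<zero> a = \<zero>" "f a \<zero> = \<zero>"
proof -
  have "f \<zero> a \<oplus> f \<zero> a = f (\<zero> \<oplus> \<zero>) a" "f a \<zero> \<oplus> f a \<zero> = f a (\<zero> \<oplus> \<zero>)"
    using f assms unfolding biadditive_def by (metis zero_closed)+
  then have "f \<zero> a \<oplus> f \<zero> a = f \<zero> a" "f a \<zero> \<oplus> f a \<zero> = f a \<zero>" by simp_all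
  then show "f \<zero> a = \<zero>" "f a \<zero> = \<zero>"
    using assms biadditive_closed add.l_cancel_one by simp_all
qed

lemma mpoly_conv_closed:
  assumes "carrier_coeff p" "carrier_coeff q"
  shows "carrier_coeff (mpoly_conv R f p q)"
  using assms unfolding carrier_coeff_def mpoly_conv_def
  by (auto intro!: finsum_closed biadditive_closed)

lemma mpoly_conv_const_left:
  assumes "a \<in> carrier R" "carrier_coeff q"
  shows "mpoly_conv R f (indexed_const a) q = (\<lambda>m. f a (q m))"
proof
  fix m :: "'c multiset"
  have c: "q u \<in> carrier R" for u using assms by (auto simp: carrier_coeff_def)
  have "mpoly_conv R f (indexed_const a) q m
      = (\<Oplus>u\<in>{u. u \<subseteq># m}. if {#} = u then f a (q m) else \<zero>)"
    unfolding mpoly_conv_def using assms(1) c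
    by (intro finsum_cong') (auto simp: indexed_const_def biadditive_zero biadditive_closed)
  also have "\<dots> = f a (q m)"
    using assms(1) c finite_submultisets by (subst finsum_singleton) (auto intro: biadditive_closed)
  finally show "mpoly_conv R f (indexed_const a) q m = f a (q m)" .
qed

lemma mpoly_conv_const_right:
  assumes "a \<in> carrier R" "carrier_coeff p"
  shows "mpoly_conv R f p (indexed_const a) = (\<lambda>m. f (p m) a)"
proof
  fix m :: "'c multiset"
  have c: "p u \<in> carrier R" for u using assms by (auto simp: carrier_coeff_def)
  have only: "m - u \<noteq> {#}" if "u \<subseteq># m" "m \<noteq> u" for u
    using that by (metis add.right_neutral subset_mset.add_diff_inverse)
  have "mpoly_conv R f p (indexed_const a) m
      = (\<Oplus>u\<in>{u. u \<subseteq># m}. if m = u then f (p m) a else \<zero>)"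
    unfolding mpoly_conv_def using assms(1) c only
    by (intro finsum_cong') (auto simp: indexed_const_def biadditive_zero biadditive_closed)
  also have "\<dots> = f (p m) a"
    using assms(1) c finite_submultisets by (subst finsum_singleton) (auto intro: biadditive_closed)
  finally show "mpoly_conv R f p (indexed_const a) m = f (p m) a" .
qed

lemma mpoly_conv_padd_left:
  assumes "carrier_coeff p" "carrier_coeff p'" "carrier_coeff q"
  shows "mpoly_conv R f (indexed_padd p p') q
    = indexed_padd (mpoly_conv R f p q) (mpoly_conv R f p' q)"
proof
  fix m
  have "p u \<in> carrier R" "p' u \<in> carrier R" "q u \<in> carrier R" for u
    using assms by (auto simp: carrier_coeff_def)
  then show "mpoly_conv R f (indexed_padd p p') q m
    = indexed_padd (mpoly_conv R f p q) (mpoly_conv R f p' q) m"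
    unfolding mpoly_conv_def indexed_padd_def
    by (subst finsum_addf[symmetric]) (use f in \<open>auto simp: biadditive_def intro!: finsum_cong'\<close>)
qed

lemma mpoly_conv_pmult_left:
  assumes "carrier_coeff p" "carrier_coeff q"
  shows "mpoly_conv R f (indexed_pmult p i) q = indexed_pmult (mpoly_conv R f p q) i"
proof
  fix m
  have c: "p u \<in> carrier R" "q u \<in> carrier R" for u
    using assms by (auto simp: carrier_coeff_def)
  show "mpoly_conv R f (indexed_pmult p i) q m = indexed_pmult (mpoly_conv R f p q) i m"
  proof (cases "i \<in># m")
    case False
    have "f (indexed_pmult p i u) (q (m - u)) = \<zero>" if "u \<subseteq># m" for u
      using False that c by (auto simp: indexed_pmult_def biadditive_zero dest: mset_subset_eqD)
    then have "mpoly_conv R f (indexed_pmult p i) q m = (\<Oplus>u\<in>{u. u \<subseteq># m}. \<zero>)"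
      unfolding mpoly_conv_def by (intro finsum_cong') auto
    then show ?thesis using False by (simp add: indexed_pmult_def)
  next
    case True
    then obtain m' where m: "m = add_mset i m'" by (metis insert_DiffM)
    have sub: "add_mset i ` {u. u \<subseteq># m'} \<subseteq> {u. u \<subseteq># m}" by (auto simp: m)
    have out: "f (indexed_pmult p i u) (q (m - u)) = \<zero>" 
      if "u \<in> {u. u \<subseteq># m} - add_mset i ` {u. u \<subseteq># m'}" for u
    proof -
      have "i \<notin># u"
      proof
        assume "i \<in># u"
        then obtain u' where "u = add_mset i u'" by (metis insert_DiffM)
        then show False using that m by auto
      qed
      then show ?thesis using c by (simp add: indexed_pmult_def biadditive_zero)
    qed
    have c': "f (indexed_pmult p i u) (q v) \<in> carrier R" for u v
      using c by (auto simp: indexed_pmult_def intro!: biadditive_closed)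
    have "mpoly_conv R f (indexed_pmult p i) q m
        = (\<Oplus>u\<in>add_mset i ` {u. u \<subseteq># m'}. f (indexed_pmult p i u) (q (m - u)))"
      unfolding mpoly_conv_def 
      by (rule add.finprod_mono_neutral_cong_left[symmetric]) (use sub out finite_submultisets c' in auto)
    also have "\<dots> = (\<Oplus>u\<in>{u. u \<subseteq># m'}. f (indexed_pmult p i (add_mset i u)) (q (m - add_mset i u)))"
      by (rule finsum_reindex) (use c' in \<open>auto simp: inj_on_def\<close>)
    also have "\<dots> = indexed_pmult (mpoly_conv R f p q) i m"
      using c by (auto simp: indexed_pmult_def m mpoly_conv_def intro!: finsum_cong' biadditive_closed)
    finally show ?thesis .
  qed
qed

lemma mpoly_conv_pset:
  fixes p q :: "'c multiset \<Rightarrow> 'a"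
  assumes "p \<in> indexed_pset I (carrier R)" "q \<in> indexed_pset I (carrier R)"
  shows "mpoly_conv R f p q \<in> indexed_pset I (carrier R)"
  using assms(1)
proof (induction p rule: indexed_pset.induct)
  case (indexed_const a)
  have "(\<lambda>m. f a (q m)) \<in> indexed_pset I (carrier R)"
    using assms(2)
  proof (induction q rule: indexed_pset.induct)
    case (indexed_const k)
    have "(\<lambda>m :: 'c multiset. f a (indexed_const k m)) = indexed_const (f a k)"
      using \<open>a \<in> carrier R\<close> by (auto simp: indexed_const_def biadditive_zero)
    moreover have "indexed_const (f a k) \<in> indexed_pset I (carrier R)"
      by (rule indexed_pset.indexed_const) (use indexed_const \<open>a \<in> carrier R\<close> biadditive_closed in simp)
    ultimately show ?case by simp
  next
    case (indexed_padd p q)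
    have "(\<lambda>m. f a (indexed_padd p q m)) = indexed_padd (\<lambda>m. f a (p m)) (\<lambda>m. f a (q m))"
      using \<open>a \<in> carrier R\<close> mpoly_pset_coeff[OF indexed_padd(1)] mpoly_pset_coeff[OF indexed_padd(2)]
      f by (auto simp: indexed_padd_def carrier_coeff_def biadditive_def)
    then show ?case using indexed_padd indexed_pset.indexed_padd by auto
  next
    case (indexed_pmult p i)
    have "(\<lambda>m. f a (indexed_pmult p i m)) = indexed_pmult (\<lambda>m. f a (p m)) i"
      using \<open>a \<in> carrier R\<close> by (auto simp: indexed_pmult_def biadditive_zero)
    then show ?case using indexed_pmult indexed_pset.indexed_pmult by auto
  qed
  then show ?case
    using indexed_const mpoly_conv_const_left[OF _ mpoly_pset_coeff[OF assms(2)]] by simp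
next
  case (indexed_padd p p')
  then show ?case
    using assms(2) by (auto simp: mpoly_conv_padd_left mpoly_pset_coeff intro!: indexed_pset.indexed_padd)
next
  case (indexed_pmult p i)
  then show ?case
    using assms(2) by (auto simp: mpoly_conv_pmult_left mpoly_pset_coeff intro!: indexed_pset.indexed_pmult)
qed

end

text \<open>Complementation \<open>u \<mapsto> m - u\<close> is an involution of the submultisets of \<open>m\<close>.\<close>

lemma mpoly_conv_comm:
  assumes "carrier_coeff p" "carrier_coeff q"
  shows "mpoly_conv R (\<otimes>) p q = mpoly_conv R (\<otimes>) q p"
proof
  fix m :: "'c multiset"
  have c: "p u \<in> carrier R" "q u \<in> carrier R" for u
    using assms by (auto simp: carrier_coeff_def)
  have inj: "inj_on (\<lambda>u. m - u) {u. u \<subseteq># m}"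
    by (rule inj_on_inverseI[where g = "\<lambda>u. m - u"]) (auto simp: multiset_eq_iff subseteq_mset_def)
  have img: "(\<lambda>u. m - u) ` {u. u \<subseteq># m} = {u. u \<subseteq># m}"
  proof (intro equalityI subsetI)
    fix u assume u: "u \<in> {u. u \<subseteq># m}"
    then have "u = m - (m - u)" by (auto simp: multiset_eq_iff subseteq_mset_def)
    then show "u \<in> (\<lambda>u. m - u) ` {u. u \<subseteq># m}" by (intro image_eqI[of _ _ "m - u"]) auto
  qed auto
  have "mpoly_conv R (\<otimes>) p q m = (\<Oplus>u\<in>(\<lambda>u. m - u) ` {u. u \<subseteq># m}. p u \<otimes> q (m - u))"
    unfolding mpoly_conv_def img ..
  also have "\<dots> = (\<Oplus>u\<in>{u. u \<subseteq># m}. p (m - u) \<otimes> q (m - (m - u)))"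
    by (rule finsum_reindex[OF _ inj]) (auto simp: c)
  also have "\<dots> = mpoly_conv R (\<otimes>) q p m"
    unfolding mpoly_conv_def
  proof (rule finsum_cong')
    fix u assume "u \<in> {u. u \<subseteq># m}"
    then have "m - (m - u) = u" by (auto simp: multiset_eq_iff subseteq_mset_def)
    then show "p (m - u) \<otimes> q (m - (m - u)) = q u \<otimes> p (m - u)" by (simp add: c m_comm)
  qed (auto simp: c)
  finally show "mpoly_conv R (\<otimes>) p q m = mpoly_conv R (\<otimes>) q p m" .
qed

text \<open>Induction along the generation of \<open>p\<close> leaves only constant left factors, which can be pulled out
  of sums. This avoids manipulating triple sums.\<close>

lemma mpoly_conv_assoc:
  assumes "p \<in> indexed_pset I (carrier R)" "carrier_coeff q" "carrier_coeff r"
  shows "mpoly_conv R (\<otimes>) (mpoly_conv R (\<otimes>) p q) r = mpoly_conv R (\<otimes>) p (mpoly_conv R (\<otimes>) q r)"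
  using assms(1)
proof (induction p rule: indexed_pset.induct)
  case (indexed_const a)
  have c: "q u \<in> carrier R" "r u \<in> carrier R" for u
    using assms by (auto simp: carrier_coeff_def)
  have "mpoly_conv R (\<otimes>) (\<lambda>m. a \<otimes> q m) r = (\<lambda>m. a \<otimes> mpoly_conv R (\<otimes>) q r m)"
    unfolding mpoly_conv_def using indexed_const c
    by (auto simp: finsum_rdistr finite_submultisets m_assoc intro!: finsum_cong')
  then show ?case
    using indexed_const assms by (simp add: mpoly_conv_const_left[OF biadditive_mult] mpoly_conv_closed[OF biadditive_mult])
next
  case (indexed_padd p p')
  then show ?case
    using assms by (simp add: mpoly_conv_padd_left[OF biadditive_mult] mpoly_conv_closed[OF biadditive_mult] mpoly_pset_coeff)
next
  case (indexed_pmult p i)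
  then show ?case
    using assms by (simp add: mpoly_conv_pmult_left[OF biadditive_mult] mpoly_conv_closed[OF biadditive_mult] mpoly_pset_coeff)
qed

lemma finite_support_pset:
  assumes "p \<in> indexed_pset I (carrier R)" shows "finite {m. p m \<noteq> \<zero>}"
  using assms
proof (induction p rule: indexed_pset.induct)
  case (indexed_const k)
  have "{m. indexed_const k m \<noteq> \<zero>} \<subseteq> {{#}}" by (auto simp: indexed_const_def)
  then show ?case by (rule finite_subset) simp
next
  case (indexed_padd p q)
  have "{m. indexed_padd p q m \<noteq> \<zero>} \<subseteq> {m. p m \<noteq> \<zero>} \<union> {m. q m \<noteq> \<zero>}"
    by (auto simp: indexed_padd_def)
  then show ?case by (rule finite_subset) (use indexed_padd in simp)
next
  case (indexed_pmult p i)
  have "{m. indexed_pmult p i m \<noteq> \<zero>} \<subseteq> add_mset i ` {m. p m \<noteq> \<zero>}"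
  proof
    fix m assume "m \<in> {m. indexed_pmult p i m \<noteq> \<zero>}"
    then have "m = add_mset i (m - {#i#})" "p (m - {#i#}) \<noteq> \<zero>"
      by (auto simp: indexed_pmult_def split: if_splits)
    then show "m \<in> add_mset i ` {m. p m \<noteq> \<zero>}" by blast
  qed
  then show ?case by (rule finite_subset) (use indexed_pmult in simp)
qed

lemma cring_mpoly: "cring (mpoly R n)"
proof (rule cringI)
  show "abelian_group (mpoly R n)"
  proof (rule abelian_groupI)
    fix p assume p: "p \<in> carrier (mpoly R n)"
    let ?q = "mpoly_conv R (\<otimes>) (indexed_const (\<ominus> \<one>)) p"
    have "?q \<in> carrier (mpoly R n)"
      using p by (auto simp: mpoly_def intro!: mpoly_conv_pset[OF biadditive_mult] indexed_pset.indexed_const)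
    moreover have "?q \<oplus>\<^bsub>mpoly R n\<^esub> p = \<zero>\<^bsub>mpoly R n\<^esub>"
    proof -
      have c: "carrier_coeff p" using p by (auto simp: mpoly_def mpoly_pset_coeff)
      then have "mpoly_conv R (\<otimes>) (indexed_const (\<ominus> \<one>)) p = (\<lambda>m. \<ominus> \<one> \<otimes> p m)"
        by (simp add: mpoly_conv_const_left[OF biadditive_mult])
      then show ?thesis using c
        by (auto simp: mpoly_def indexed_padd_def indexed_const_def carrier_coeff_def l_minus l_neg)
    qed
    ultimately show "\<exists>y\<in>carrier (mpoly R n). y \<oplus>\<^bsub>mpoly R n\<^esub> p = \<zero>\<^bsub>mpoly R n\<^esub>" by blast
  next
    fix p q r assume "p \<in> carrier (mpoly R n)" "q \<in> carrier (mpoly R n)" "r \<in> carrier (mpoly R n)"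
    then have "p m \<in> carrier R" "q m \<in> carrier R" "r m \<in> carrier R" for m
      using mpoly_pset_coeff by (fastforce simp: mpoly_def carrier_coeff_def)+
    then show "p \<oplus>\<^bsub>mpoly R n\<^esub> q \<oplus>\<^bsub>mpoly R n\<^esub> r = p \<oplus>\<^bsub>mpoly R n\<^esub> (q \<oplus>\<^bsub>mpoly R n\<^esub> r)"
      "p \<oplus>\<^bsub>mpoly R n\<^esub> q = q \<oplus>\<^bsub>mpoly R n\<^esub> p" "\<zero>\<^bsub>mpoly R n\<^esub> \<oplus>\<^bsub>mpoly R n\<^esub> p = p"
      by (auto simp: mpoly_def indexed_padd_def indexed_const_def a_ac)
  qed (auto simp: mpoly_def intro!: indexed_pset.indexed_padd indexed_pset.indexed_const)
  show "comm_monoid (mpoly R n)"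
  proof (rule comm_monoidI)
    fix p assume p: "p \<in> carrier (mpoly R n)"
    show "\<one>\<^bsub>mpoly R n\<^esub> \<otimes>\<^bsub>mpoly R n\<^esub> p = p"
      using p mpoly_pset_coeff[of p] by (auto simp: mpoly_def mpoly_conv_const_left[OF biadditive_mult] carrier_coeff_def)
  qed (auto simp: mpoly_def mpoly_pset_coeff intro!: mpoly_conv_pset[OF biadditive_mult] mpoly_conv_assoc mpoly_conv_comm
        indexed_pset.indexed_const)
qed (auto simp: mpoly_def mpoly_pset_coeff mpoly_conv_padd_left[OF biadditive_mult])

end

locale mpoly_cring = cring R for R :: "('a, 'm) ring_scheme" (structure) +
  fixes n :: nat and P :: "(nat multiset \<Rightarrow> 'a) ring" (structure)
  defines P_def: "P \<equiv> mpoly R n"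

context mpoly_cring
begin

lemma P_coeff [intro, simp]: "p \<in> carrier P \<Longrightarrow> p m \<in> carrier R"
  using mpoly_pset_coeff[of p] by (auto simp: P_def mpoly_def carrier_coeff_def)

lemma add_coeff: "(p \<oplus>\<^bsub>P\<^esub> q) m = p m \<oplus> q m"
  by (auto simp: P_def mpoly_def indexed_padd_def)

lemma mult_coeff: "(p \<otimes>\<^bsub>P\<^esub> q) m = (\<Oplus>u\<in>{u. u \<subseteq># m}. p u \<otimes> q (m - u))"
  by (auto simp: P_def mpoly_def mpoly_conv_def)

lemma zero_coeff: "\<zero>\<^bsub>P\<^esub> m = \<zero>"
  by (auto simp: P_def mpoly_def indexed_const_def)

lemma one_P: "\<one>\<^bsub>P\<^esub> = indexed_const \<one>"
  by (auto simp: P_def mpoly_def)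

lemma const_coeff: "indexed_const a m = (if m = {#} then a else \<zero>)"
  by (simp add: indexed_const_def)

lemma P_cring: "cring P" unfolding P_def by (rule cring_mpoly)

sublocale P: cring P by (rule P_cring)

lemma const_closed [intro, simp]: "a \<in> carrier R \<Longrightarrow> indexed_const a \<in> carrier P"
  by (auto simp: P_def mpoly_def intro: indexed_pset.indexed_const)

lemma const_hom: "indexed_const \<in> ring_hom R P"
proof (rule ring_hom_memI)
  fix a b assume a: "a \<in> carrier R" "b \<in> carrier R"
  have "carrier_coeff (indexed_const b :: nat multiset \<Rightarrow> 'a)" using a by (auto simp: carrier_coeff_def indexed_const_def)
  then show "indexed_const (a \<otimes> b) = indexed_const a \<otimes>\<^bsub>P\<^esub> indexed_const b"
    using a mpoly_conv_const_left[OF biadditive_mult, of a "indexed_const b :: nat multiset \<Rightarrow> 'a"]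
    by (simp add: P_def mpoly_def) (auto simp: indexed_const_def)
qed (auto simp: one_P fun_eq_iff const_coeff add_coeff)

lemma const_mult_coeff: 
  "a \<in> carrier R \<Longrightarrow> q \<in> carrier P \<Longrightarrow> (indexed_const a \<otimes>\<^bsub>P\<^esub> q) m = a \<otimes> q m"
  using mpoly_pset_coeff[of q] by (auto simp: P_def mpoly_def mpoly_conv_const_left[OF biadditive_mult])

lemma var_closed [intro, simp]: "i < n \<Longrightarrow> indexed_var i \<in> carrier P"
  by (auto simp: P_def mpoly_def indexed_var_def intro!: indexed_pset.intros)

lemma var_coeff: "indexed_var i m = (if m = {#i#} then \<one> else \<zero>)"
  by (auto simp: indexed_var_def indexed_pmult_def indexed_const_def dest: insert_DiffM)

lemma var_times: "q \<in> carrier P \<Longrightarrow> indexed_var i \<otimes>\<^bsub>P\<^esub> q = indexed_pmult q i"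
proof -
  assume q: "q \<in> carrier P"
  then have c: "carrier_coeff q" by (auto simp: carrier_coeff_def)
  have "carrier_coeff (indexed_const \<one>)" by (auto simp: carrier_coeff_def indexed_const_def)
  then have "indexed_var i \<otimes>\<^bsub>P\<^esub> q = indexed_pmult (mpoly_conv R (\<otimes>) (indexed_const \<one>) q) i"
    unfolding indexed_var_def using c mpoly_conv_pmult_left[OF biadditive_mult, of "indexed_const \<one>" q i] by (simp add: P_def mpoly_def)
  also have "mpoly_conv R (\<otimes>) (indexed_const \<one>) q = q" 
    using c q by (auto simp: mpoly_conv_const_left[OF biadditive_mult])
  finally show ?thesis .
qed

lemma P_induct [consumes 1, case_names const add var_mult]:
  assumes "p \<in> carrier P"
    and const: "\<And>a. a \<in> carrier R \<Longrightarrow> Q (indexed_const a)"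
    and add: "\<And>p q. \<lbrakk>p \<in> carrier P; q \<in> carrier P; Q p; Q q\<rbrakk> \<Longrightarrow> Q (p \<oplus>\<^bsub>P\<^esub> q)"
    and mult: "\<And>p i. \<lbrakk>p \<in> carrier P; i < n; Q p\<rbrakk> \<Longrightarrow> Q (indexed_var i \<otimes>\<^bsub>P\<^esub> p)"
  shows "Q p"
proof -
  have "p \<in> indexed_pset {..<n} (carrier R)" using assms(1) by (simp add: P_def mpoly_def)
  then show ?thesis
  proof (induction p rule: indexed_pset.induct)
    case (indexed_const k) then show ?case by (rule const)
  next
    case (indexed_padd p q)
    then show ?case using add[of p q] by (auto simp: P_def mpoly_def)
  next
    case (indexed_pmult p i)
    then have "p \<in> carrier P" by (auto simp: P_def mpoly_def)
    then show ?case using mult[of p i] var_times[of p i] indexed_pmult by auto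
  qed
qed

lemma finite_support: "p \<in> carrier P \<Longrightarrow> finite {m. p m \<noteq> \<zero>}"
  using finite_support_pset[of p] by (auto simp: P_def mpoly_def)

lemma minus_coeff: "p \<in> carrier P \<Longrightarrow> (\<ominus>\<^bsub>P\<^esub> p) m = \<ominus> p m"
proof -
  assume p: "p \<in> carrier P"
  have "(\<ominus>\<^bsub>P\<^esub> p \<oplus>\<^bsub>P\<^esub> p) m = \<zero>" using p zero_coeff by (simp add: P.l_neg)
  then show ?thesis using p by (simp add: add_coeff minus_equality)
qed

lemma diff_coeff: "q \<in> carrier P \<Longrightarrow> (p \<ominus>\<^bsub>P\<^esub> q) m = p m \<ominus> q m"
  unfolding P.minus_eq add_coeff a_minus_def by (subst minus_coeff) simp_all

lemma one_coeff: "\<one>\<^bsub>P\<^esub> m = (if m = {#} then \<one> else \<zero>)"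
  unfolding one_P const_coeff ..

lemma support_vars: "p \<in> carrier P \<Longrightarrow> p m \<noteq> \<zero> \<Longrightarrow> set_mset m \<subseteq> {..<n}"
proof (induction p arbitrary: m rule: P_induct)
  case (add p q)
  then show ?case by (cases "p m = \<zero>") (auto simp: add_coeff)
next
  case (var_mult p i)
  then have "i \<in># m" "p (m - {#i#}) \<noteq> \<zero>" 
    using var_times[of p i] var_mult by (auto simp: indexed_pmult_def split: if_splits)
  then show ?case using var_mult by (metis insert_DiffM set_mset_add_mset_insert insert_subset lessThan_iff)
qed (auto simp: const_coeff split: if_splits)

end

section \<open>Evaluation of polynomials\<close>

text \<open>The product runs over all \<open>n\<close> variables rather than over those occurring in \<open>m\<close>, so that factors of
  different monomials can be multiplied index by index. Indices \<open>i \<ge> n\<close> do not contribute.\<close>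

definition monomial_eval :: "('b, 'l) ring_scheme \<Rightarrow> nat \<Rightarrow> (nat \<Rightarrow> 'b) \<Rightarrow> nat multiset \<Rightarrow> 'b"
  where "monomial_eval T n v m = finprod T (\<lambda>i. v i [^]\<^bsub>T\<^esub> count m i) {..<n}"

definition poly_eval ::
    "('a, 'm) ring_scheme \<Rightarrow> ('b, 'l) ring_scheme \<Rightarrow> nat \<Rightarrow> ('a \<Rightarrow> 'b) \<Rightarrow> (nat \<Rightarrow> 'b) \<Rightarrow>
     (nat multiset \<Rightarrow> 'a) \<Rightarrow> 'b"
  where "poly_eval R T n f v p =
    finsum T (\<lambda>m. f (p m) \<otimes>\<^bsub>T\<^esub> monomial_eval T n v m) {m. p m \<noteq> \<zero>\<^bsub>R\<^esub>}"

lemma (in cring) monomial_eval_closed [intro, simp]: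
  "(\<And>i. i < n \<Longrightarrow> v i \<in> carrier R) \<Longrightarrow> monomial_eval R n v m \<in> carrier R"
  unfolding monomial_eval_def by (intro finprod_closed) auto

lemma (in cring) monomial_eval_empty [simp]: "monomial_eval R n v {#} = \<one>"
  unfolding monomial_eval_def by (intro finprod_one_eqI) auto

lemma (in cring) monomial_eval_add_mset:
  assumes v: "\<And>i. i < n \<Longrightarrow> v i \<in> carrier R" and i: "i < n"
  shows "monomial_eval R n v (add_mset i m) = v i \<otimes> monomial_eval R n v m"
proof -
  have "v i \<otimes> monomial_eval R n v m
      = (\<Otimes>j\<in>{..<n}. if i = j then v j else \<one>) \<otimes> (\<Otimes>j\<in>{..<n}. v j [^] count m j)"
    unfolding monomial_eval_def using v i by (subst finprod_singleton) auto
  also have "\<dots> = (\<Otimes>j\<in>{..<n}. (if i = j then v j else \<one>) \<otimes> v j [^] count m j)"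
    using v by (subst finprod_multf) auto
  also have "\<dots> = monomial_eval R n v (add_mset i m)"
    unfolding monomial_eval_def using v
    by (intro finprod_cong') (auto simp: m_comm)
  finally show ?thesis by simp
qed

locale mpoly_eval = mpoly_cring R n P + T: cring T
    for R :: "('a, 'm) ring_scheme" (structure) and n and P (structure)
      and T :: "('b, 'l) ring_scheme" (structure) +
  fixes f :: "'a \<Rightarrow> 'b" and v :: "nat \<Rightarrow> 'b" and E
  assumes f_hom: "f \<in> ring_hom R T" and v_closed: "i < n \<Longrightarrow> v i \<in> carrier T"
  defines E_def: "E \<equiv> poly_eval R T n f v"
begin

lemma f_closed [intro, simp]: "a \<in> carrier R \<Longrightarrow> f a \<in> carrier T"
  using ring_hom_closed[OF f_hom] by simp

lemma f_zero [simp]: "f \<zero>\<^bsub>R\<^esub> = \<zero>\<^bsub>T\<^esub>"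
proof -
  interpret ring_hom_ring R T f
    by (rule ring_hom_ringI2[OF ring_axioms T.ring_axioms f_hom])
  show ?thesis by simp
qed

lemma mon_closed [intro, simp]: "monomial_eval T n v m \<in> carrier T"
  using v_closed by auto

text \<open>Polynomials with different supports can only be added after summing over a common index set.\<close>

lemma E_superset:
  assumes p: "p \<in> carrier P" and F: "finite F" "{m. p m \<noteq> \<zero>\<^bsub>R\<^esub>} \<subseteq> F"
  shows "E p = (\<Oplus>\<^bsub>T\<^esub>m\<in>F. f (p m) \<otimes>\<^bsub>T\<^esub> monomial_eval T n v m)"
  unfolding E_def poly_eval_def
  by (rule T.add.finprod_mono_neutral_cong_left) (use F p in auto)

lemma E_closed [intro, simp]: "p \<in> carrier P \<Longrightarrow> E p \<in> carrier T"
  unfolding E_def poly_eval_def by (intro T.finsum_closed) auto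

lemma E_const [simp]: assumes "a \<in> carrier R" shows "E (indexed_const a) = f a"
proof -
  have "E (indexed_const a) = (\<Oplus>\<^bsub>T\<^esub>m\<in>{{#}}. f (indexed_const a m) \<otimes>\<^bsub>T\<^esub> monomial_eval T n v m)"
    by (rule E_superset) (use assms in \<open>auto simp: const_coeff split: if_splits\<close>)
  also have "\<dots> = f a" using assms by (simp add: const_coeff)
  finally show ?thesis .
qed

lemma E_add: assumes p: "p \<in> carrier P" and q: "q \<in> carrier P"
  shows "E (p \<oplus>\<^bsub>P\<^esub> q) = E p \<oplus>\<^bsub>T\<^esub> E q"
proof -
  let ?F = "{m. p m \<noteq> \<zero>\<^bsub>R\<^esub>} \<union> {m. q m \<noteq> \<zero>\<^bsub>R\<^esub>}"
  let ?M = "monomial_eval T n v"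
  have F: "finite ?F" using p q finite_support by auto
  have "E (p \<oplus>\<^bsub>P\<^esub> q) = (\<Oplus>\<^bsub>T\<^esub>m\<in>?F. f ((p \<oplus>\<^bsub>P\<^esub> q) m) \<otimes>\<^bsub>T\<^esub> ?M m)"
    by (rule E_superset) (use F p q in \<open>auto simp: add_coeff\<close>)
  also have "\<dots> = (\<Oplus>\<^bsub>T\<^esub>m\<in>?F. f (p m) \<otimes>\<^bsub>T\<^esub> ?M m \<oplus>\<^bsub>T\<^esub> f (q m) \<otimes>\<^bsub>T\<^esub> ?M m)"
    by (rule T.finsum_cong') (use p q in \<open>auto simp: add_coeff ring_hom_add[OF f_hom] T.l_distr\<close>)
  also have "\<dots> = (\<Oplus>\<^bsub>T\<^esub>m\<in>?F. f (p m) \<otimes>\<^bsub>T\<^esub> ?M m) \<oplus>\<^bsub>T\<^esub> (\<Oplus>\<^bsub>T\<^esub>m\<in>?F. f (q m) \<otimes>\<^bsub>T\<^esub> ?M m)"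
    by (rule T.finsum_addf) (use p q in auto)
  also have "\<dots> = E p \<oplus>\<^bsub>T\<^esub> E q"
    using E_superset[OF p F] E_superset[OF q F] by simp
  finally show ?thesis .
qed

lemma E_var_mult: assumes p: "p \<in> carrier P" and i: "i < n"
  shows "E (indexed_var i \<otimes>\<^bsub>P\<^esub> p) = v i \<otimes>\<^bsub>T\<^esub> E p"
proof -
  let ?F = "{m. p m \<noteq> \<zero>\<^bsub>R\<^esub>}"
  let ?M = "monomial_eval T n v"
  let ?q = "indexed_var i \<otimes>\<^bsub>P\<^esub> p"
  have F: "finite ?F" using p finite_support by auto
  have q: "?q \<in> carrier P" using p i by auto
  have sub: "{m. ?q m \<noteq> \<zero>\<^bsub>R\<^esub>} \<subseteq> add_mset i ` ?F"
  proof
    fix m assume "m \<in> {m. ?q m \<noteq> \<zero>\<^bsub>R\<^esub>}"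
    then have "m = add_mset i (m - {#i#})" "p (m - {#i#}) \<noteq> \<zero>\<^bsub>R\<^esub>"
      using p by (auto simp: var_times indexed_pmult_def split: if_splits)
    then show "m \<in> add_mset i ` ?F" by blast
  qed
  have "E ?q = (\<Oplus>\<^bsub>T\<^esub>m\<in>add_mset i ` ?F. f (?q m) \<otimes>\<^bsub>T\<^esub> ?M m)"
    by (rule E_superset[OF q _ sub]) (use F in simp)
  also have "\<dots> = (\<Oplus>\<^bsub>T\<^esub>m\<in>?F. f (?q (add_mset i m)) \<otimes>\<^bsub>T\<^esub> ?M (add_mset i m))"
    by (rule T.finsum_reindex) (use q in \<open>auto simp: inj_on_def\<close>)
  also have "\<dots> = (\<Oplus>\<^bsub>T\<^esub>m\<in>?F. v i \<otimes>\<^bsub>T\<^esub> (f (p m) \<otimes>\<^bsub>T\<^esub> ?M m))"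
  proof (rule T.finsum_cong')
    fix m
    have "?q (add_mset i m) = p m" using p by (simp add: var_times indexed_pmult_def)
    then show "f (?q (add_mset i m)) \<otimes>\<^bsub>T\<^esub> ?M (add_mset i m) = v i \<otimes>\<^bsub>T\<^esub> (f (p m) \<otimes>\<^bsub>T\<^esub> ?M m)"
      using i v_closed p by (simp add: T.monomial_eval_add_mset T.m_ac)
  qed (use p i v_closed in auto)
  also have "\<dots> = v i \<otimes>\<^bsub>T\<^esub> E p"
    unfolding E_superset[OF p F order_refl]
    by (rule T.finsum_rdistr[symmetric]) (use F p i v_closed in auto)
  finally show ?thesis .
qed

lemma E_const_mult: assumes a: "a \<in> carrier R" and q: "q \<in> carrier P"
  shows "E (indexed_const a \<otimes>\<^bsub>P\<^esub> q) = f a \<otimes>\<^bsub>T\<^esub> E q"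
proof -
  let ?F = "{m. q m \<noteq> \<zero>\<^bsub>R\<^esub>}"
  let ?M = "monomial_eval T n v"
  have F: "finite ?F" using q finite_support by auto
  have "E (indexed_const a \<otimes>\<^bsub>P\<^esub> q) = (\<Oplus>\<^bsub>T\<^esub>m\<in>?F. f ((indexed_const a \<otimes>\<^bsub>P\<^esub> q) m) \<otimes>\<^bsub>T\<^esub> ?M m)"
    by (rule E_superset) (use F a q in \<open>auto simp: const_mult_coeff\<close>)
  also have "\<dots> = (\<Oplus>\<^bsub>T\<^esub>m\<in>?F. f a \<otimes>\<^bsub>T\<^esub> (f (q m) \<otimes>\<^bsub>T\<^esub> ?M m))"
    by (rule T.finsum_cong') (use a q in \<open>auto simp: const_mult_coeff ring_hom_mult[OF f_hom] T.m_assoc\<close>)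
  also have "\<dots> = f a \<otimes>\<^bsub>T\<^esub> E q"
    unfolding E_superset[OF q F order_refl]
    by (rule T.finsum_rdistr[symmetric]) (use F a q in auto)
  finally show ?thesis .
qed

text \<open>\<open>E\<close> is additive and commutes with constants and with multiplication by variables; as these
  generate the polynomial ring, it is multiplicative.\<close>

lemma E_hom: "E \<in> ring_hom P T"
proof (rule ring_hom_memI)
  fix p q assume p: "p \<in> carrier P" and q: "q \<in> carrier P"
  show "E (p \<otimes>\<^bsub>P\<^esub> q) = E p \<otimes>\<^bsub>T\<^esub> E q"
    using p
  proof (induction p rule: P_induct)
    case (const a)
    then show ?case using q by (simp add: E_const_mult)
  next
    case (add p p')
    then show ?case using q by (simp add: P.l_distr E_add T.l_distr)
  next
    case (var_mult p i)
    then show ?case using q v_closed by (simp add: P.m_assoc E_var_mult T.m_assoc)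
  qed
qed (auto simp: E_add one_P ring_hom_one[OF f_hom])

lemma E_var [simp]: assumes "i < n" shows "E (indexed_var i) = v i"
  using E_var_mult[of "\<one>\<^bsub>P\<^esub>" i] assms v_closed ring_hom_one[OF E_hom] by simp

end

context mpoly_cring
begin

text \<open>Evaluating at the variables themselves is an endomorphism fixing all generators, hence the identity.\<close>

lemma poly_expansion:
  assumes p: "p \<in> carrier P"
  shows "p = (\<Oplus>\<^bsub>P\<^esub>m\<in>{m. p m \<noteq> \<zero>}. indexed_const (p m) \<otimes>\<^bsub>P\<^esub> monomial_eval P n indexed_var m)"
proof -
  interpret I: mpoly_eval R n P P indexed_const indexed_var "poly_eval R P n indexed_const indexed_var"
    by unfold_locales (rule P_def const_hom var_closed reflexive | assumption)+
  have "poly_eval R P n indexed_const indexed_var p = p"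
    using p
    by (induction p rule: P_induct) (auto simp: I.E_add I.E_var_mult)
  then show ?thesis by (simp add: poly_eval_def)
qed

end

section \<open>Prime ideals and nilpotent elements\<close>

lemma (in primeideal) prime_power_mem:
  assumes "a \<in> carrier R" "a [^] (k::nat) \<in> I" shows "a \<in> I"
  using assms(2)
proof (induction k)
  case 0
  then show ?case using one_imp_carrier I_notcarr by auto
next
  case (Suc k)
  then show ?case using I_prime[of "a [^] k" a] assms(1) by auto
qed

context cring
begin

lemma mem_add_PIdl:
  "z \<in> I <+> PIdl a \<longleftrightarrow> (\<exists>y\<in>I. \<exists>r\<in>carrier R. z = y \<oplus> r \<otimes> a)"
  unfolding set_add_def' cgenideal_def by auto

text \<open>Krull's argument: an ideal \<open>M\<close> that is maximal among the ideals containing \<open>I\<close> but no power of \<open>x\<close>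
  is prime. If \<open>a, b \<notin> M\<close>, then \<open>M + (a)\<close> and \<open>M + (b)\<close> contain powers of \<open>x\<close>, and so does their product,
  which lies in \<open>M + (a b)\<close>; hence \<open>a b \<notin> M\<close>.\<close>

lemma prime_ideal_avoiding_powers:
  assumes I: "ideal I R" and x: "x \<in> carrier R" and pow: "\<And>k::nat. x [^] k \<notin> I"
  shows "\<exists>Q. primeideal Q R \<and> I \<subseteq> Q \<and> x \<notin> Q"
proof -
  define S where "S = {J. ideal J R \<and> I \<subseteq> J \<and> (\<forall>k::nat. x [^] k \<notin> J)}"
  have "\<exists>M \<in> S. \<forall>J \<in> S. M \<subseteq> J \<longrightarrow> J = M"
  proof (rule subset_Zorn)
    fix C assume C: "subset.chain S C"
    show "\<exists>U \<in> S. \<forall>J \<in> C. J \<subseteq> U"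
    proof (cases "C = {}")
      case True
      then show ?thesis using I pow by (auto simp: S_def)
    next
      case False
      have "subset.chain {I. ideal I R} C"
        using C unfolding pred_on.chain_def S_def by auto
      then have "ideal (\<Union>C) R"
        using chain_Union_is_ideal[of C] False by simp
      moreover have "I \<subseteq> \<Union>C" "\<forall>k::nat. x [^] k \<notin> \<Union>C"
        using C False unfolding pred_on.chain_def S_def by blast+
      ultimately show ?thesis unfolding S_def by blast
    qed
  qed
  then obtain M where M: "ideal M R" "I \<subseteq> M" "\<And>k::nat. x [^] k \<notin> M"
    and max0: "\<And>J. J \<in> S \<Longrightarrow> M \<subseteq> J \<Longrightarrow> J = M"
    unfolding S_def by auto
  have max: "J = M" if "ideal J R" "I \<subseteq> J" "\<And>k::nat. x [^] k \<notin> J" "M \<subseteq> J" for J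
    using max0[of J] that by (simp add: S_def)
  interpret M: ideal M R by fact
  have enlarge: "\<exists>k::nat. \<exists>y\<in>M. \<exists>r\<in>carrier R. x [^] k = y \<oplus> r \<otimes> a"
    if a: "a \<in> carrier R" "a \<notin> M" for a
  proof (rule ccontr)
    assume "\<not> ?thesis"
    then have no: "x [^] k \<notin> M <+> PIdl a" for k :: nat
      unfolding mem_add_PIdl by blast
    have J: "ideal (M <+> PIdl a) R"
      by (rule add_ideals) (use a M.is_ideal cgenideal_ideal in auto)
    have sub: "M \<subseteq> M <+> PIdl a"
    proof
      fix y assume y: "y \<in> M"
      then have "y = y \<oplus> \<zero> \<otimes> a" using a M.Icarr by auto
      then show "y \<in> M <+> PIdl a" unfolding mem_add_PIdl using y by blast
    qed
    have "a = \<zero> \<oplus> \<one> \<otimes> a" using a by simp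
    then have "a \<in> M <+> PIdl a" unfolding mem_add_PIdl using a M.zero_closed by blast
    moreover have "M <+> PIdl a = M" using max[OF J _ no sub] M(2) sub by blast
    ultimately show False using a by simp
  qed
  have "primeideal M R"
  proof (rule primeidealI[OF M(1) is_cring])
    show "carrier R \<noteq> M" using M(3)[of 0] by auto
    fix a b assume ab: "a \<in> carrier R" "b \<in> carrier R" "a \<otimes> b \<in> M"
    show "a \<in> M \<or> b \<in> M"
    proof (rule ccontr)
      assume "\<not> (a \<in> M \<or> b \<in> M)"
      then obtain k l :: nat and y z r s where *: "y \<in> M" "z \<in> M" "r \<in> carrier R" "s \<in> carrier R"
        "x [^] k = y \<oplus> r \<otimes> a" "x [^] l = z \<oplus> s \<otimes> b"
        using enlarge[of a] enlarge[of b] ab by blast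
      then have c: "y \<in> carrier R" "z \<in> carrier R" using M.Icarr by auto
      have "x [^] (k + l) = (y \<oplus> r \<otimes> a) \<otimes> (z \<oplus> s \<otimes> b)"
        using x by (simp add: nat_pow_mult[symmetric] *)
      also have "\<dots> = y \<otimes> (z \<oplus> s \<otimes> b) \<oplus> ((r \<otimes> a) \<otimes> z \<oplus> (r \<otimes> s) \<otimes> (a \<otimes> b))"
        using * c ab by (simp add: l_distr r_distr m_ac a_ac)
      also have "\<dots> \<in> M"
        using * c ab by (intro M.a_closed M.I_l_closed[of z] M.I_l_closed[of "a \<otimes> b"] M.I_r_closed[of y]) auto
      finally show False using M(3) by blast
    qed
  qed
  then show ?thesis using M(2) M(3)[of 1] x by auto
qed

lemma finsum_mem:
  assumes zero: "\<zero> \<in> J" and add: "\<And>x y. \<lbrakk>x \<in> J; y \<in> J\<rbrakk> \<Longrightarrow> x \<oplus> y \<in> J"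
    and sub: "J \<subseteq> carrier R" and g: "\<And>i. i \<in> A \<Longrightarrow> g i \<in> J"
  shows "finsum R g A \<in> J"
proof (cases "finite A")
  case True
  then show ?thesis using g
  proof (induction A)
    case (insert a A)
    then show ?case using sub by (subst finsum_insert) (auto intro!: add)
  qed (simp add: zero)
qed (simp add: zero)

lemma finsum_mem_ideal:
  assumes "ideal J R" and "\<And>i. i \<in> A \<Longrightarrow> g i \<in> J"
  shows "finsum R g A \<in> J"
proof -
  interpret J: ideal J R by fact
  show ?thesis using assms(2) J.Icarr by (intro finsum_mem) auto
qed

lemma nilradical_iff:
  "a \<in> nilradical R \<longleftrightarrow> a \<in> carrier R \<and> (\<exists>k::nat. a [^] k = \<zero>)"
proof
  assume a: "a \<in> nilradical R"
  then have "a \<in> carrier R" by (simp add: nilradical_def)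
  moreover have "\<exists>k::nat. a [^] k = \<zero>"
    using prime_ideal_avoiding_powers[OF zeroideal \<open>a \<in> carrier R\<close>] a
    by (auto simp: nilradical_def)
  ultimately show "a \<in> carrier R \<and> (\<exists>k::nat. a [^] k = \<zero>)" by simp
next
  assume "a \<in> carrier R \<and> (\<exists>k::nat. a [^] k = \<zero>)"
  then obtain k :: nat where a: "a \<in> carrier R" "a [^] k = \<zero>" by blast
  have "a \<in> Q" if "primeideal Q R" for Q
  proof -
    interpret Q: primeideal Q R by fact
    show ?thesis using Q.prime_power_mem[OF a(1), of k] a(2) by simp
  qed
  then show "a \<in> nilradical R" using a by (auto simp: nilradical_def)
qed

end

section \<open>Polynomials modulo an ideal of coefficients\<close>

context mpoly_cring
begin

definition coeff_ideal :: "'a set \<Rightarrow> (nat multiset \<Rightarrow> 'a) set"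
  where "coeff_ideal J = {p \<in> carrier P. \<forall>m. p m \<in> J}"

lemma ideal_coeff_ideal:
  assumes "ideal J R" shows "ideal (coeff_ideal J) P"
proof -
  interpret J: ideal J R by fact
  have mult: "p \<otimes>\<^bsub>P\<^esub> q \<in> coeff_ideal J" if "p \<in> coeff_ideal J" "q \<in> carrier P" for p q
    using that by (auto simp: coeff_ideal_def mult_coeff intro!: finsum_mem_ideal[OF assms] J.I_r_closed)
  show ?thesis
  proof (rule idealI[OF P.ring_axioms])
    show "subgroup (coeff_ideal J) (add_monoid P)"
    proof (rule P.add.subgroupI)
      have "\<zero>\<^bsub>P\<^esub> \<in> coeff_ideal J" by (auto simp: coeff_ideal_def zero_coeff)
      then show "coeff_ideal J \<noteq> {}" by blast
    qed (auto simp: coeff_ideal_def add_coeff minus_coeff J.a_inv_closed)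
  qed (use mult P.m_comm in \<open>auto simp: coeff_ideal_def\<close>)
qed

text \<open>The multiset order over the linearly ordered indices is total and compatible with sums of
  monomials, so it is a monomial order. Among the pairs of monomials with product \<open>u + v\<close>, every pair
  other than \<open>(u, v)\<close> has a component above \<open>u\<close> or above \<open>v\<close> and therefore contributes an element of \<open>Q\<close>.\<close>

lemma leading_coeff_mult:
  assumes Q: "primeideal Q R" and p: "p \<in> carrier P" and q: "q \<in> carrier P"
    and u: "p u \<notin> Q" "\<And>w. p w \<notin> Q \<Longrightarrow> w \<le> u" and v: "q v \<notin> Q" "\<And>w. q w \<notin> Q \<Longrightarrow> w \<le> v"
  shows "(p \<otimes>\<^bsub>P\<^esub> q) (u + v) \<notin> Q"
proof
  interpret Q: primeideal Q R by fact
  let ?g = "\<lambda>w. p w \<otimes> q (u + v - w)"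
  let ?A = "{w. w \<subseteq># u + v} - {u}"
  assume in_Q: "(p \<otimes>\<^bsub>P\<^esub> q) (u + v) \<in> Q"
  have rest: "?g w \<in> Q" if "w \<in> ?A" for w
  proof (cases "p w \<in> Q")
    case True
    then show ?thesis using q Q.I_r_closed by auto
  next
    case False
    then have "w < u" using u(2)[of w] that by auto
    have "q (u + v - w) \<in> Q"
    proof (rule ccontr)
      assume "q (u + v - w) \<notin> Q"
      then have "w + (u + v - w) < u + v"
        using \<open>w < u\<close> v(2) add_less_le_mono by blast
      then show False using that by simp
    qed
    then show ?thesis using p Q.I_l_closed by auto
  qed
  have s: "finsum R ?g ?A \<in> Q" by (rule finsum_mem_ideal[OF Q.is_ideal rest])
  have "{w. w \<subseteq># u + v} = insert u ?A" by auto
  then have "(p \<otimes>\<^bsub>P\<^esub> q) (u + v) = finsum R ?g (insert u ?A)"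
    by (simp add: mult_coeff)
  also have "\<dots> = ?g u \<oplus> finsum R ?g ?A"
    by (rule finsum_insert) (use p q finite_submultisets in auto)
  finally have eq: "(p \<otimes>\<^bsub>P\<^esub> q) (u + v) = p u \<otimes> q v \<oplus> finsum R ?g ?A" by simp
  have "p u \<otimes> q v \<in> carrier R" "finsum R ?g ?A \<in> carrier R" using p q by auto
  then have "p u \<otimes> q v = (p \<otimes>\<^bsub>P\<^esub> q) (u + v) \<oplus> \<ominus> finsum R ?g ?A"
    by (simp add: eq a_assoc r_neg)
  moreover have "(p \<otimes>\<^bsub>P\<^esub> q) (u + v) \<oplus> \<ominus> finsum R ?g ?A \<in> Q"
    by (rule Q.a_closed[OF in_Q Q.a_inv_closed[OF s]])
  ultimately have "p u \<otimes> q v \<in> Q" by simp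
  then show False using Q.I_prime p q u v by blast
qed

lemma leading_monomial:
  assumes Q: "ideal Q R" and p: "p \<in> carrier P" "p \<notin> coeff_ideal Q"
  obtains u where "p u \<notin> Q" "\<And>w. p w \<notin> Q \<Longrightarrow> w \<le> u"
proof -
  interpret Q: ideal Q R by fact
  let ?S = "{m. p m \<notin> Q}"
  have "?S \<subseteq> {m. p m \<noteq> \<zero>}" by auto
  then have fin: "finite ?S" using finite_support[OF p(1)] finite_subset by blast
  have "?S \<noteq> {}" using p by (auto simp: coeff_ideal_def)
  then show thesis using Max_in[OF fin] Max_ge[OF fin] that[of "Max ?S"] by blast
qed

lemma coeff_ideal_prime:
  assumes Q: "primeideal Q R" and p: "p \<in> carrier P" and q: "q \<in> carrier P"
    and pq: "p \<otimes>\<^bsub>P\<^esub> q \<in> coeff_ideal Q"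
  shows "p \<in> coeff_ideal Q \<or> q \<in> coeff_ideal Q"
proof (rule ccontr)
  assume *: "\<not> ?thesis"
  obtain u where u: "p u \<notin> Q" "\<And>w. p w \<notin> Q \<Longrightarrow> w \<le> u"
    using leading_monomial[OF primeideal.axioms(1)[OF Q] p] * by blast
  obtain v where v: "q v \<notin> Q" "\<And>w. q w \<notin> Q \<Longrightarrow> w \<le> v"
    using leading_monomial[OF primeideal.axioms(1)[OF Q] q] * by blast
  show False
    using leading_coeff_mult[OF Q p q u v] pq unfolding coeff_ideal_def by simp
qed

lemma primeideal_coeff_ideal:
  assumes Q: "primeideal Q R" shows "primeideal (coeff_ideal Q) P"
proof (rule primeidealI[OF ideal_coeff_ideal P.is_cring])
  interpret Q: primeideal Q R by fact
  show "ideal Q R" by (rule Q.is_ideal)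
  have "indexed_const \<one> \<notin> coeff_ideal Q"
    using Q.one_imp_carrier Q.I_notcarr by (auto simp: coeff_ideal_def const_coeff)
  then show "carrier P \<noteq> coeff_ideal Q" by auto
qed (rule coeff_ideal_prime[OF Q])

text \<open>Over the domain \<open>R / Q\<close>, the equation \<open>p = p\<^sup>2 q\<close> forces \<open>p = 0\<close> or \<open>p q = 1\<close>. In the second case
  the leading monomials of \<open>p\<close> and \<open>q\<close> have product \<open>1\<close>, so \<open>p\<close> is constant.\<close>

lemma regular_constant_mod_prime:
  assumes Q: "primeideal Q R" and p: "p \<in> carrier P" and q: "q \<in> carrier P"
    and reg: "p \<ominus>\<^bsub>P\<^esub> p \<otimes>\<^bsub>P\<^esub> p \<otimes>\<^bsub>P\<^esub> q \<in> coeff_ideal Q" and m: "m \<noteq> {#}"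
  shows "p m \<in> Q"
proof (cases "p \<in> coeff_ideal Q")
  case True
  then show ?thesis by (simp add: coeff_ideal_def)
next
  case False
  interpret Q: primeideal Q R by fact
  interpret PQ: primeideal "coeff_ideal Q" P by (rule primeideal_coeff_ideal[OF Q])
  let ?r = "\<one>\<^bsub>P\<^esub> \<ominus>\<^bsub>P\<^esub> p \<otimes>\<^bsub>P\<^esub> q"
  have "p \<otimes>\<^bsub>P\<^esub> ?r = p \<ominus>\<^bsub>P\<^esub> p \<otimes>\<^bsub>P\<^esub> p \<otimes>\<^bsub>P\<^esub> q"
    using p q by (simp add: P.minus_eq P.r_distr P.r_minus P.m_assoc)
  then have r: "?r \<in> coeff_ideal Q" using PQ.I_prime[of p ?r] reg p q False by auto
  have one: "\<one>\<^bsub>P\<^esub> \<notin> coeff_ideal Q" using PQ.one_imp_carrier PQ.I_notcarr by auto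
  have "q \<notin> coeff_ideal Q"
  proof
    assume "q \<in> coeff_ideal Q"
    then have "?r \<oplus>\<^bsub>P\<^esub> p \<otimes>\<^bsub>P\<^esub> q \<in> coeff_ideal Q" using r p PQ.I_l_closed PQ.a_closed by blast
    moreover have "?r \<oplus>\<^bsub>P\<^esub> p \<otimes>\<^bsub>P\<^esub> q = \<one>\<^bsub>P\<^esub>" using p q by (simp add: P.minus_eq P.a_assoc P.l_neg)
    ultimately show False using one by simp
  qed
  obtain u where u: "p u \<notin> Q" "\<And>w. p w \<notin> Q \<Longrightarrow> w \<le> u"
    using leading_monomial[OF Q.is_ideal p False] by blast
  obtain v where v: "q v \<notin> Q" "\<And>w. q w \<notin> Q \<Longrightarrow> w \<le> v"
    using leading_monomial[OF Q.is_ideal q \<open>q \<notin> _\<close>] by blast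
  have "(p \<otimes>\<^bsub>P\<^esub> q) (u + v) \<notin> Q" by (rule leading_coeff_mult[OF Q p q u v])
  moreover have "(p \<otimes>\<^bsub>P\<^esub> q) w \<in> Q" if "w \<noteq> {#}" for w
  proof -
    have "p \<otimes>\<^bsub>P\<^esub> q \<in> carrier P" using p q by simp
    from diff_coeff[OF this, of "\<one>\<^bsub>P\<^esub>" w] have "?r w = \<zero> \<ominus> (p \<otimes>\<^bsub>P\<^esub> q) w"
      unfolding one_coeff if_not_P[OF that] .
    also have "\<dots> = \<ominus> (p \<otimes>\<^bsub>P\<^esub> q) w"
      using P_coeff[OF \<open>p \<otimes>\<^bsub>P\<^esub> q \<in> carrier P\<close>] by (simp only: minus_eq l_zero a_inv_closed)
    finally have "?r w = \<ominus> (p \<otimes>\<^bsub>P\<^esub> q) w" .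
    moreover have "?r w \<in> Q" using r unfolding coeff_ideal_def by blast
    ultimately have "\<ominus> (p \<otimes>\<^bsub>P\<^esub> q) w \<in> Q" by metis
    then have "\<ominus> (\<ominus> (p \<otimes>\<^bsub>P\<^esub> q) w) \<in> Q" by (rule Q.a_inv_closed)
    then show ?thesis using p q by simp
  qed
  ultimately have "u = {#}" by (cases "u + v = {#}") auto
  then show ?thesis using u(2)[of m] le_multiset_empty_left[OF m] leD by blast
qed

text \<open>Being von Neumann regular up to nilpotents is preserved by ring isomorphisms. So an isomorphism
  between polynomial rings maps every constant with this property to a constant, up to a polynomial
  with nilpotent coefficients.\<close>

lemma regular_constant_mod_nil:
  assumes p: "p \<in> carrier P" and q: "q \<in> carrier P"
    and reg: "p \<ominus>\<^bsub>P\<^esub> p \<otimes>\<^bsub>P\<^esub> p \<otimes>\<^bsub>P\<^esub> q \<in> nilradical P"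
  shows "p \<ominus>\<^bsub>P\<^esub> indexed_const (p {#}) \<in> coeff_ideal (nilradical R)"
proof -
  interpret N: ideal "nilradical R" R by (rule ideal_nilradical[OF is_cring])
  have "p m \<in> nilradical R" if "m \<noteq> {#}" for m
  proof -
    have "p m \<in> Q" if Q: "primeideal Q R" for Q
    proof (rule regular_constant_mod_prime[OF Q p q _ \<open>m \<noteq> {#}\<close>])
      show "p \<ominus>\<^bsub>P\<^esub> p \<otimes>\<^bsub>P\<^esub> p \<otimes>\<^bsub>P\<^esub> q \<in> coeff_ideal Q"
        using reg primeideal_coeff_ideal[OF Q] by (auto simp: nilradical_def)
    qed
    then show ?thesis using p by (auto simp: nilradical_def)
  qed
  then have "(p \<ominus>\<^bsub>P\<^esub> indexed_const (p {#})) m \<in> nilradical R" for m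
    unfolding diff_coeff[OF const_closed[OF P_coeff[OF p]]] const_coeff
    using p by (cases "m = {#}") (simp_all add: minus_eq r_neg)
  then show ?thesis using p by (simp add: coeff_ideal_def)
qed

end

section \<open>One-sided inverses of square matrices\<close>

context cring
begin

lemma finsum_swap:
  assumes "finite A" "finite B" and f: "\<And>i j. i \<in> A \<Longrightarrow> j \<in> B \<Longrightarrow> f i j \<in> carrier R"
  shows "(\<Oplus>i\<in>A. \<Oplus>j\<in>B. f i j) = (\<Oplus>j\<in>B. \<Oplus>i\<in>A. f i j)"
  using assms(1) f
proof (induction A)
  case empty
  then show ?case by simp
next
  case (insert a A)
  have "(\<Oplus>j\<in>B. \<Oplus>i\<in>insert a A. f i j) = (\<Oplus>j\<in>B. f a j \<oplus> (\<Oplus>i\<in>A. f i j))"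
    using insert by (intro finsum_cong') (auto intro!: finsum_closed finsum_insert)
  also have "\<dots> = (\<Oplus>j\<in>B. f a j) \<oplus> (\<Oplus>j\<in>B. \<Oplus>i\<in>A. f i j)"
    using insert by (intro finsum_addf) (auto intro!: finsum_closed)
  finally show ?case using insert by (subst finsum_insert) (auto intro!: finsum_closed)
qed

lemma finsum_remove:
  assumes "finite A" "a \<in> A" and f: "\<And>i. i \<in> A \<Longrightarrow> f i \<in> carrier R"
  shows "finsum R f (A - {a}) = finsum R f A \<ominus> f a"
proof -
  have "finsum R f (insert a (A - {a})) = f a \<oplus> finsum R f (A - {a})"
    by (rule finsum_insert) (use assms in auto)
  then have "finsum R f A = finsum R f (A - {a}) \<oplus> f a"
    using assms by (simp add: insert_absorb a_comm)
  then show ?thesis using assms by (auto simp: minus_eq a_assoc r_neg)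
qed

lemma finsum_lin:
  assumes "finite A" "x \<in> carrier R" "y \<in> carrier R"
    and f: "\<And>i. i \<in> A \<Longrightarrow> f i \<in> carrier R" and g: "\<And>i. i \<in> A \<Longrightarrow> g i \<in> carrier R"
  shows "(\<Oplus>i\<in>A. x \<otimes> f i \<oplus> y \<otimes> g i) = x \<otimes> finsum R f A \<oplus> y \<otimes> finsum R g A"
proof -
  have "(\<Oplus>i\<in>A. x \<otimes> f i \<oplus> y \<otimes> g i) = (\<Oplus>i\<in>A. x \<otimes> f i) \<oplus> (\<Oplus>i\<in>A. y \<otimes> g i)"
    using assms by (intro finsum_addf) auto
  then show ?thesis using assms by (simp add: finsum_rdistr Pi_def)
qed

lemma finsum_lin_diff:
  assumes "finite A" "x \<in> carrier R" "y \<in> carrier R"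
    and f: "\<And>i. i \<in> A \<Longrightarrow> f i \<in> carrier R" and g: "\<And>i. i \<in> A \<Longrightarrow> g i \<in> carrier R"
  shows "(\<Oplus>i\<in>A. x \<otimes> f i \<ominus> y \<otimes> g i) = x \<otimes> finsum R f A \<ominus> y \<otimes> finsum R g A"
proof -
  have "(\<Oplus>i\<in>A. x \<otimes> f i \<ominus> y \<otimes> g i) = (\<Oplus>i\<in>A. x \<otimes> f i \<oplus> \<ominus> y \<otimes> g i)"
    using assms by (intro finsum_cong') (auto simp: minus_eq l_minus)
  also have "\<dots> = x \<otimes> finsum R f A \<oplus> \<ominus> y \<otimes> finsum R g A"
    by (rule finsum_lin) (use assms in auto)
  finally show ?thesis using assms by (simp add: minus_eq l_minus)
qed

lemma matrix_assoc:
  assumes "finite J" "finite K" "i \<in> I" "l \<in> H"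
    and "\<And>i j. i \<in> I \<Longrightarrow> j \<in> J \<Longrightarrow> U i j \<in> carrier R"
    and "\<And>j k. j \<in> J \<Longrightarrow> k \<in> K \<Longrightarrow> Y j k \<in> carrier R"
    and "\<And>k l. k \<in> K \<Longrightarrow> l \<in> H \<Longrightarrow> Z k l \<in> carrier R"
  shows "(\<Oplus>j\<in>J. U i j \<otimes> (\<Oplus>k\<in>K. Y j k \<otimes> Z k l)) = (\<Oplus>k\<in>K. (\<Oplus>j\<in>J. U i j \<otimes> Y j k) \<otimes> Z k l)"
proof -
  have "(\<Oplus>j\<in>J. U i j \<otimes> (\<Oplus>k\<in>K. Y j k \<otimes> Z k l)) = (\<Oplus>j\<in>J. \<Oplus>k\<in>K. U i j \<otimes> Y j k \<otimes> Z k l)"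
    using assms by (intro finsum_cong') (auto simp: finsum_rdistr m_assoc Pi_def intro!: finsum_closed finsum_cong')
  also have "\<dots> = (\<Oplus>k\<in>K. \<Oplus>j\<in>J. U i j \<otimes> Y j k \<otimes> Z k l)"
    using assms by (intro finsum_swap) auto
  also have "\<dots> = (\<Oplus>k\<in>K. (\<Oplus>j\<in>J. U i j \<otimes> Y j k) \<otimes> Z k l)"
    using assms by (intro finsum_cong') (auto simp: finsum_ldistr Pi_def intro!: finsum_closed)
  finally show ?thesis .
qed

lemma finsum_kronecker:
  assumes "finite A" "a \<in> A" "w \<in> carrier R" and f: "\<And>i. i \<in> A \<Longrightarrow> f i \<in> carrier R"
  shows "(\<Oplus>i\<in>A. (if a = i then w else \<zero>) \<otimes> f i) = w \<otimes> f a"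
    and "(\<Oplus>i\<in>A. f i \<otimes> (if i = a then w else \<zero>)) = f a \<otimes> w"
proof -
  have "(\<Oplus>i\<in>A. (if a = i then w else \<zero>) \<otimes> f i) = (\<Oplus>i\<in>A. if a = i then w \<otimes> f i else \<zero>)"
    using assms by (intro finsum_cong') auto
  also have "\<dots> = w \<otimes> f a" using assms by (intro finsum_singleton) auto
  finally show "(\<Oplus>i\<in>A. (if a = i then w else \<zero>) \<otimes> f i) = w \<otimes> f a" .
  have "(\<Oplus>i\<in>A. f i \<otimes> (if i = a then w else \<zero>)) = (\<Oplus>i\<in>A. if a = i then f i \<otimes> w else \<zero>)"
    using assms by (intro finsum_cong') auto
  also have "\<dots> = f a \<otimes> w" using assms by (intro finsum_singleton) auto
  finally show "(\<Oplus>i\<in>A. f i \<otimes> (if i = a then w else \<zero>)) = f a \<otimes> w" .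
qed

text \<open>The entries of \<open>M L - w 1\<close>, for matrices \<open>L\<close> with rows indexed by \<open>I\<close> and \<open>M\<close> with columns indexed by
  \<open>I\<close>. Allowing a scalar \<open>w\<close> in place of \<open>1\<close> makes room for the pivots of an elimination without division.\<close>

definition matrix_defect ::
    "'i set \<Rightarrow> 'a \<Rightarrow> ('i \<Rightarrow> 'k \<Rightarrow> 'a) \<Rightarrow> ('k \<Rightarrow> 'i \<Rightarrow> 'a) \<Rightarrow> 'k \<Rightarrow> 'k \<Rightarrow> 'a" where
  "matrix_defect I w L M k l = (\<Oplus>j\<in>I. M k j \<otimes> L j l) \<ominus> (if k = l then w else \<zero>)"

text \<open>With \<open>Z = M L - w 1\<close>, associativity gives \<open>L Z = (L M) L - w L = 0\<close> and \<open>Z M = M (L M) - w M = 0\<close>.\<close>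

lemma matrix_defect_annihilated:
  assumes fin: "finite I" "finite K"
    and L: "\<And>i k. i \<in> I \<Longrightarrow> k \<in> K \<Longrightarrow> L i k \<in> carrier R"
    and M: "\<And>i k. i \<in> I \<Longrightarrow> k \<in> K \<Longrightarrow> M k i \<in> carrier R"
    and w: "w \<in> carrier R"
    and LM: "\<And>i j. i \<in> I \<Longrightarrow> j \<in> I \<Longrightarrow> (\<Oplus>k\<in>K. L i k \<otimes> M k j) = (if i = j then w else \<zero>)"
  shows "i \<in> I \<Longrightarrow> l \<in> K \<Longrightarrow> (\<Oplus>k\<in>K. L i k \<otimes> matrix_defect I w L M k l) = \<zero>"
    and "k \<in> K \<Longrightarrow> i \<in> I \<Longrightarrow> (\<Oplus>l\<in>K. matrix_defect I w L M k l \<otimes> M l i) = \<zero>"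
proof -
  assume i: "i \<in> I" and l: "l \<in> K"
  let ?D = "\<lambda>k. (\<Oplus>j\<in>I. M k j \<otimes> L j l)"
  have D: "?D k \<in> carrier R" if "k \<in> K" for k
    using that l L M by (auto intro!: finsum_closed)
  have "(\<Oplus>k\<in>K. L i k \<otimes> matrix_defect I w L M k l)
      = (\<Oplus>k\<in>K. \<one> \<otimes> (L i k \<otimes> ?D k) \<ominus> \<one> \<otimes> (L i k \<otimes> (if k = l then w else \<zero>)))"
    unfolding matrix_defect_def using D L w i
    by (intro finsum_cong') (auto simp: minus_eq r_distr r_minus)
  also have "\<dots> = \<one> \<otimes> (\<Oplus>k\<in>K. L i k \<otimes> ?D k) \<ominus> \<one> \<otimes> (\<Oplus>k\<in>K. L i k \<otimes> (if k = l then w else \<zero>))"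
    by (rule finsum_lin_diff) (use D L w i fin in auto)
  also have "(\<Oplus>k\<in>K. L i k \<otimes> (if k = l then w else \<zero>)) = L i l \<otimes> w"
    by (rule finsum_kronecker) (use L w i l fin in auto)
  also have "(\<Oplus>k\<in>K. L i k \<otimes> ?D k) = (\<Oplus>j\<in>I. (\<Oplus>k\<in>K. L i k \<otimes> M k j) \<otimes> L j l)"
    by (rule matrix_assoc[where I = I and H = K]) (use fin i l L M in auto)
  also have "\<dots> = (\<Oplus>j\<in>I. (if i = j then w else \<zero>) \<otimes> L j l)"
    using L w i l by (intro finsum_cong') (auto simp: LM)
  also have "\<dots> = w \<otimes> L i l"
    by (rule finsum_kronecker) (use L w i l fin in auto)
  finally show "(\<Oplus>k\<in>K. L i k \<otimes> matrix_defect I w L M k l) = \<zero>"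
    using w L[OF i l] by (simp add: m_comm minus_eq r_neg)
next
  assume k: "k \<in> K" and i: "i \<in> I"
  let ?D = "\<lambda>l. (\<Oplus>j\<in>I. M k j \<otimes> L j l)"
  have D: "?D l \<in> carrier R" if "l \<in> K" for l
    using that k L M by (auto intro!: finsum_closed)
  have "(\<Oplus>l\<in>K. matrix_defect I w L M k l \<otimes> M l i)
      = (\<Oplus>l\<in>K. \<one> \<otimes> (?D l \<otimes> M l i) \<ominus> \<one> \<otimes> ((if k = l then w else \<zero>) \<otimes> M l i))"
    unfolding matrix_defect_def using D M w i
    by (intro finsum_cong') (auto simp: minus_eq l_distr l_minus)
  also have "\<dots> = \<one> \<otimes> (\<Oplus>l\<in>K. ?D l \<otimes> M l i) \<ominus> \<one> \<otimes> (\<Oplus>l\<in>K. (if k = l then w else \<zero>) \<otimes> M l i)"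
    by (rule finsum_lin_diff) (use D M w i fin in auto)
  also have "(\<Oplus>l\<in>K. (if k = l then w else \<zero>) \<otimes> M l i) = w \<otimes> M k i"
    by (rule finsum_kronecker) (use M w i k fin in auto)
  also have "(\<Oplus>l\<in>K. ?D l \<otimes> M l i) = (\<Oplus>j\<in>I. M k j \<otimes> (\<Oplus>l\<in>K. L j l \<otimes> M l i))"
    by (rule matrix_assoc[where I = K and H = I, symmetric]) (use fin i k L M in auto)
  also have "\<dots> = (\<Oplus>j\<in>I. M k j \<otimes> (if j = i then w else \<zero>))"
    using M w i k by (intro finsum_cong') (auto simp: LM)
  also have "\<dots> = M k i \<otimes> w"
    by (rule finsum_kronecker) (use M w i k fin in auto)
  finally show "(\<Oplus>l\<in>K. matrix_defect I w L M k l \<otimes> M l i) = \<zero>"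
    using w M[OF i k] by (simp add: m_comm minus_eq r_neg)
qed

text \<open>Fraction-free Gaussian elimination. Let \<open>u\<close> be the entry of \<open>M\<close> in row \<open>k0\<close> and column \<open>i0\<close>.
  Clearing column \<open>i0\<close> with this pivot turns \<open>L M = w 1\<close> into an equation with scalar \<open>u w\<close> between
  matrices that are smaller by one row and one column. By induction a power of \<open>u w\<close> kills the smaller
  defect, and the relations \<open>L Z = 0\<close> and \<open>Z M = 0\<close> carry this over to \<open>Z\<close>. So some power of each \<open>u w\<close>
  lies in the annihilator \<open>J\<close> of \<open>Z\<close>. As \<open>w\<close> is a combination of the entries \<open>u\<close> of column \<open>i0\<close>, every
  prime ideal containing \<open>J\<close> contains \<open>w\<close>, and therefore \<open>J\<close> contains a power of \<open>w\<close>.\<close>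

lemma matrix_defect_power:
  assumes "finite I" "finite K" "card I = card K"
    and "\<And>i k. i \<in> I \<Longrightarrow> k \<in> K \<Longrightarrow> L i k \<in> carrier R"
    and "\<And>i k. i \<in> I \<Longrightarrow> k \<in> K \<Longrightarrow> M k i \<in> carrier R"
    and "w \<in> carrier R"
    and "\<And>i j. i \<in> I \<Longrightarrow> j \<in> I \<Longrightarrow> (\<Oplus>k\<in>K. L i k \<otimes> M k j) = (if i = j then w else \<zero>)"
  shows "\<exists>a::nat. \<forall>k\<in>K. \<forall>l\<in>K. w [^] a \<otimes> matrix_defect I w L M k l = \<zero>"
  using assms
proof (induction I arbitrary: K M w rule: finite_induct)
  case empty
  then show ?case by simp
next
  case (insert i0 I)
  let ?I = "insert i0 I"
  let ?Z = "matrix_defect ?I w L M"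
  note fin = insert.hyps(1) insert.prems(1)
  note L = insert.prems(3) and M = insert.prems(4) and w = insert.prems(5) and LM = insert.prems(6)
  have prod_closed: "(\<Oplus>j\<in>?I. M k j \<otimes> L j l) \<in> carrier R" if "k \<in> K" "l \<in> K" for k l
    using that L M by (intro finsum_closed) auto
  have Z: "?Z k l \<in> carrier R" if "k \<in> K" "l \<in> K" for k l
    unfolding matrix_defect_def using prod_closed that w by auto
  have LZ: "(\<Oplus>k\<in>K. L i k \<otimes> ?Z k l) = \<zero>" if "i \<in> ?I" "l \<in> K" for i l
    by (rule matrix_defect_annihilated(1)) (use fin L M w LM that in simp_all)
  have ZM: "(\<Oplus>l\<in>K. ?Z k l \<otimes> M l i) = \<zero>" if "k \<in> K" "i \<in> ?I" for i k
    by (rule matrix_defect_annihilated(2)) (use fin L M w LM that in simp_all)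
  define J where "J = {r \<in> carrier R. \<forall>k\<in>K. \<forall>l\<in>K. r \<otimes> ?Z k l = \<zero>}"
  have J_mult: "x \<otimes> r \<in> J" if "r \<in> J" "x \<in> carrier R" for r x
    using that Z by (auto simp: J_def m_assoc)
  have J: "ideal J R"
  proof (rule idealI[OF ring_axioms])
    show "subgroup J (add_monoid R)"
    proof (rule add.subgroupI)
      have "\<zero> \<in> J" using Z by (auto simp: J_def)
      then show "J \<noteq> {}" by blast
    qed (use Z in \<open>auto simp: J_def l_distr l_minus\<close>)
    fix r x assume r: "r \<in> J" and x: "x \<in> carrier R"
    show "x \<otimes> r \<in> J" by (rule J_mult[OF r x])
    then show "r \<otimes> x \<in> J" using r x by (simp add: J_def m_comm)
  qed
  have pivot: "\<exists>a::nat. (M k0 i0 \<otimes> w) [^] a \<in> J" if k0: "k0 \<in> K" for k0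
  proof -
    let ?K = "K - {k0}"
    define u where "u = M k0 i0"
    have u: "u \<in> carrier R" using M k0 by (simp add: u_def)
    define M' where "M' k j = u \<otimes> M k j \<ominus> M k i0 \<otimes> M k0 j" for k j
    have M': "M' k j \<in> carrier R" if "k \<in> K" "j \<in> ?I" for k j
      unfolding M'_def using that u M k0 by auto
    have card: "card I = card ?K" using insert k0 by simp
    have "\<exists>a::nat. \<forall>k\<in>?K. \<forall>l\<in>?K. (u \<otimes> w) [^] a \<otimes> matrix_defect I (u \<otimes> w) L M' k l = \<zero>"
    proof (rule insert.IH[OF _ card])
      fix i j assume ij: "i \<in> I" "j \<in> I"
      then have ne: "i \<noteq> i0" "j \<noteq> i0" using insert.hyps by auto
      have "(\<Oplus>k\<in>?K. L i k \<otimes> M' k j)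
          = (\<Oplus>k\<in>?K. u \<otimes> (L i k \<otimes> M k j) \<ominus> M k0 j \<otimes> (L i k \<otimes> M k i0))"
        unfolding M'_def using L M u ij k0
        by (intro finsum_cong') (auto simp: minus_eq r_distr r_minus m_ac)
      also have "\<dots> = u \<otimes> (\<Oplus>k\<in>?K. L i k \<otimes> M k j) \<ominus> M k0 j \<otimes> (\<Oplus>k\<in>?K. L i k \<otimes> M k i0)"
        by (rule finsum_lin_diff) (use L M u ij k0 fin in auto)
      also have "(\<Oplus>k\<in>?K. L i k \<otimes> M k j) = (if i = j then w else \<zero>) \<ominus> L i k0 \<otimes> M k0 j"
        using finsum_remove[of K k0 "\<lambda>k. L i k \<otimes> M k j"] LM[of i j] L M ij k0 fin by simp
      also have "(\<Oplus>k\<in>?K. L i k \<otimes> M k i0) = \<zero> \<ominus> L i k0 \<otimes> u"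
        using finsum_remove[of K k0 "\<lambda>k. L i k \<otimes> M k i0"] LM[of i i0] L M ij k0 fin ne
        by (simp add: u_def)
      also have "u \<otimes> ((if i = j then w else \<zero>) \<ominus> L i k0 \<otimes> M k0 j) \<ominus> M k0 j \<otimes> (\<zero> \<ominus> L i k0 \<otimes> u)
          = (if i = j then u \<otimes> w else \<zero>)"
        using u w L[of i k0] M[of j k0] ij k0
        by (auto simp: minus_eq r_distr r_minus m_ac a_assoc l_neg)
      finally show "(\<Oplus>k\<in>?K. L i k \<otimes> M' k j) = (if i = j then u \<otimes> w else \<zero>)" .
    qed (use fin L M' u w in auto)
    then obtain a :: nat where a:
      "\<And>k l. k \<in> ?K \<Longrightarrow> l \<in> ?K \<Longrightarrow> (u \<otimes> w) [^] a \<otimes> matrix_defect I (u \<otimes> w) L M' k l = \<zero>"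
      by blast
    define d where "d = (u \<otimes> w) [^] a"
    have d: "d \<in> carrier R" using u w by (simp add: d_def)
    \<comment> \<open>The smaller defect at \<open>(k, l)\<close> is \<open>u Z k l - M k i0 Z k0 l\<close>: modulo the annihilator of \<open>d\<close>, every
      row of \<open>u Z\<close> is a multiple of row \<open>k0\<close>, except in column \<open>k0\<close>.\<close>
    have row: "d \<otimes> (u \<otimes> ?Z k l) = d \<otimes> (M k i0 \<otimes> ?Z k0 l)" if k: "k \<in> K" and l: "l \<in> ?K" for k l
    proof (cases "k = k0")
      case True
      then show ?thesis by (simp add: u_def)
    next
      case False
      have rem: "(\<Oplus>j\<in>I. M k' j \<otimes> L j l) = (\<Oplus>j\<in>?I. M k' j \<otimes> L j l) \<ominus> M k' i0 \<otimes> L i0 l" if "k' \<in> K" for k'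
        using finsum_remove[of ?I i0 "\<lambda>j. M k' j \<otimes> L j l"] L M that l fin insert.hyps by simp
      have "(\<Oplus>j\<in>I. M' k j \<otimes> L j l) = (\<Oplus>j\<in>I. u \<otimes> (M k j \<otimes> L j l) \<ominus> M k i0 \<otimes> (M k0 j \<otimes> L j l))"
        unfolding M'_def using L M u k l k0
        by (intro finsum_cong') (auto simp: minus_eq l_distr l_minus m_assoc)
      also have "\<dots> = u \<otimes> (\<Oplus>j\<in>I. M k j \<otimes> L j l) \<ominus> M k i0 \<otimes> (\<Oplus>j\<in>I. M k0 j \<otimes> L j l)"
        by (rule finsum_lin_diff) (use L M u k l k0 fin in auto)
      also have "\<dots> = u \<otimes> (\<Oplus>j\<in>?I. M k j \<otimes> L j l) \<ominus> M k i0 \<otimes> (\<Oplus>j\<in>?I. M k0 j \<otimes> L j l)"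
      proof -
        have cl: "(\<Oplus>j\<in>?I. M k j \<otimes> L j l) \<in> carrier R" "(\<Oplus>j\<in>?I. M k0 j \<otimes> L j l) \<in> carrier R"
          "M k i0 \<in> carrier R" "L i0 l \<in> carrier R"
          using prod_closed k k0 l L M by auto
        have gen: "u \<otimes> (x \<ominus> m \<otimes> y) \<ominus> m \<otimes> (z \<ominus> u \<otimes> y) = u \<otimes> x \<ominus> m \<otimes> z"
          if "x \<in> carrier R" "m \<in> carrier R" "y \<in> carrier R" "z \<in> carrier R" for x m y z
          using that u by algebra
        show ?thesis unfolding rem[OF k] rem[OF k0] using gen[OF cl(1) cl(3) cl(4) cl(2)] by (simp add: u_def)
      qed
      also have "\<dots> = u \<otimes> (?Z k l \<oplus> (if k = l then w else \<zero>)) \<ominus> M k i0 \<otimes> ?Z k0 l"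
        unfolding matrix_defect_def using prod_closed[OF k, of l] prod_closed[OF k0, of l] l w by (auto simp: minus_eq a_assoc l_neg)
      finally have "matrix_defect I (u \<otimes> w) L M' k l = u \<otimes> ?Z k l \<ominus> M k i0 \<otimes> ?Z k0 l"
      proof -
        assume eq: "(\<Oplus>j\<in>I. M' k j \<otimes> L j l) = u \<otimes> (?Z k l \<oplus> (if k = l then w else \<zero>)) \<ominus> M k i0 \<otimes> ?Z k0 l"
        have gen: "u \<otimes> (x \<oplus> z) \<ominus> y \<ominus> u \<otimes> z = u \<otimes> x \<ominus> y" 
          if "x \<in> carrier R" "y \<in> carrier R" "z \<in> carrier R" for x y z
          using that u by algebra
        have "(if k = l then u \<otimes> w else \<zero>) = u \<otimes> (if k = l then w else \<zero>)" using u by simp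
        then show ?thesis unfolding matrix_defect_def[of I] eq
          using gen[of "?Z k l" "M k i0 \<otimes> ?Z k0 l" "if k = l then w else \<zero>"] Z k k0 l M w by simp
      qed
      then have "d \<otimes> (u \<otimes> ?Z k l \<ominus> M k i0 \<otimes> ?Z k0 l) = \<zero>"
        using a[of k l] k l False by (simp add: d_def)
      moreover have "u \<otimes> ?Z k l \<in> carrier R" "M k i0 \<otimes> ?Z k0 l \<in> carrier R"
        using u M Z k k0 l by auto
      ultimately show ?thesis using d by (simp add: minus_eq r_distr r_minus r_right_minus_eq[unfolded minus_eq])
    qed
    \<comment> \<open>Row \<open>i0\<close> of \<open>L Z = 0\<close> then says that row \<open>k0\<close> of \<open>Z\<close>, multiplied by \<open>d w\<close>, vanishes off column \<open>k0\<close>.\<close>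
    have dw: "d \<otimes> w \<otimes> ?Z k0 l = \<zero>" if l: "l \<in> ?K" for l
    proof -
      have "\<zero> = (d \<otimes> u) \<otimes> (\<Oplus>k\<in>K. L i0 k \<otimes> ?Z k l)"
        using LZ[of i0 l] l d u by simp
      also have "\<dots> = (\<Oplus>k\<in>K. (d \<otimes> u) \<otimes> (L i0 k \<otimes> ?Z k l))"
        using fin L Z l d u by (intro finsum_rdistr) auto
      also have "\<dots> = (\<Oplus>k\<in>K. (d \<otimes> ?Z k0 l) \<otimes> (L i0 k \<otimes> M k i0))"
      proof (rule finsum_cong')
        fix k assume k: "k \<in> K"
        have c: "L i0 k \<in> carrier R" "M k i0 \<in> carrier R" "?Z k l \<in> carrier R" "?Z k0 l \<in> carrier R"
          using L M Z k k0 l by auto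
        have "(d \<otimes> u) \<otimes> (L i0 k \<otimes> ?Z k l) = L i0 k \<otimes> (d \<otimes> (u \<otimes> ?Z k l))"
          using c d u by (simp add: m_ac)
        also have "\<dots> = L i0 k \<otimes> (d \<otimes> (M k i0 \<otimes> ?Z k0 l))" using row[OF k l] by simp
        also have "\<dots> = (d \<otimes> ?Z k0 l) \<otimes> (L i0 k \<otimes> M k i0)" using c d by (simp add: m_ac)
        finally show "(d \<otimes> u) \<otimes> (L i0 k \<otimes> ?Z k l) = (d \<otimes> ?Z k0 l) \<otimes> (L i0 k \<otimes> M k i0)" .
      qed (use L M Z k0 l d in auto)
      also have "\<dots> = (d \<otimes> ?Z k0 l) \<otimes> (\<Oplus>k\<in>K. L i0 k \<otimes> M k i0)"
        using fin L M Z k0 l d by (intro finsum_rdistr[symmetric]) auto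
      finally show ?thesis using LM[of i0 i0] Z[OF k0, of l] l d w by (simp add: m_ac)
    qed
    have dwu: "d \<otimes> w \<otimes> u \<otimes> ?Z k l = \<zero>" if k: "k \<in> K" and l: "l \<in> ?K" for k l
    proof -
      have c: "M k i0 \<in> carrier R" "?Z k l \<in> carrier R" "?Z k0 l \<in> carrier R"
        using M Z k k0 l by auto
      have "d \<otimes> w \<otimes> u \<otimes> ?Z k l = w \<otimes> (d \<otimes> (u \<otimes> ?Z k l))" using c d w u by (simp add: m_ac)
      also have "\<dots> = M k i0 \<otimes> (d \<otimes> w \<otimes> ?Z k0 l)" unfolding row[OF k l] using c d w by (simp add: m_ac)
      finally show ?thesis using dw[OF l] c by simp
    qed
    \<comment> \<open>For column \<open>k0\<close>, use column \<open>i0\<close> of \<open>Z M = 0\<close>, of which only the summand \<open>l = k0\<close> survives.\<close>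
    have dwuu: "d \<otimes> w \<otimes> u \<otimes> u \<otimes> ?Z k k0 = \<zero>" if k: "k \<in> K" for k
    proof -
      have "\<zero> = (d \<otimes> w \<otimes> u) \<otimes> (\<Oplus>l\<in>K. ?Z k l \<otimes> M l i0)"
        using ZM[of k i0] k d w u by simp
      also have "\<dots> = (\<Oplus>l\<in>K. (d \<otimes> w \<otimes> u) \<otimes> (?Z k l \<otimes> M l i0))"
        using fin M Z k d w u by (intro finsum_rdistr) auto
      also have "\<dots> = (\<Oplus>l\<in>K. if k0 = l then (d \<otimes> w \<otimes> u) \<otimes> (?Z k l \<otimes> M l i0) else \<zero>)"
      proof (rule finsum_cong')
        fix l assume l: "l \<in> K"
        have "(d \<otimes> w \<otimes> u) \<otimes> (?Z k l \<otimes> M l i0) = \<zero>" if "k0 \<noteq> l"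
        proof -
          have "(d \<otimes> w \<otimes> u) \<otimes> (?Z k l \<otimes> M l i0) = (d \<otimes> w \<otimes> u \<otimes> ?Z k l) \<otimes> M l i0"
            using Z[OF k l] M[of i0 l] l d w u by (simp add: m_assoc)
          then show ?thesis using dwu[OF k, of l] that l M by simp
        qed
        then show "(d \<otimes> w \<otimes> u) \<otimes> (?Z k l \<otimes> M l i0)
            = (if k0 = l then (d \<otimes> w \<otimes> u) \<otimes> (?Z k l \<otimes> M l i0) else \<zero>)" by simp
      qed (use M Z k d w u in auto)
      also have "\<dots> = (d \<otimes> w \<otimes> u) \<otimes> (?Z k k0 \<otimes> M k0 i0)"
        by (rule finsum_singleton) (use k0 fin M Z k d w u in auto)
      finally show ?thesis using Z[OF k k0] d w u by (simp add: u_def[symmetric] m_ac)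
    qed
    have c: "d \<otimes> w \<otimes> u \<otimes> u \<in> J"
      unfolding J_def
    proof (intro CollectI conjI ballI)
      fix k l assume k: "k \<in> K" and l: "l \<in> K"
      show "d \<otimes> w \<otimes> u \<otimes> u \<otimes> ?Z k l = \<zero>"
      proof (cases "l = k0")
        case True
        then show ?thesis using dwuu[OF k] by simp
      next
        case False
        have "d \<otimes> w \<otimes> u \<otimes> u \<otimes> ?Z k l = u \<otimes> (d \<otimes> w \<otimes> u \<otimes> ?Z k l)"
          using Z[OF k l] d w u by (simp add: m_ac)
        then show ?thesis using dwu[OF k, of l] l False u by simp
      qed
    qed (use d w u in auto)
    have "(u \<otimes> w) [^] (a + 2) = w \<otimes> (d \<otimes> w \<otimes> u \<otimes> u)"
      using u w by (simp add: d_def numeral_2_eq_2 m_ac)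
    also have "\<dots> \<in> J" using ideal.I_l_closed[OF J c w] .
    finally show ?thesis unfolding u_def by blast
  qed
  have "\<exists>a::nat. w [^] a \<in> J"
  proof (rule ccontr)
    assume "\<not> ?thesis"
    then obtain Q where Q: "primeideal Q R" "J \<subseteq> Q" "w \<notin> Q"
      using prime_ideal_avoiding_powers[OF J w] by blast
    interpret Q: primeideal Q R by fact
    have "M k i0 \<in> Q" if k: "k \<in> K" for k
    proof -
      obtain a :: nat where a: "(M k i0 \<otimes> w) [^] a \<in> Q" using pivot[OF k] Q(2) by blast
      have c: "M k i0 \<in> carrier R" using M k by simp
      have "M k i0 \<otimes> w \<in> Q" by (rule Q.prime_power_mem[OF _ a]) (use c w in simp)
      then show ?thesis using Q.I_prime[OF c w] Q(3) by blast
    qed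
    then have "(\<Oplus>k\<in>K. L i0 k \<otimes> M k i0) \<in> Q"
      using L by (intro finsum_mem_ideal[OF Q.is_ideal] Q.I_l_closed) auto
    then show False using LM[of i0 i0] Q(3) by simp
  qed
  then show ?case unfolding J_def by blast
qed

text \<open>Over a commutative ring a left inverse of a square matrix is a right inverse. This is what excludes
  that \<open>n\<close> polynomials generate a polynomial ring in \<open>n\<close> variables while satisfying a relation.\<close>

lemma matrix_right_inverse:
  assumes "finite I"
    and L: "\<And>i k. i \<in> I \<Longrightarrow> k \<in> I \<Longrightarrow> L i k \<in> carrier R"
    and M: "\<And>i k. i \<in> I \<Longrightarrow> k \<in> I \<Longrightarrow> M k i \<in> carrier R"
    and LM: "\<And>i j. i \<in> I \<Longrightarrow> j \<in> I \<Longrightarrow> (\<Oplus>k\<in>I. L i k \<otimes> M k j) = (if i = j then \<one> else \<zero>)"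
    and kl: "k \<in> I" "l \<in> I"
  shows "(\<Oplus>j\<in>I. M k j \<otimes> L j l) = (if k = l then \<one> else \<zero>)"
proof -
  have cl: "(\<Oplus>j\<in>I. M k j \<otimes> L j l) \<in> carrier R" using L M kl by (intro finsum_closed) auto
  obtain a :: nat where "\<one> [^] a \<otimes> matrix_defect I \<one> L M k l = \<zero>"
    using matrix_defect_power[OF assms(1) assms(1) refl L M one_closed LM] kl by blast
  then have "(\<Oplus>j\<in>I. M k j \<otimes> L j l) \<ominus> (if k = l then \<one> else \<zero>) = \<zero>"
    using cl by (simp add: matrix_defect_def split: if_splits)
  then show ?thesis using cl r_right_minus_eq[of "(\<Oplus>j\<in>I. M k j \<otimes> L j l)" "if k = l then \<one> else \<zero>"] by auto
qed

end

section \<open>Generation up to nilpotents\<close>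

context cring
begin

text \<open>Inserting the decomposition of \<open>r\<close> into \<open>q = s + j + x r\<close> repeatedly replaces \<open>x\<close> by its powers.\<close>

lemma subring_absorb_nilpotent:
  assumes S: "subring S R" and I: "ideal I R" and x: "x \<in> S" "x [^] (k::nat) = \<zero>"
    and dec: "\<And>q. q \<in> carrier R \<Longrightarrow> \<exists>s\<in>S. \<exists>j\<in>I. \<exists>r\<in>carrier R. q = s \<oplus> j \<oplus> x \<otimes> r"
    and q: "q \<in> carrier R"
  shows "\<exists>s\<in>S. \<exists>j\<in>I. q = s \<oplus> j"
proof -
  interpret I: ideal I R by fact
  note S_simps = subringE[OF S]
  have xc: "x \<in> carrier R" using x S_simps(1) by auto
  have xk: "x [^] (k::nat) \<in> S" for k by (induction k) (auto simp: S_simps x)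
  have "\<exists>s\<in>S. \<exists>j\<in>I. \<exists>r\<in>carrier R. q = s \<oplus> j \<oplus> x [^] k \<otimes> r" for k :: nat
  proof (induction k)
    case 0
    have "q = \<zero> \<oplus> \<zero> \<oplus> x [^] (0::nat) \<otimes> q" using q by simp
    then show ?case using q S_simps(2) I.zero_closed by blast
  next
    case (Suc k)
    then obtain s j r where *: "s \<in> S" "j \<in> I" "r \<in> carrier R" "q = s \<oplus> j \<oplus> x [^] k \<otimes> r" by blast
    obtain s' j' r' where **: "s' \<in> S" "j' \<in> I" "r' \<in> carrier R" "r = s' \<oplus> j' \<oplus> x \<otimes> r'"
      using dec[OF *(3)] by blast
    have c: "s \<in> carrier R" "s' \<in> carrier R" "j \<in> carrier R" "j' \<in> carrier R"
      using * ** S_simps(1) I.Icarr by auto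
    have "q = (s \<oplus> x [^] k \<otimes> s') \<oplus> (j \<oplus> x [^] k \<otimes> j') \<oplus> x [^] Suc k \<otimes> r'"
      using *(4) **(4) c **(3) xc by (simp add: r_distr m_assoc a_ac)
    moreover have "s \<oplus> x [^] k \<otimes> s' \<in> S" using * ** xk by (intro S_simps)
    moreover have "j \<oplus> x [^] k \<otimes> j' \<in> I" using * ** xc by (intro I.a_closed I.I_l_closed) auto
    ultimately show ?case using **(3) by blast
  qed
  from this[of k] obtain s j r where *: "s \<in> S" "j \<in> I" "r \<in> carrier R" "q = s \<oplus> j \<oplus> x [^] k \<otimes> r" by blast
  then have "q = s \<oplus> j" using x(2) S_simps(1) I.Icarr by auto
  then show ?thesis using * by blast
qed

text \<open>A form of Nakayama's lemma for subrings: a finite set of nilpotents does not contribute to the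
  generation of \<open>R\<close>. The nilpotents are discarded one at a time.\<close>

lemma subring_eq_carrier_mod_nilpotents:
  assumes S: "subring S R" and G: "finite G" "G \<subseteq> S" "G \<subseteq> nilradical R"
    and dec: "\<And>q. q \<in> carrier R \<Longrightarrow> \<exists>s\<in>S. \<exists>j\<in>Idl G. q = s \<oplus> j"
  shows "S = carrier R"
  using G dec
proof (induction G rule: finite_induct)
  case empty
  have "Idl {} \<subseteq> {\<zero>}" by (rule genideal_minimal[OF zeroideal]) simp
  then have "carrier R \<subseteq> S"
    using empty.prems(3) subringE(1)[OF S] by fastforce
  then show ?case using subringE(1)[OF S] by blast
next
  case (insert x G)
  have Gc: "G \<subseteq> carrier R" "x \<in> carrier R" using insert.prems subringE(1)[OF S] by auto
  obtain k :: nat where k: "x [^] k = \<zero>" using insert.prems(2) by (auto simp: nilradical_iff)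
  have I: "ideal (Idl G) R" by (rule genideal_ideal[OF Gc(1)])
  have J: "ideal (Idl G <+> PIdl x) R" by (rule add_ideals[OF I cgenideal_ideal[OF Gc(2)]])
  have "insert x G \<subseteq> Idl G <+> PIdl x"
  proof
    fix y assume "y \<in> insert x G"
    then consider "y = x" | "y \<in> G" by blast
    then show "y \<in> Idl G <+> PIdl x"
    proof cases
      case 1
      have "x = \<zero> \<oplus> \<one> \<otimes> x" using Gc by simp
      moreover have "\<zero> \<in> Idl G" using I by (simp add: additive_subgroup.zero_closed ideal.axioms(1))
      ultimately show ?thesis unfolding mem_add_PIdl 1 by blast
    next
      case 2
      then have "y \<in> Idl G" "y = y \<oplus> \<zero> \<otimes> x" using genideal_self[OF Gc(1)] Gc by auto
      then show ?thesis unfolding mem_add_PIdl by blast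
    qed
  qed
  then have sub: "Idl (insert x G) \<subseteq> Idl G <+> PIdl x" by (rule genideal_minimal[OF J])
  show ?case
  proof (rule insert.IH)
    fix q assume q: "q \<in> carrier R"
    show "\<exists>s\<in>S. \<exists>j\<in>Idl G. q = s \<oplus> j"
    proof (rule subring_absorb_nilpotent[OF S I _ k _ q])
      show "x \<in> S" using insert.prems by simp
      fix q assume "q \<in> carrier R"
      then obtain s j where sj: "s \<in> S" "j \<in> Idl (insert x G)" "q = s \<oplus> j" using insert.prems(3) by blast
      then obtain y r where yr: "y \<in> Idl G" "r \<in> carrier R" "j = y \<oplus> r \<otimes> x"
        using sub mem_add_PIdl by blast
      have "s \<in> carrier R" "y \<in> carrier R" using sj yr subringE(1)[OF S] ideal.Icarr[OF I] by auto
      then have "q = s \<oplus> y \<oplus> x \<otimes> r" using sj yr Gc by (simp add: a_assoc m_comm)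
      then show "\<exists>s\<in>S. \<exists>j\<in>Idl G. \<exists>r\<in>carrier R. q = s \<oplus> j \<oplus> x \<otimes> r" using sj yr by blast
    qed
  qed (use insert.prems in auto)
qed

lemma subring_add_ideal:
  assumes S: "subring S R" and I: "ideal I R"
  shows "subring {q \<in> carrier R. \<exists>s\<in>S. q \<ominus> s \<in> I} R"
proof (rule subringI)
  interpret I: ideal I R by fact
  note S' = subringE[OF S]
  show "\<one> \<in> {q \<in> carrier R. \<exists>s\<in>S. q \<ominus> s \<in> I}"
    using S'(3) I.zero_closed by (auto intro!: bexI[of _ \<one>] simp: minus_eq r_neg)
  {
    fix p assume "p \<in> {q \<in> carrier R. \<exists>s\<in>S. q \<ominus> s \<in> I}"
    then obtain s where s: "p \<in> carrier R" "s \<in> S" "p \<ominus> s \<in> I" by blast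
    then have "\<ominus> (p \<ominus> s) = \<ominus> p \<ominus> \<ominus> s" using S'(1) by (auto simp: minus_eq minus_add)
    then show "\<ominus> p \<in> {q \<in> carrier R. \<exists>s\<in>S. q \<ominus> s \<in> I}"
      using s I.a_inv_closed[OF s(3)] S'(5)[OF s(2)] by auto
  }
  fix p q assume "p \<in> {q \<in> carrier R. \<exists>s\<in>S. q \<ominus> s \<in> I}" "q \<in> {q \<in> carrier R. \<exists>s\<in>S. q \<ominus> s \<in> I}"
  then obtain s t where st: "p \<in> carrier R" "s \<in> S" "p \<ominus> s \<in> I" "q \<in> carrier R" "t \<in> S" "q \<ominus> t \<in> I" by blast
  then have c: "s \<in> carrier R" "t \<in> carrier R" using S'(1) by auto
  have "p \<otimes> q \<ominus> s \<otimes> t = p \<otimes> (q \<ominus> t) \<oplus> (p \<ominus> s) \<otimes> t"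
    using st(1,4) c by algebra
  moreover have "\<dots> \<in> I" using st c by (intro I.a_closed I.I_l_closed I.I_r_closed) auto
  ultimately show "p \<otimes> q \<in> {q \<in> carrier R. \<exists>s\<in>S. q \<ominus> s \<in> I}"
    using S'(6)[OF st(2,5)] st(1,4) by (auto intro!: bexI[of _ "s \<otimes> t"])
  have "(p \<oplus> q) \<ominus> (s \<oplus> t) = (p \<ominus> s) \<oplus> (q \<ominus> t)"
    using st(1,4) c by algebra
  moreover have "\<dots> \<in> I" using st by (intro I.a_closed)
  ultimately show "p \<oplus> q \<in> {q \<in> carrier R. \<exists>s\<in>S. q \<ominus> s \<in> I}"
    using S'(7)[OF st(2,5)] st(1,4) by (auto intro!: bexI[of _ "s \<oplus> t"])
qed auto

end

context mpoly_cring
begin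

lemma subring_vars_eq_carrier:
  assumes S: "subring S P" and const: "indexed_const ` carrier R \<subseteq> S"
    and vars: "\<And>i. i < n \<Longrightarrow> indexed_var i \<in> S"
  shows "S = carrier P"
proof -
  have "p \<in> S" if "p \<in> carrier P" for p
    using that
    by (induction p rule: P_induct) (use const vars subringE[OF S] in auto)
  then show ?thesis using subringE(1)[OF S] by blast
qed

text \<open>Only the finitely many coefficients of the polynomials \<open>x\<^sub>i - p\<^sub>i\<close> matter; they generate an ideal to
  which Nakayama's lemma applies, although the whole nilradical need not be nilpotent.\<close>

lemma subring_eq_carrier_mod_nil:
  assumes S: "subring S P" and const: "indexed_const ` carrier R \<subseteq> S"
    and vars: "\<And>i. i < n \<Longrightarrow> \<exists>p\<in>S. indexed_var i \<ominus>\<^bsub>P\<^esub> p \<in> coeff_ideal (nilradical R)"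
  shows "S = carrier P"
proof -
  obtain p where p: "\<And>i. i < n \<Longrightarrow> p i \<in> S"
    and nu: "\<And>i. i < n \<Longrightarrow> indexed_var i \<ominus>\<^bsub>P\<^esub> p i \<in> coeff_ideal (nilradical R)"
    using vars by metis
  define \<nu> where "\<nu> i = indexed_var i \<ominus>\<^bsub>P\<^esub> p i" for i
  have nu_P: "\<nu> i \<in> carrier P" if "i < n" for i using nu[OF that] by (auto simp: \<nu>_def coeff_ideal_def)
  define C where "C = (\<Union>i<n. \<nu> i ` {m. \<nu> i m \<noteq> \<zero>})"
  define G :: "(nat multiset \<Rightarrow> 'a) set" where "G = indexed_const ` C"
  have C: "finite C" "C \<subseteq> nilradical R"
    using finite_support[OF nu_P] nu by (auto simp: C_def \<nu>_def coeff_ideal_def)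
  then have CR: "C \<subseteq> carrier R" by (auto simp: nilradical_def)
  have GP: "G \<subseteq> carrier P" using CR by (auto simp: G_def)
  interpret I: ideal "genideal P G" P by (rule P.genideal_ideal[OF GP])
  have G_nil: "G \<subseteq> nilradical P"
  proof
    fix x assume "x \<in> G"
    then obtain c where c: "c \<in> C" "x = indexed_const c" by (auto simp: G_def)
    then obtain k :: nat where k: "c \<in> carrier R" "c [^] k = \<zero>" using C(2) nilradical_iff by blast
    interpret h: ring_hom_ring R P indexed_const
      by (rule ring_hom_ringI2[OF ring_axioms P.ring_axioms const_hom])
    have "x [^]\<^bsub>P\<^esub> k = \<zero>\<^bsub>P\<^esub>" using h.hom_nat_pow[of c k] k c by simp
    then show "x \<in> nilradical P" using c k by (auto simp: P.nilradical_iff)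
  qed
  have nu_I: "\<nu> i \<in> genideal P G" if i: "i < n" for i
  proof -
    have "indexed_const (\<nu> i m) \<otimes>\<^bsub>P\<^esub> monomial_eval P n indexed_var m \<in> genideal P G" if "\<nu> i m \<noteq> \<zero>" for m
    proof (rule I.I_r_closed)
      have "indexed_const (\<nu> i m) \<in> G" using that i by (auto simp: G_def C_def)
      then show "indexed_const (\<nu> i m) \<in> genideal P G" using P.genideal_self[OF GP] by blast
    qed auto
    then have "(\<Oplus>\<^bsub>P\<^esub>m\<in>{m. \<nu> i m \<noteq> \<zero>}. indexed_const (\<nu> i m) \<otimes>\<^bsub>P\<^esub> monomial_eval P n indexed_var m) \<in> genideal P G"
      by (intro P.finsum_mem_ideal[OF I.is_ideal]) auto
    then show ?thesis using poly_expansion[OF nu_P[OF i]] by simp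
  qed
  let ?V = "{q \<in> carrier P. \<exists>s\<in>S. q \<ominus>\<^bsub>P\<^esub> s \<in> genideal P G}"
  have V: "?V = carrier P"
  proof (rule subring_vars_eq_carrier)
    show "subring ?V P" by (rule P.subring_add_ideal[OF S I.is_ideal])
    show "indexed_const ` carrier R \<subseteq> ?V"
    proof
      fix q :: "nat multiset \<Rightarrow> 'a"
      assume "q \<in> indexed_const ` carrier R"
      then have "q \<in> S" "q \<in> carrier P" using const by auto
      then show "q \<in> ?V" using I.zero_closed by (auto intro!: bexI[of _ q] simp: P.minus_eq P.r_neg)
    qed
    show "indexed_var i \<in> ?V" if "i < n" for i
      using p[OF that] nu_I[OF that] that by (auto simp: \<nu>_def)
  qed
  show ?thesis
  proof (rule P.subring_eq_carrier_mod_nilpotents[OF S _ _ G_nil])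
    show "finite G" using C by (simp add: G_def)
    show "G \<subseteq> S" using const CR by (auto simp: G_def)
    fix q assume q: "q \<in> carrier P"
    then obtain s where s: "s \<in> S" "q \<ominus>\<^bsub>P\<^esub> s \<in> genideal P G" using V by blast
    have "s \<in> carrier P" using s subringE(1)[OF S] by auto
    then have "q = s \<oplus>\<^bsub>P\<^esub> (q \<ominus>\<^bsub>P\<^esub> s)" using q by algebra
    then show "\<exists>s\<in>S. \<exists>j\<in>genideal P G. q = s \<oplus>\<^bsub>P\<^esub> j" using s by blast
  qed
qed

end

section \<open>Generators of a polynomial ring\<close>

sublocale mpoly_eval \<subseteq> E: ring_hom_cring P T E
  by unfold_locales (rule E_hom)

context mpoly_cring
begin

lemma finsum_coeff:
  assumes "\<And>i. i \<in> A \<Longrightarrow> f i \<in> carrier P"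
  shows "(finsum P f A) m = (\<Oplus>i\<in>A. f i m)"
proof (cases "finite A")
  case True
  then show ?thesis using assms
  proof (induction A)
    case (insert a A)
    have "finsum P f (insert a A) = f a \<oplus>\<^bsub>P\<^esub> finsum P f A"
      by (rule P.finsum_insert) (use insert in auto)
    moreover have "(\<Oplus>i\<in>insert a A. f i m) = f a m \<oplus> (\<Oplus>i\<in>A. f i m)"
      by (rule finsum_insert) (use insert in auto)
    ultimately show ?case using insert by (simp only: add_coeff) auto
  qed (simp add: zero_coeff)
qed (simp add: zero_coeff)

lemma mult_coeff_empty:
  assumes "p \<in> carrier P" "q \<in> carrier P"
  shows "(p \<otimes>\<^bsub>P\<^esub> q) {#} = p {#} \<otimes> q {#}"
proof -
  have "{u. u \<subseteq># {#}} = {{#}}" by auto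
  then show ?thesis using assms by (simp add: mult_coeff)
qed

lemma mult_coeff_single:
  assumes "p \<in> carrier P" "q \<in> carrier P"
  shows "(p \<otimes>\<^bsub>P\<^esub> q) {#j#} = p {#} \<otimes> q {#j#} \<oplus> q {#} \<otimes> p {#j#}"
proof -
  have "{u. u \<subseteq># {#j#}} = {{#}, {#j#}}" 
    by (auto simp: subset_mset.le_iff_add)
      (metis add_diff_cancel_left' diff_add_zero insert_noteq_member single_is_union)
  then show ?thesis using assms by (simp add: mult_coeff m_comm)
qed

text \<open>The \<open>k\<close>-th power of the ideal generated by the variables.\<close>

definition order_ideal :: "nat \<Rightarrow> (nat multiset \<Rightarrow> 'a) set"
  where "order_ideal k = {p \<in> carrier P. \<forall>m. size m < k \<longrightarrow> p m = \<zero>}"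

lemma order_ideal_mult:
  assumes p: "p \<in> order_ideal k" and q: "q \<in> order_ideal l"
  shows "p \<otimes>\<^bsub>P\<^esub> q \<in> order_ideal (k + l)"
proof -
  have pq: "p \<in> carrier P" "q \<in> carrier P" using p q by (auto simp: order_ideal_def)
  have "(p \<otimes>\<^bsub>P\<^esub> q) m = \<zero>" if m: "size m < k + l" for m
  proof -
    have "p u \<otimes> q (m - u) = \<zero>" if "u \<subseteq># m" for u
    proof (cases "size u < k")
      case True
      then have "p u = \<zero>" using p by (auto simp: order_ideal_def)
      then show ?thesis using pq by simp
    next
      case False
      then have "size (m - u) < l" using m that size_mset_mono[OF that] by (simp add: size_Diff_submset)
      then have "q (m - u) = \<zero>" using q by (auto simp: order_ideal_def)
      then show ?thesis using pq by simp
    qed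
    then have "(\<Oplus>u\<in>{u. u \<subseteq># m}. p u \<otimes> q (m - u)) = (\<Oplus>u\<in>{u. u \<subseteq># m}. \<zero>)"
      by (intro finsum_cong') auto
    then show ?thesis by (simp add: mult_coeff)
  qed
  then show ?thesis using pq by (simp add: order_ideal_def)
qed

lemma order_ideal_0: "order_ideal 0 = carrier P"
  by (auto simp: order_ideal_def)

lemma order_ideal_mono: "k \<le> l \<Longrightarrow> order_ideal l \<subseteq> order_ideal k"
  by (auto simp: order_ideal_def)

lemma ideal_order_ideal: "ideal (order_ideal k) P"
proof (rule idealI[OF P.ring_axioms])
  show "subgroup (order_ideal k) (add_monoid P)"
  proof (rule P.add.subgroupI)
    have "\<zero>\<^bsub>P\<^esub> \<in> order_ideal k" by (auto simp: order_ideal_def zero_coeff)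
    then show "order_ideal k \<noteq> {}" by blast
  qed (auto simp: order_ideal_def add_coeff minus_coeff)
  fix p q assume pq: "p \<in> order_ideal k" "q \<in> carrier P"
  then show "p \<otimes>\<^bsub>P\<^esub> q \<in> order_ideal k" "q \<otimes>\<^bsub>P\<^esub> p \<in> order_ideal k"
    using order_ideal_mult[of p k q 0] order_ideal_mult[of q 0 p k] by (auto simp: order_ideal_0)
qed

lemma order_ideal_2I:
  assumes "p \<in> carrier P" "p {#} = \<zero>" "\<And>j. j < n \<Longrightarrow> p {#j#} = \<zero>"
  shows "p \<in> order_ideal 2"
proof -
  have "p m = \<zero>" if m: "size m < 2" for m
  proof (cases "m = {#}")
    case True
    then show ?thesis using assms by simp
  next
    case False
    then have "size m = 1" using m by (simp add: nonempty_has_size)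
    then obtain j where j: "m = {#j#}" using size_1_singleton_mset[of m] by blast
    show ?thesis
    proof (rule ccontr)
      assume *: "p m \<noteq> \<zero>"
      then have "set_mset {#j#} \<subseteq> {..<n}" using support_vars[OF assms(1), of m] j by blast
      then have "j < n" by simp
      then show False using assms(3) j * by simp
    qed
  qed
  then show ?thesis using assms by (simp add: order_ideal_def)
qed

text \<open>The linear coefficients of \<open>p q\<close> are \<open>p(0)\<close> times those of \<open>q\<close> plus \<open>q(0)\<close> times those of \<open>p\<close>.
  So the polynomials whose linear part is a combination of the linear parts of the \<open>s k\<close> form a subring,
  whatever the constant terms of the \<open>s k\<close> are.\<close>

lemma linear_coeffs_spanned:
  assumes s: "\<And>k. k < n \<Longrightarrow> s k \<in> carrier P"
    and gen: "\<And>S. \<lbrakk>subring S P; indexed_const ` carrier R \<subseteq> S; \<And>k. k < n \<Longrightarrow> s k \<in> S\<rbrakk> \<Longrightarrow> S = carrier P"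
    and q: "q \<in> carrier P"
  shows "\<exists>c. (\<forall>k<n. c k \<in> carrier R) \<and> (\<forall>j<n. (\<Oplus>k\<in>{..<n}. c k \<otimes> s k {#j#}) = q {#j#})"
proof -
  let ?ok = "\<lambda>q c. (\<forall>k<n. c k \<in> carrier R) \<and> (\<forall>j<n. (\<Oplus>k\<in>{..<n}. c k \<otimes> s k {#j#}) = q {#j#})"
  let ?S = "{q \<in> carrier P. \<exists>c. ?ok q c}"
  have sc: "s k m \<in> carrier R" if "k < n" for k m using s[OF that] by auto
  have lin: "\<exists>c. ?ok r c"
    if "?ok p c" "?ok q d" "x \<in> carrier R" "y \<in> carrier R" "\<And>j. r {#j#} = x \<otimes> p {#j#} \<oplus> y \<otimes> q {#j#}" for p q r c d x y
  proof -
    have "(\<Oplus>k\<in>{..<n}. (x \<otimes> c k \<oplus> y \<otimes> d k) \<otimes> s k {#j#}) = r {#j#}" if j: "j < n" for j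
    proof -
      have "(\<Oplus>k\<in>{..<n}. (x \<otimes> c k \<oplus> y \<otimes> d k) \<otimes> s k {#j#})
          = (\<Oplus>k\<in>{..<n}. x \<otimes> (c k \<otimes> s k {#j#}) \<oplus> y \<otimes> (d k \<otimes> s k {#j#}))"
        using that \<open>?ok p c\<close> \<open>?ok q d\<close> sc \<open>x \<in> _\<close> \<open>y \<in> _\<close> by (intro finsum_cong') (auto simp: l_distr m_assoc)
      also have "\<dots> = x \<otimes> (\<Oplus>k\<in>{..<n}. c k \<otimes> s k {#j#}) \<oplus> y \<otimes> (\<Oplus>k\<in>{..<n}. d k \<otimes> s k {#j#})"
        using \<open>?ok p c\<close> \<open>?ok q d\<close> sc \<open>x \<in> _\<close> \<open>y \<in> _\<close> by (intro finsum_lin) auto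
      finally show ?thesis using \<open>?ok p c\<close> \<open>?ok q d\<close> j that(1) \<open>r _ = _\<close>[of j] by simp
    qed
    then show ?thesis using that by (intro exI[of _ "\<lambda>k. x \<otimes> c k \<oplus> y \<otimes> d k"]) auto
  qed
  have zero: "?ok q (\<lambda>_. \<zero>)" if "\<And>j. q {#j#} = \<zero>" for q
  proof -
    have "(\<Oplus>k\<in>{..<n}. \<zero> \<otimes> s k {#j#}) = (\<Oplus>k\<in>{..<n}. \<zero>)" for j
      using sc by (intro finsum_cong') auto
    then show ?thesis using that by simp
  qed
  have "?S = carrier P"
  proof (rule gen)
    show "subring ?S P"
    proof (rule P.subringI)
      show "\<one>\<^bsub>P\<^esub> \<in> ?S" using zero[of "\<one>\<^bsub>P\<^esub>"] by (auto simp: one_coeff)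
      fix p assume "p \<in> ?S"
      then obtain c where p: "p \<in> carrier P" "?ok p c" by blast
      have "\<exists>c. ?ok (\<ominus>\<^bsub>P\<^esub> p) c"
        by (rule lin[OF p(2) p(2), of "\<ominus> \<one>" \<zero>]) (use p in \<open>auto simp: minus_coeff l_minus\<close>)
      then show "\<ominus>\<^bsub>P\<^esub> p \<in> ?S" using p by simp
    next
      fix p q assume "p \<in> ?S" "q \<in> ?S"
      then obtain c d where p: "p \<in> carrier P" "?ok p c" and q: "q \<in> carrier P" "?ok q d" by blast
      have "\<exists>c. ?ok (p \<oplus>\<^bsub>P\<^esub> q) c"
        by (rule lin[OF p(2) q(2), of \<one> \<one>]) (use p(1) q(1) in \<open>auto simp: add_coeff\<close>)
      then show "p \<oplus>\<^bsub>P\<^esub> q \<in> ?S" using p q by simp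
      have "\<exists>c. ?ok (p \<otimes>\<^bsub>P\<^esub> q) c"
        by (rule lin[OF q(2) p(2), of "p {#}" "q {#}"]) (use p(1) q(1) in \<open>auto simp: mult_coeff_single\<close>)
      then show "p \<otimes>\<^bsub>P\<^esub> q \<in> ?S" using p q by simp
    qed auto
    show "indexed_const ` carrier R \<subseteq> ?S"
    proof (intro image_subsetI CollectI conjI)
      fix a assume a: "a \<in> carrier R"
      show "indexed_const a \<in> carrier P" by (rule const_closed[OF a])
      have "indexed_const a {#j#} = \<zero>" for j :: nat by (simp add: indexed_const_def)
      from zero[of "indexed_const a", OF this]
      show "\<exists>c. ?ok (indexed_const a) c" by (rule exI[of _ "\<lambda>_. \<zero>"])
    qed
    fix k assume k: "k < n"
    have "(\<Oplus>i\<in>{..<n}. (if k = i then \<one> else \<zero>) \<otimes> s i {#j#}) = \<one> \<otimes> s k {#j#}" for j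
      by (rule finsum_kronecker(1)) (use k sc in auto)
    then have "?ok (s k) (\<lambda>i. if k = i then \<one> else \<zero>)" using sc[OF k] by simp
    then have "\<exists>c. ?ok (s k) c" by (rule exI[of _ "\<lambda>i. if k = i then \<one> else \<zero>"])
    then show "s k \<in> ?S" using s[OF k] by simp
  qed
  then show ?thesis using q by blast
qed

text \<open>The substitution \<open>x\<^sub>i \<mapsto> g i\<close> acts as the identity on the graded ring of the powers of the ideal
  generated by the variables: it does not change the terms of lowest degree.\<close>

lemma unipotent_substitution_inj:
  assumes g: "\<And>i. i < n \<Longrightarrow> g i \<in> carrier P"
    and lead: "\<And>i. i < n \<Longrightarrow> g i \<ominus>\<^bsub>P\<^esub> indexed_var i \<in> order_ideal 2"
    and p: "p \<in> carrier P" and zero: "poly_eval R P n indexed_const g p = \<zero>\<^bsub>P\<^esub>"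
  shows "p = \<zero>\<^bsub>P\<^esub>"
proof -
  let ?M = "monomial_eval P n"
  have var1: "indexed_var i \<in> order_ideal 1" if "i < n" for i
    using that by (auto simp: order_ideal_def var_coeff)
  have g1: "g i \<in> order_ideal 1" if i: "i < n" for i
  proof -
    have "g i = (g i \<ominus>\<^bsub>P\<^esub> indexed_var i) \<oplus>\<^bsub>P\<^esub> indexed_var i"
      using g[OF i] var_closed[OF i] by algebra
    moreover have "g i \<ominus>\<^bsub>P\<^esub> indexed_var i \<in> order_ideal 1"
      using lead[OF i] order_ideal_mono[of 1 2] by auto
    ultimately show ?thesis
      using var1[OF i] additive_subgroup.a_closed[OF ideal.axioms(1)[OF ideal_order_ideal[of 1]]] by metis
  qed
  have gM: "?M g m \<in> order_ideal (size m)" if "set_mset m \<subseteq> {..<n}" for m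
    using that
  proof (induction m)
    case empty
    then show ?case by (simp add: order_ideal_0)
  next
    case (add i m)
    then show ?case using order_ideal_mult[OF g1[of i], of "?M g m" "size m"] g
      by (simp add: P.monomial_eval_add_mset)
  qed
  have diff: "?M g m \<ominus>\<^bsub>P\<^esub> ?M indexed_var m \<in> order_ideal (Suc (size m))" if "set_mset m \<subseteq> {..<n}" for m
    using that
  proof (induction m)
    case empty
    then show ?case using ideal_order_ideal additive_subgroup.zero_closed ideal.axioms(1)
      by (fastforce simp: P.minus_eq P.r_neg)
  next
    case (add i m)
    then have i: "i < n" and m: "set_mset m \<subseteq> {..<n}" by auto
    have c: "g i \<in> carrier P" "indexed_var i \<in> carrier P" "?M g m \<in> carrier P" "?M indexed_var m \<in> carrier P"
      using g i by auto
    have "?M g (add_mset i m) \<ominus>\<^bsub>P\<^esub> ?M indexed_var (add_mset i m)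
      = (g i \<ominus>\<^bsub>P\<^esub> indexed_var i) \<otimes>\<^bsub>P\<^esub> ?M g m \<oplus>\<^bsub>P\<^esub> indexed_var i \<otimes>\<^bsub>P\<^esub> (?M g m \<ominus>\<^bsub>P\<^esub> ?M indexed_var m)"
    proof -
      have "?M g (add_mset i m) = g i \<otimes>\<^bsub>P\<^esub> ?M g m"
        "?M indexed_var (add_mset i m) = indexed_var i \<otimes>\<^bsub>P\<^esub> ?M indexed_var m"
        using g i by (simp_all add: P.monomial_eval_add_mset)
      then show ?thesis using c by algebra
    qed
    moreover have "(g i \<ominus>\<^bsub>P\<^esub> indexed_var i) \<otimes>\<^bsub>P\<^esub> ?M g m \<in> order_ideal (Suc (size (add_mset i m)))"
      using order_ideal_mult[OF lead[OF i] gM[OF m]] by simp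
    moreover have "indexed_var i \<otimes>\<^bsub>P\<^esub> (?M g m \<ominus>\<^bsub>P\<^esub> ?M indexed_var m) \<in> order_ideal (Suc (size (add_mset i m)))"
      using order_ideal_mult[OF var1[OF i] add.IH[OF m]] by simp
    ultimately show ?case
      using additive_subgroup.a_closed[OF ideal.axioms(1)[OF ideal_order_ideal]] by metis
  qed
  have "p \<in> order_ideal k" for k
  proof (induction k)
    case 0
    then show ?case using p by (simp add: order_ideal_0)
  next
    case (Suc k)
    let ?F = "{m. p m \<noteq> \<zero>}"
    have F: "finite ?F" by (rule finite_support[OF p])
    have c: "indexed_const (p m) \<in> carrier P" "?M g m \<in> carrier P" "?M indexed_var m \<in> carrier P" for m
      using p g by auto
    have "(\<Oplus>\<^bsub>P\<^esub>m\<in>?F. indexed_const (p m) \<otimes>\<^bsub>P\<^esub> (?M indexed_var m \<ominus>\<^bsub>P\<^esub> ?M g m))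
        = (\<Oplus>\<^bsub>P\<^esub>m\<in>?F. \<one>\<^bsub>P\<^esub> \<otimes>\<^bsub>P\<^esub> (indexed_const (p m) \<otimes>\<^bsub>P\<^esub> ?M indexed_var m)
            \<ominus>\<^bsub>P\<^esub> \<one>\<^bsub>P\<^esub> \<otimes>\<^bsub>P\<^esub> (indexed_const (p m) \<otimes>\<^bsub>P\<^esub> ?M g m))"
      using c by (intro P.finsum_cong') (auto simp: P.minus_eq P.r_distr P.r_minus)
    also have "\<dots> = \<one>\<^bsub>P\<^esub> \<otimes>\<^bsub>P\<^esub> (\<Oplus>\<^bsub>P\<^esub>m\<in>?F. indexed_const (p m) \<otimes>\<^bsub>P\<^esub> ?M indexed_var m)
        \<ominus>\<^bsub>P\<^esub> \<one>\<^bsub>P\<^esub> \<otimes>\<^bsub>P\<^esub> (\<Oplus>\<^bsub>P\<^esub>m\<in>?F. indexed_const (p m) \<otimes>\<^bsub>P\<^esub> ?M g m)"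
      by (rule P.finsum_lin_diff) (use F c in auto)
    also have "\<dots> = p"
      unfolding poly_expansion[OF p, symmetric] zero[unfolded poly_eval_def]
      using p by (simp add: P.minus_eq)
    finally have eq: "(\<Oplus>\<^bsub>P\<^esub>m\<in>?F. indexed_const (p m) \<otimes>\<^bsub>P\<^esub> (?M indexed_var m \<ominus>\<^bsub>P\<^esub> ?M g m)) = p" .
    have "indexed_const (p m) \<otimes>\<^bsub>P\<^esub> (?M indexed_var m \<ominus>\<^bsub>P\<^esub> ?M g m) \<in> order_ideal (Suc k)" if m: "m \<in> ?F" for m
    proof -
      interpret O: ideal "order_ideal (Suc k)" P by (rule ideal_order_ideal)
      have sz: "k \<le> size m" using Suc m unfolding order_ideal_def by (metis (mono_tags, lifting) mem_Collect_eq not_le)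
      have "set_mset m \<subseteq> {..<n}" using support_vars[OF p] m by blast
      then have "?M g m \<ominus>\<^bsub>P\<^esub> ?M indexed_var m \<in> order_ideal (Suc k)"
        using diff[of m] order_ideal_mono[of "Suc k" "Suc (size m)"] sz by blast
      then have "\<ominus>\<^bsub>P\<^esub> (?M g m \<ominus>\<^bsub>P\<^esub> ?M indexed_var m) \<in> order_ideal (Suc k)" by (rule O.a_inv_closed)
      moreover have "\<ominus>\<^bsub>P\<^esub> (?M g m \<ominus>\<^bsub>P\<^esub> ?M indexed_var m) = ?M indexed_var m \<ominus>\<^bsub>P\<^esub> ?M g m"
        using c by algebra
      ultimately show ?thesis using O.I_l_closed[OF _ c(1)] by simp
    qed
    then have "(\<Oplus>\<^bsub>P\<^esub>m\<in>?F. indexed_const (p m) \<otimes>\<^bsub>P\<^esub> (?M indexed_var m \<ominus>\<^bsub>P\<^esub> ?M g m)) \<in> order_ideal (Suc k)"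
      by (rule P.finsum_mem_ideal[OF ideal_order_ideal])
    then show ?case unfolding eq .
  qed
  then have "p m = \<zero>" for m
    unfolding order_ideal_def using lessI[of "size m"] by blast
  then show ?thesis by (auto simp: fun_eq_iff zero_coeff)
qed

end

context mpoly_cring
begin

text \<open>If \<open>s 0, \<dots>, s (n - 1)\<close> generate the polynomial ring in \<open>n\<close> variables over \<open>R\<close>, then \<open>R\<close> embeds into the
  quotient by the ideal they generate. The reason is that the \<open>s k\<close> are coordinates: subtracting the
  constant terms \<open>d\<close> and applying the inverse \<open>\<rho>\<close> of the matrix \<open>\<sigma>\<close> of linear coefficients gives
  generators \<open>g i = x\<^sub>i + \<dots>\<close>, and the substitution \<open>x\<^sub>i \<mapsto> g i\<close> is bijective. Pulling \<open>b = \<Sum> s k h k\<close>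
  back along it replaces each \<open>s k\<close> by an affine polynomial \<open>e k = d k + \<Sum> \<sigma> k i x\<^sub>i\<close>. As \<open>\<sigma>\<close> is
  invertible, the \<open>e k\<close> have a common zero in \<open>R\<close>, and evaluating there gives \<open>b = 0\<close>.\<close>

lemma constant_in_generator_ideal_zero:
  assumes s: "\<And>k. k < n \<Longrightarrow> s k \<in> carrier P"
    and gen: "\<And>S. \<lbrakk>subring S P; indexed_const ` carrier R \<subseteq> S; \<And>k. k < n \<Longrightarrow> s k \<in> S\<rbrakk> \<Longrightarrow> S = carrier P"
    and b: "b \<in> carrier R" and h: "\<And>k. k < n \<Longrightarrow> h k \<in> carrier P"
    and eq: "indexed_const b = (\<Oplus>\<^bsub>P\<^esub>k\<in>{..<n}. s k \<otimes>\<^bsub>P\<^esub> h k)"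
  shows "b = \<zero>"
proof -
  interpret c: ring_hom_cring R P indexed_const
    by unfold_locales (rule const_hom)
  have "\<exists>c. (\<forall>k<n. c k \<in> carrier R) \<and> (\<forall>j<n. (\<Oplus>k\<in>{..<n}. c k \<otimes> s k {#j#}) = indexed_var i {#j#})"
    if "i < n" for i
    by (rule linear_coeffs_spanned[OF s gen var_closed[OF that]])
  then have "\<forall>i\<in>{..<n}. \<exists>c. (\<forall>k<n. c k \<in> carrier R) \<and> (\<forall>j<n. (\<Oplus>k\<in>{..<n}. c k \<otimes> s k {#j#}) = indexed_var i {#j#})"
    by simp
  from bchoice[OF this]
  obtain \<rho> where \<rho>: "\<And>i k. i < n \<Longrightarrow> k < n \<Longrightarrow> \<rho> i k \<in> carrier R"
    and \<rho>s: "\<And>i j. i < n \<Longrightarrow> j < n \<Longrightarrow> (\<Oplus>k\<in>{..<n}. \<rho> i k \<otimes> s k {#j#}) = indexed_var i {#j#}"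
    by auto
  define \<sigma> where "\<sigma> k j = s k {#j#}" for k j
  have \<sigma>: "\<sigma> k j \<in> carrier R" if "k < n" for k j using s[OF that] by (auto simp: \<sigma>_def)
  have \<rho>\<sigma>: "(\<Oplus>k\<in>{..<n}. \<rho> i k \<otimes> \<sigma> k j) = (if i = j then \<one> else \<zero>)" if "i < n" "j < n" for i j
    using \<rho>s[OF that] by (auto simp: \<sigma>_def var_coeff)
  \<comment> \<open>Generation provides a left inverse of \<open>\<sigma>\<close> only; the common zero below needs a right inverse.\<close>
  have \<sigma>\<rho>: "(\<Oplus>i\<in>{..<n}. \<sigma> k i \<otimes> \<rho> i l) = (if k = l then \<one> else \<zero>)" if "k < n" "l < n" for k l
    by (rule matrix_right_inverse[of "{..<n}" \<rho> \<sigma>]) (use that \<rho> \<sigma> \<rho>\<sigma> in auto)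
  define d where "d k = s k {#}" for k
  have d: "d k \<in> carrier R" if "k < n" for k using s[OF that] by (auto simp: d_def)
  define s' where "s' k = s k \<ominus>\<^bsub>P\<^esub> indexed_const (d k)" for k
  have s': "s' k \<in> carrier P" if "k < n" for k using s[OF that] d[OF that] by (auto simp: s'_def)
  have s_s': "s k = indexed_const (d k) \<oplus>\<^bsub>P\<^esub> s' k" if "k < n" for k
  proof -
    have "s k \<in> carrier P" "indexed_const (d k) \<in> carrier P" using s d that by auto
    then show ?thesis unfolding s'_def by algebra
  qed
  have s'_coeff: "s' k {#} = \<zero>" "s' k {#j#} = \<sigma> k j" if "k < n" for k j
    using diff_coeff[OF const_closed[OF d[OF that]], of "s k"] s[OF that]
    by (simp_all add: s'_def const_coeff d_def \<sigma>_def minus_eq r_neg)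
  define g where "g i = (\<Oplus>\<^bsub>P\<^esub>k\<in>{..<n}. indexed_const (\<rho> i k) \<otimes>\<^bsub>P\<^esub> s' k)" for i
  have g: "g i \<in> carrier P" if "i < n" for i
    unfolding g_def using that \<rho> s' by (intro P.finsum_closed) auto
  have g_coeff: "g i m = (\<Oplus>k\<in>{..<n}. \<rho> i k \<otimes> s' k m)" if i: "i < n" for i m
  proof -
    have "g i m = (\<Oplus>k\<in>{..<n}. (indexed_const (\<rho> i k) \<otimes>\<^bsub>P\<^esub> s' k) m)"
      unfolding g_def by (rule finsum_coeff) (use i \<rho> s' in auto)
    also have "\<dots> = (\<Oplus>k\<in>{..<n}. \<rho> i k \<otimes> s' k m)"
      using i \<rho> s' by (intro finsum_cong') (auto simp: const_mult_coeff)
    finally show ?thesis .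
  qed
  have lead: "g i \<ominus>\<^bsub>P\<^esub> indexed_var i \<in> order_ideal 2" if i: "i < n" for i
  proof (rule order_ideal_2I)
    show "g i \<ominus>\<^bsub>P\<^esub> indexed_var i \<in> carrier P" using g i by auto
    have "g i {#} = (\<Oplus>k\<in>{..<n}. \<zero>)"
      unfolding g_coeff[OF i] using i \<rho> by (intro finsum_cong') (auto simp: s'_coeff)
    then show "(g i \<ominus>\<^bsub>P\<^esub> indexed_var i) {#} = \<zero>"
      unfolding diff_coeff[OF var_closed[OF i]] var_coeff by (simp add: minus_eq)
    fix j assume j: "j < n"
    have "g i {#j#} = (\<Oplus>k\<in>{..<n}. \<rho> i k \<otimes> \<sigma> k j)"
      unfolding g_coeff[OF i] using i \<rho> \<sigma> by (intro finsum_cong') (auto simp: s'_coeff)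
    then show "(g i \<ominus>\<^bsub>P\<^esub> indexed_var i) {#j#} = \<zero>"
      unfolding diff_coeff[OF var_closed[OF i]] var_coeff \<rho>\<sigma>[OF i j] by (simp add: minus_eq r_neg)
  qed
  have s'_g: "s' k = (\<Oplus>\<^bsub>P\<^esub>i\<in>{..<n}. indexed_const (\<sigma> k i) \<otimes>\<^bsub>P\<^esub> g i)" if k: "k < n" for k
  proof -
    have "(\<Oplus>\<^bsub>P\<^esub>i\<in>{..<n}. indexed_const (\<sigma> k i) \<otimes>\<^bsub>P\<^esub> g i)
        = (\<Oplus>\<^bsub>P\<^esub>l\<in>{..<n}. (\<Oplus>\<^bsub>P\<^esub>i\<in>{..<n}. indexed_const (\<sigma> k i) \<otimes>\<^bsub>P\<^esub> indexed_const (\<rho> i l)) \<otimes>\<^bsub>P\<^esub> s' l)"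
      unfolding g_def
      by (rule P.matrix_assoc[where I = "{..<n}" and H = UNIV and l = k
            and U = "\<lambda>k i. indexed_const (\<sigma> k i)" and Y = "\<lambda>i l. indexed_const (\<rho> i l)" and Z = "\<lambda>l _. s' l"])
        (use k \<rho> \<sigma> s' in auto)
    also have "\<dots> = (\<Oplus>\<^bsub>P\<^esub>l\<in>{..<n}. (if k = l then \<one>\<^bsub>P\<^esub> else \<zero>\<^bsub>P\<^esub>) \<otimes>\<^bsub>P\<^esub> s' l)"
    proof (rule P.finsum_cong')
      fix l assume l: "l \<in> {..<n}"
      have "(\<Oplus>\<^bsub>P\<^esub>i\<in>{..<n}. indexed_const (\<sigma> k i) \<otimes>\<^bsub>P\<^esub> indexed_const (\<rho> i l))
          = (\<Oplus>\<^bsub>P\<^esub>i\<in>{..<n}. (indexed_const \<circ> (\<lambda>i. \<sigma> k i \<otimes> \<rho> i l)) i)"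
        using k l \<rho> \<sigma> by (intro P.finsum_cong') auto
      also have "\<dots> = indexed_const (\<Oplus>i\<in>{..<n}. \<sigma> k i \<otimes> \<rho> i l)"
        by (rule c.hom_finsum[symmetric]) (use k l \<rho> \<sigma> in auto)
      also have "\<dots> = (if k = l then \<one>\<^bsub>P\<^esub> else \<zero>\<^bsub>P\<^esub>)" using \<sigma>\<rho>[OF k, of l] l by simp
      finally show "(\<Oplus>\<^bsub>P\<^esub>i\<in>{..<n}. indexed_const (\<sigma> k i) \<otimes>\<^bsub>P\<^esub> indexed_const (\<rho> i l)) \<otimes>\<^bsub>P\<^esub> s' l
          = (if k = l then \<one>\<^bsub>P\<^esub> else \<zero>\<^bsub>P\<^esub>) \<otimes>\<^bsub>P\<^esub> s' l" by simp
    qed (use s' in auto)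
    also have "\<dots> = \<one>\<^bsub>P\<^esub> \<otimes>\<^bsub>P\<^esub> s' k"
      by (rule P.finsum_kronecker) (use k s' in auto)
    finally show ?thesis using s' k by simp
  qed
  define E where "E = poly_eval R P n indexed_const g"
  interpret E: mpoly_eval R n P P indexed_const g E
    unfolding E_def by unfold_locales (rule P_def const_hom g reflexive | assumption)+
  have inj: "p = q" if pq: "p \<in> carrier P" "q \<in> carrier P" "E p = E q" for p q
  proof -
    have "E (p \<ominus>\<^bsub>P\<^esub> q) = \<zero>\<^bsub>P\<^esub>" using pq by (simp add: P.minus_eq P.r_neg)
    then have "p \<ominus>\<^bsub>P\<^esub> q = \<zero>\<^bsub>P\<^esub>"
      using unipotent_substitution_inj[OF g lead, of "p \<ominus>\<^bsub>P\<^esub> q"] pq by (simp add: E_def)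
    then show ?thesis using pq by simp
  qed
  define e where "e k = indexed_const (d k) \<oplus>\<^bsub>P\<^esub> (\<Oplus>\<^bsub>P\<^esub>i\<in>{..<n}. indexed_const (\<sigma> k i) \<otimes>\<^bsub>P\<^esub> indexed_var i)" for k
  have e_sum: "(\<Oplus>\<^bsub>P\<^esub>i\<in>{..<n}. indexed_const (\<sigma> k i) \<otimes>\<^bsub>P\<^esub> indexed_var i) \<in> carrier P" if "k < n" for k
    using that \<sigma> by (intro P.finsum_closed) auto
  have e: "e k \<in> carrier P" if "k < n" for k
    using that d e_sum by (auto simp: e_def)
  have E_e: "E (e k) = s k" if k: "k < n" for k
  proof -
    have "E (\<Oplus>\<^bsub>P\<^esub>i\<in>{..<n}. indexed_const (\<sigma> k i) \<otimes>\<^bsub>P\<^esub> indexed_var i)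
        = (\<Oplus>\<^bsub>P\<^esub>i\<in>{..<n}. (E \<circ> (\<lambda>i. indexed_const (\<sigma> k i) \<otimes>\<^bsub>P\<^esub> indexed_var i)) i)"
      by (rule E.E.hom_finsum) (use k \<sigma> in auto)
    also have "\<dots> = (\<Oplus>\<^bsub>P\<^esub>i\<in>{..<n}. indexed_const (\<sigma> k i) \<otimes>\<^bsub>P\<^esub> g i)"
      using k \<sigma> g by (intro P.finsum_cong') auto
    finally show ?thesis
      using k d e_sum s'_g[OF k] s_s'[OF k] by (simp add: e_def)
  qed
  have surj: "E ` carrier P = carrier P"
  proof (rule gen)
    show "subring (E ` carrier P) P"
      by (rule ring_hom_ring.img_is_subring[OF ring_hom_ringI2[OF P.ring_axioms P.ring_axioms E.E_hom]
            P.carrier_is_subring])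
    show "indexed_const ` carrier R \<subseteq> E ` carrier P"
    proof (rule image_subsetI)
      fix a assume "a \<in> carrier R"
      then have "indexed_const a = E (indexed_const a)" "indexed_const a \<in> carrier P" by auto
      then show "indexed_const a \<in> E ` carrier P" by (rule image_eqI)
    qed
    show "s k \<in> E ` carrier P" if "k < n" for k
      using E_e[OF that] e[OF that] by (metis image_eqI)
  qed
  have "\<forall>k\<in>{..<n}. \<exists>p. p \<in> carrier P \<and> E p = h k"
  proof
    fix k assume "k \<in> {..<n}"
    then have "h k \<in> E ` carrier P" using h surj by simp
    then show "\<exists>p. p \<in> carrier P \<and> E p = h k" by auto
  qed
  from bchoice[OF this] obtain p where p: "\<And>k. k < n \<Longrightarrow> p k \<in> carrier P" and Ep: "\<And>k. k < n \<Longrightarrow> E (p k) = h k"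
    by auto
  have sum: "(\<Oplus>\<^bsub>P\<^esub>k\<in>{..<n}. e k \<otimes>\<^bsub>P\<^esub> p k) \<in> carrier P" using e p by (intro P.finsum_closed) auto
  have "E (\<Oplus>\<^bsub>P\<^esub>k\<in>{..<n}. e k \<otimes>\<^bsub>P\<^esub> p k) = (\<Oplus>\<^bsub>P\<^esub>k\<in>{..<n}. (E \<circ> (\<lambda>k. e k \<otimes>\<^bsub>P\<^esub> p k)) k)"
    by (rule E.E.hom_finsum) (use e p in auto)
  also have "\<dots> = (\<Oplus>\<^bsub>P\<^esub>k\<in>{..<n}. s k \<otimes>\<^bsub>P\<^esub> h k)"
    using e p E_e Ep s h by (intro P.finsum_cong') auto
  also have "\<dots> = E (indexed_const b)" unfolding eq[symmetric] using b by simp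
  finally have pulled: "(\<Oplus>\<^bsub>P\<^esub>k\<in>{..<n}. e k \<otimes>\<^bsub>P\<^esub> p k) = indexed_const b"
    using inj[OF sum] b by auto
  \<comment> \<open>The common zero of the \<open>e k\<close> is \<open>x = - \<rho> d\<close>.\<close>
  define x where "x i = \<ominus> (\<Oplus>l\<in>{..<n}. \<rho> i l \<otimes> d l)" for i
  have x: "x i \<in> carrier R" if "i < n" for i
    unfolding x_def using that \<rho> d by (intro a_inv_closed finsum_closed) auto
  have id_hom: "id \<in> ring_hom R R" by (rule ring_hom_memI) auto
  define G where "G = poly_eval R R n id x"
  interpret G: mpoly_eval R n P R id x G
    unfolding G_def by unfold_locales (rule P_def id_hom x reflexive | assumption)+
  have minus_out: "a \<otimes> \<ominus> y = \<ominus> \<one> \<otimes> (a \<otimes> y)" if "a \<in> carrier R" "y \<in> carrier R" for a y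
    using that by (simp add: l_minus r_minus)
  have G_e: "G (e k) = \<zero>" if k: "k < n" for k
  proof -
    have "G (\<Oplus>\<^bsub>P\<^esub>i\<in>{..<n}. indexed_const (\<sigma> k i) \<otimes>\<^bsub>P\<^esub> indexed_var i)
        = (\<Oplus>i\<in>{..<n}. (G \<circ> (\<lambda>i. indexed_const (\<sigma> k i) \<otimes>\<^bsub>P\<^esub> indexed_var i)) i)"
      by (rule G.E.hom_finsum) (use k \<sigma> in auto)
    also have "\<dots> = (\<Oplus>i\<in>{..<n}. \<ominus> \<one> \<otimes> (\<sigma> k i \<otimes> (\<Oplus>l\<in>{..<n}. \<rho> i l \<otimes> d l)))"
    proof (rule finsum_cong')
      fix i assume i: "i \<in> {..<n}"
      have y: "(\<Oplus>l\<in>{..<n}. \<rho> i l \<otimes> d l) \<in> carrier R" using i \<rho> d by (intro finsum_closed) auto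
      have "(G \<circ> (\<lambda>i. indexed_const (\<sigma> k i) \<otimes>\<^bsub>P\<^esub> indexed_var i)) i = \<sigma> k i \<otimes> x i"
        using i k \<sigma> by simp
      also have "\<dots> = \<ominus> \<one> \<otimes> (\<sigma> k i \<otimes> (\<Oplus>l\<in>{..<n}. \<rho> i l \<otimes> d l))"
        unfolding x_def by (rule minus_out[OF \<sigma>[OF k] y])
      finally show "(G \<circ> (\<lambda>i. indexed_const (\<sigma> k i) \<otimes>\<^bsub>P\<^esub> indexed_var i)) i
          = \<ominus> \<one> \<otimes> (\<sigma> k i \<otimes> (\<Oplus>l\<in>{..<n}. \<rho> i l \<otimes> d l))" .
    qed (use k \<sigma> \<rho> d in \<open>auto intro!: m_closed finsum_closed\<close>)
    also have "\<dots> = \<ominus> \<one> \<otimes> (\<Oplus>i\<in>{..<n}. \<sigma> k i \<otimes> (\<Oplus>l\<in>{..<n}. \<rho> i l \<otimes> d l))"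
      by (rule finsum_rdistr[symmetric]) (use k \<sigma> \<rho> d in \<open>auto intro!: m_closed finsum_closed\<close>)
    also have "(\<Oplus>i\<in>{..<n}. \<sigma> k i \<otimes> (\<Oplus>l\<in>{..<n}. \<rho> i l \<otimes> d l))
        = (\<Oplus>l\<in>{..<n}. (\<Oplus>i\<in>{..<n}. \<sigma> k i \<otimes> \<rho> i l) \<otimes> d l)"
      by (rule matrix_assoc[where I = "{..<n}" and H = UNIV and l = k and Z = "\<lambda>l _. d l"])
        (use k \<rho> \<sigma> d in auto)
    also have "\<dots> = (\<Oplus>l\<in>{..<n}. (if k = l then \<one> else \<zero>) \<otimes> d l)"
    proof (rule finsum_cong')
      fix l assume "l \<in> {..<n}"
      then show "(\<Oplus>i\<in>{..<n}. \<sigma> k i \<otimes> \<rho> i l) \<otimes> d l = (if k = l then \<one> else \<zero>) \<otimes> d l"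
        using \<sigma>\<rho>[OF k, of l] by simp
    qed (use d in auto)
    also have "\<dots> = \<one> \<otimes> d k"
      by (rule finsum_kronecker) (use k d in auto)
    finally show ?thesis
      using k d e_sum by (simp add: e_def l_minus r_neg)
  qed
  have "b = G (\<Oplus>\<^bsub>P\<^esub>k\<in>{..<n}. e k \<otimes>\<^bsub>P\<^esub> p k)" unfolding pulled using b by simp
  also have "\<dots> = (\<Oplus>k\<in>{..<n}. (G \<circ> (\<lambda>k. e k \<otimes>\<^bsub>P\<^esub> p k)) k)"
    by (rule G.E.hom_finsum) (use e p in auto)
  also have "\<dots> = (\<Oplus>k\<in>{..<n}. \<zero>)"
    using e p G_e by (intro finsum_cong') auto
  finally show ?thesis by simp
qed

end

section \<open>Regularity of Poisson central elements\<close>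

context cring
begin

text \<open>A prime ideal containing \<open>a\<^sup>k (1 - a c)\<close> contains \<open>a (1 - a c)\<close>.\<close>

lemma regular_mod_nilradical:
  assumes a: "a \<in> carrier R" and c: "c \<in> carrier R"
    and pow: "a [^] (k::nat) \<ominus> a [^] Suc k \<otimes> c \<in> nilradical R"
  shows "a \<ominus> a \<otimes> a \<otimes> c \<in> nilradical R"
proof -
  have "a \<ominus> a \<otimes> a \<otimes> c \<in> Q" if "primeideal Q R" for Q
  proof -
    interpret Q: primeideal Q R by fact
    have ak: "a [^] k \<in> carrier R" using a by simp
    have eq: "a \<ominus> a \<otimes> a \<otimes> c = a \<otimes> (\<one> \<ominus> a \<otimes> c)"
      using a c by (simp add: minus_eq r_distr r_minus m_assoc)
    have "a [^] k \<ominus> a [^] Suc k \<otimes> c = a [^] k \<otimes> (\<one> \<ominus> a \<otimes> c)"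
      using a c ak by (simp add: minus_eq r_distr r_minus m_assoc)
    moreover have "a [^] k \<ominus> a [^] Suc k \<otimes> c \<in> Q" using pow that by (auto simp: nilradical_def)
    ultimately have "a [^] k \<in> Q \<or> \<one> \<ominus> a \<otimes> c \<in> Q"
      using Q.I_prime[OF ak, of "\<one> \<ominus> a \<otimes> c"] a c by simp
    then have "a \<in> Q \<or> \<one> \<ominus> a \<otimes> c \<in> Q" using Q.prime_power_mem[OF a] by blast
    then show ?thesis
      unfolding eq using Q.I_l_closed Q.I_r_closed a c by auto
  qed
  then show ?thesis using a c by (auto simp: nilradical_def)
qed

lemma artinian_power_stable:
  assumes "artinian_ring R" and a: "a \<in> carrier R"
  shows "\<exists>k::nat. \<exists>c\<in>carrier R. a [^] k = a [^] Suc k \<otimes> c"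
proof -
  interpret art: artinian_ring R by fact
  have "\<exists>k::nat. \<forall>i\<ge>k. PIdl (a [^] i) = PIdl (a [^] k)"
  proof (rule art.descending_chain[where I = "\<lambda>i. PIdl (a [^] i)"])
    fix i :: nat
    show "ideal (PIdl (a [^] i)) R" using a by (simp add: cgenideal_ideal)
    have "a [^] Suc i \<in> PIdl (a [^] i)"
      using a by (auto simp: cgenideal_def m_comm)
    then show "PIdl (a [^] Suc i) \<subseteq> PIdl (a [^] i)"
      using a by (intro cgenideal_minimal cgenideal_ideal) auto
  qed
  then obtain k :: nat where "PIdl (a [^] Suc k) = PIdl (a [^] k)"
    using le_Suc_eq by blast
  then have "a [^] k \<in> PIdl (a [^] Suc k)" using cgenideal_self[of "a [^] k"] a by simp
  then obtain c where "c \<in> carrier R" "a [^] k = c \<otimes> a [^] Suc k" by (auto simp: cgenideal_def)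
  then show ?thesis using a m_comm by (metis nat_pow_closed)
qed

end

text \<open>The common consequence of the three artinian conditions from which cancellation is derived: Poisson
  central elements are von Neumann regular up to nilpotents.\<close>

definition center_regular_mod_nil :: "('k, 'a, 'n) poisson_alg_scheme \<Rightarrow> bool"
  where "center_regular_mod_nil A \<longleftrightarrow>
    (\<forall>a\<in>poisson_center A. \<exists>c\<in>carrier A. a \<ominus>\<^bsub>A\<^esub> a \<otimes>\<^bsub>A\<^esub> a \<otimes>\<^bsub>A\<^esub> c \<in> nilradical A)"

context poisson_algebra
begin

interpretation A: cring A by (rule M_cring)

lemma center_regular_if_artinian:
  assumes "artinian_ring A"
  shows "center_regular_mod_nil A"
  unfolding center_regular_mod_nil_def
proof
  fix a assume "a \<in> poisson_center A"
  then have a: "a \<in> carrier A" by (simp add: poisson_center_def)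
  obtain k :: nat and c where c: "c \<in> carrier A" "a [^]\<^bsub>A\<^esub> k = a [^]\<^bsub>A\<^esub> Suc k \<otimes>\<^bsub>A\<^esub> c"
    using A.artinian_power_stable[OF assms a] by blast
  have "a [^]\<^bsub>A\<^esub> Suc k \<otimes>\<^bsub>A\<^esub> c \<ominus>\<^bsub>A\<^esub> a [^]\<^bsub>A\<^esub> Suc k \<otimes>\<^bsub>A\<^esub> c \<in> nilradical A"
    using a c(1) additive_subgroup.zero_closed[OF ideal.axioms(1)[OF ideal_nilradical[OF M_cring]]]
    by (simp add: a_minus_def A.M.r_neg)
  then show "\<exists>c\<in>carrier A. a \<ominus>\<^bsub>A\<^esub> a \<otimes>\<^bsub>A\<^esub> a \<otimes>\<^bsub>A\<^esub> c \<in> nilradical A"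
    using A.regular_mod_nilradical[OF a c(1), of k] c(1) unfolding c(2)[symmetric] by blast
qed

lemma center_regular_if_center_artinian:
  assumes "artinian_ring (poisson_center_ring A)"
  shows "center_regular_mod_nil A"
  unfolding center_regular_mod_nil_def
proof
  fix a assume a: "a \<in> poisson_center A"
  have sub: "poisson_center A \<subseteq> carrier A" by (auto simp: poisson_center_def)
  let ?Z = "poisson_center_ring A"
  have Z_simps: "carrier ?Z = poisson_center A" "monoid.mult ?Z = monoid.mult A" "one ?Z = one A"
    by (simp_all add: poisson_center_ring_def)
  interpret Z: artinian_ring ?Z by fact
  interpret Z: cring ?Z
    by (intro cring.intro Z.ring_axioms comm_monoid.intro Z.is_monoid comm_monoid_axioms.intro)
      (use sub A.m_comm in \<open>auto simp: Z_simps\<close>)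
  have pow: "a [^]\<^bsub>?Z\<^esub> k = a [^]\<^bsub>A\<^esub> k" for k :: nat
    by (simp add: nat_pow_def Z_simps)
  obtain k :: nat and c where "c \<in> poisson_center A" "a [^]\<^bsub>A\<^esub> k = a [^]\<^bsub>A\<^esub> Suc k \<otimes>\<^bsub>A\<^esub> c"
    using Z.artinian_power_stable[OF assms, of a] a by (auto simp: Z_simps pow)
  then have c: "c \<in> carrier A" "a [^]\<^bsub>A\<^esub> k = a [^]\<^bsub>A\<^esub> Suc k \<otimes>\<^bsub>A\<^esub> c" using sub by auto
  have aA: "a \<in> carrier A" using a sub by auto
  have "a [^]\<^bsub>A\<^esub> Suc k \<otimes>\<^bsub>A\<^esub> c \<ominus>\<^bsub>A\<^esub> a [^]\<^bsub>A\<^esub> Suc k \<otimes>\<^bsub>A\<^esub> c \<in> nilradical A"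
    using aA c(1) additive_subgroup.zero_closed[OF ideal.axioms(1)[OF ideal_nilradical[OF M_cring]]]
    by (simp add: a_minus_def A.M.r_neg)
  then show "\<exists>c\<in>carrier A. a \<ominus>\<^bsub>A\<^esub> a \<otimes>\<^bsub>A\<^esub> a \<otimes>\<^bsub>A\<^esub> c \<in> nilradical A"
    using A.regular_mod_nilradical[OF aA c(1), of k] c(1) unfolding c(2)[symmetric] by blast
qed

text \<open>An artinian ring has a unit, so the center of \<open>A\<^sub>r\<^sub>e\<^sub>d\<close> is nonempty and the nilradical is stable under
  the bracket. Then cosets of central elements are central, and the chain condition for powers of a
  coset lifts to a relation in \<open>A\<close> up to nilpotents.\<close>

lemma center_regular_if_reduced_center_artinian:
  assumes art: "artinian_ring (poisson_center_ring (reduced_poisson A))"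
  shows "center_regular_mod_nil A"
  unfolding center_regular_mod_nil_def
proof
  fix a assume a: "a \<in> poisson_center A"
  let ?N = "nilradical A" and ?Q = "reduced_poisson A"
  let ?Z = "poisson_center_ring ?Q"
  interpret N: ideal ?N A by (rule ideal_nilradical) (rule M_cring)
  have aA: "a \<in> carrier A" using a by (auto simp: poisson_center_def)
  have Z_simps: "carrier ?Z = poisson_center ?Q" "monoid.mult ?Z = rcoset_mult A ?N" "\<one>\<^bsub>?Z\<^esub> = ?N +>\<^bsub>A\<^esub> \<one>\<^bsub>A\<^esub>"
    by (simp_all add: poisson_center_ring_def reduced_poisson_def Let_def FactRing_def)
  interpret Z: artinian_ring ?Z by fact
  have Q_carrier: "carrier ?Q = (\<lambda>x. ?N +>\<^bsub>A\<^esub> x) ` carrier A"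
    by (auto simp: reduced_poisson_def Let_def FactRing_simps)
  have Z_sub: "\<exists>x\<in>carrier A. U = ?N +>\<^bsub>A\<^esub> x" if "U \<in> carrier ?Z" for U
    using that Q_carrier by (auto simp: Z_simps poisson_center_def)
  have mult: "(?N +>\<^bsub>A\<^esub> x) \<otimes>\<^bsub>?Z\<^esub> (?N +>\<^bsub>A\<^esub> y) = ?N +>\<^bsub>A\<^esub> (x \<otimes>\<^bsub>A\<^esub> y)"
    if "x \<in> carrier A" "y \<in> carrier A" for x y
    unfolding Z_simps by (rule N.rcoset_mult_add[OF that])
  interpret Z: cring ?Z
  proof (intro cring.intro Z.ring_axioms comm_monoid.intro Z.is_monoid comm_monoid_axioms.intro)
    fix U V assume "U \<in> carrier ?Z" "V \<in> carrier ?Z"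
    then show "U \<otimes>\<^bsub>?Z\<^esub> V = V \<otimes>\<^bsub>?Z\<^esub> U"
      using Z_sub[of U] Z_sub[of V] mult A.m_comm by metis
  qed
  have "poisson_center ?Q \<noteq> {}" using Z.one_closed by (auto simp: Z_simps)
  then have stable: "\<lbrace>x, y\<rbrace>\<^bsub>A\<^esub> \<in> ?N" if "x \<in> ?N" "y \<in> carrier A" for x y
    using reduced_poisson_center_empty[OF that] by blast
  have central: "?N +>\<^bsub>A\<^esub> a \<in> carrier ?Z"
  proof -
    have "\<lbrace>?N +>\<^bsub>A\<^esub> a, ?N +>\<^bsub>A\<^esub> y\<rbrace>\<^bsub>?Q\<^esub> = \<zero>\<^bsub>?Q\<^esub>" if y: "y \<in> carrier A" for y
    proof -
      have "\<lbrace>?N +>\<^bsub>A\<^esub> a, ?N +>\<^bsub>A\<^esub> y\<rbrace>\<^bsub>?Q\<^esub> = ?N +>\<^bsub>A\<^esub> \<lbrace>a, y\<rbrace>\<^bsub>A\<^esub>"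
        by (rule reduced_poisson_bracket[OF stable aA y])
      also have "\<lbrace>a, y\<rbrace>\<^bsub>A\<^esub> = \<zero>\<^bsub>A\<^esub>" using a y by (auto simp: poisson_center_def)
      also have "?N +>\<^bsub>A\<^esub> \<zero>\<^bsub>A\<^esub> = ?N" by (rule A.a_rcos_zero[OF N.is_ideal N.zero_closed])
      finally show ?thesis by (simp add: reduced_poisson_def Let_def FactRing_def)
    qed
    then show ?thesis using aA Q_carrier by (auto simp: Z_simps poisson_center_def)
  qed
  have pow: "(?N +>\<^bsub>A\<^esub> a) [^]\<^bsub>?Z\<^esub> k = ?N +>\<^bsub>A\<^esub> (a [^]\<^bsub>A\<^esub> k)" for k :: nat
  proof (induction k)
    case 0
    then show ?case by (simp add: Z_simps(3))
  next
    case (Suc k)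
    then show ?case using mult[of "a [^]\<^bsub>A\<^esub> k" a] aA by simp
  qed
  obtain k :: nat and U where U: "U \<in> carrier ?Z"
    "(?N +>\<^bsub>A\<^esub> a) [^]\<^bsub>?Z\<^esub> k = (?N +>\<^bsub>A\<^esub> a) [^]\<^bsub>?Z\<^esub> Suc k \<otimes>\<^bsub>?Z\<^esub> U"
    using Z.artinian_power_stable[OF art central] by blast
  obtain c where c: "c \<in> carrier A" "U = ?N +>\<^bsub>A\<^esub> c" using Z_sub[OF U(1)] by blast
  have "?N +>\<^bsub>A\<^esub> (a [^]\<^bsub>A\<^esub> k) = ?N +>\<^bsub>A\<^esub> (a [^]\<^bsub>A\<^esub> Suc k \<otimes>\<^bsub>A\<^esub> c)"
    using U(2) mult[of "a [^]\<^bsub>A\<^esub> Suc k" c] aA c unfolding pow by simp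
  then have "a [^]\<^bsub>A\<^esub> k \<ominus>\<^bsub>A\<^esub> a [^]\<^bsub>A\<^esub> Suc k \<otimes>\<^bsub>A\<^esub> c \<in> ?N"
    using A.quotient_eq_iff_same_a_r_cos[OF N.is_ideal, of "a [^]\<^bsub>A\<^esub> k" "a [^]\<^bsub>A\<^esub> Suc k \<otimes>\<^bsub>A\<^esub> c"] aA c by simp
  then show "\<exists>c\<in>carrier A. a \<ominus>\<^bsub>A\<^esub> a \<otimes>\<^bsub>A\<^esub> a \<otimes>\<^bsub>A\<^esub> c \<in> ?N"
    using A.regular_mod_nilradical[OF aA c(1)] c(1) by blast
qed

end

section \<open>Cancellation\<close>

lemma poisson_iso_inverse:
  assumes h: "h \<in> poisson_iso K A B" and "ring A"
    and smult: "\<And>k a. k \<in> carrier K \<Longrightarrow> a \<in> carrier A \<Longrightarrow> k \<odot>\<^bsub>A\<^esub> a \<in> carrier A"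
    and bracket: "\<And>a b. a \<in> carrier A \<Longrightarrow> b \<in> carrier A \<Longrightarrow> \<lbrace>a, b\<rbrace>\<^bsub>A\<^esub> \<in> carrier A"
  shows "inv_into (carrier A) h \<in> poisson_iso K B A"
proof -
  interpret A: ring A by fact
  let ?g = "inv_into (carrier A) h"
  have iso: "h \<in> ring_iso A B" using h by (simp add: poisson_iso_def)
  then have bij: "bij_betw h (carrier A) (carrier B)" by (simp add: ring_iso_def)
  have g: "?g y \<in> carrier A" "h (?g y) = y" if "y \<in> carrier B" for y
    using bij that by (auto simp: bij_betw_def inv_into_into f_inv_into_f)
  have gh: "?g (h x) = x" if "x \<in> carrier A" for x
    using bij that by (auto simp: bij_betw_def)
  have "?g (k \<odot>\<^bsub>B\<^esub> y) = k \<odot>\<^bsub>A\<^esub> ?g y" if "k \<in> carrier K" "y \<in> carrier B" for k y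
  proof -
    have "h (k \<odot>\<^bsub>A\<^esub> ?g y) = k \<odot>\<^bsub>B\<^esub> y" using h that g[OF that(2)] by (simp add: poisson_iso_def)
    then show ?thesis using gh[OF smult[OF that(1) g(1)[OF that(2)]]] by simp
  qed
  moreover have "?g \<lbrace>x, y\<rbrace>\<^bsub>B\<^esub> = \<lbrace>?g x, ?g y\<rbrace>\<^bsub>A\<^esub>" if "x \<in> carrier B" "y \<in> carrier B" for x y
  proof -
    have "h \<lbrace>?g x, ?g y\<rbrace>\<^bsub>A\<^esub> = \<lbrace>x, y\<rbrace>\<^bsub>B\<^esub>"
      using h g[OF that(1)] g[OF that(2)] by (simp add: poisson_iso_def)
    then show ?thesis using gh[OF bracket[OF g(1)[OF that(1)] g(1)[OF that(2)]]] by simp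
  qed
  ultimately show ?thesis
    using ring_iso_set_sym[OF assms(2) iso] by (simp add: poisson_iso_def)
qed

lemma poisson_poly_simps:
  "carrier (poisson_poly A n) = carrier (mpoly A n)"
  "monoid.mult (poisson_poly A n) = monoid.mult (mpoly A n)"
  "ring.add (poisson_poly A n) = ring.add (mpoly A n)"
  "monoid.one (poisson_poly A n) = monoid.one (mpoly A n)"
  "ring.zero (poisson_poly A n) = ring.zero (mpoly A n)"
  "smult (poisson_poly A n) = (\<lambda>k P m. k \<odot>\<^bsub>A\<^esub> P m)"
  "pbracket (poisson_poly A n) = mpoly_conv A (pbracket A)"
  by (simp_all add: poisson_poly_def mpoly_def)

context poisson_algebra
begin

interpretation A: cring A by (rule M_cring)

lemma biadditive_pbracket: "A.biadditive (pbracket A)"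
  by (simp add: A.biadditive_def pbracket_closed pbracket_add_left pbracket_add_right)

lemma ring_poisson_poly: "ring (poisson_poly A n)"
proof -
  interpret P: cring "mpoly A n" by (rule A.cring_mpoly)
  have "\<exists>y\<in>carrier (mpoly A n). y \<oplus>\<^bsub>mpoly A n\<^esub> x = \<zero>\<^bsub>mpoly A n\<^esub>" if "x \<in> carrier (mpoly A n)" for x
    using that P.l_neg by blast
  then have "abelian_group (poisson_poly A n)"
    by (intro abelian_groupI) (simp_all add: poisson_poly_simps P.add.m_assoc P.add.m_comm P.add.m_lcomm)
  moreover have "monoid (poisson_poly A n)"
    by (intro monoidI) (simp_all add: poisson_poly_simps P.m_assoc)
  ultimately show ?thesis
    by (intro ringI) (simp_all add: poisson_poly_simps P.l_distr P.r_distr)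
qed

lemma poisson_poly_smult_closed:
  assumes k: "k \<in> carrier K" and p: "p \<in> carrier (poisson_poly A n)"
  shows "k \<odot>\<^bsub>poisson_poly A n\<^esub> p \<in> carrier (poisson_poly A n)"
proof -
  interpret P: mpoly_cring A n "mpoly A n" by unfold_locales
  have p': "p \<in> carrier (mpoly A n)" using p by (simp add: poisson_poly_simps)
  have k1: "k \<odot>\<^bsub>A\<^esub> \<one>\<^bsub>A\<^esub> \<in> carrier A" using k by simp
  have "k \<odot>\<^bsub>poisson_poly A n\<^esub> p = A.indexed_const (k \<odot>\<^bsub>A\<^esub> \<one>\<^bsub>A\<^esub>) \<otimes>\<^bsub>mpoly A n\<^esub> p"
  proof
    fix m
    have "p m \<in> carrier A" using p' by (rule P.P_coeff)
    then show "(k \<odot>\<^bsub>poisson_poly A n\<^esub> p) m = (A.indexed_const (k \<odot>\<^bsub>A\<^esub> \<one>\<^bsub>A\<^esub>) \<otimes>\<^bsub>mpoly A n\<^esub> p) m"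
      unfolding P.const_mult_coeff[OF k1 p'] using k by (simp add: poisson_poly_simps smult_assoc2)
  qed
  also have "\<dots> \<in> carrier (mpoly A n)" using P.const_closed[OF k1] p' by (rule P.P.m_closed)
  finally show ?thesis by (simp add: poisson_poly_simps)
qed

lemma poisson_poly_bracket_closed:
  assumes "p \<in> carrier (poisson_poly A n)" "q \<in> carrier (poisson_poly A n)"
  shows "\<lbrace>p, q\<rbrace>\<^bsub>poisson_poly A n\<^esub> \<in> carrier (poisson_poly A n)"
  using assms A.mpoly_conv_pset[OF biadditive_pbracket] by (simp add: poisson_poly_def)

end

lemma (in mpoly_cring) constant_plus_variables:
  assumes "p \<in> carrier P"
  shows "\<exists>r. (\<forall>k<n. r k \<in> carrier P) \<and>
    p = indexed_const (p {#}) \<oplus>\<^bsub>P\<^esub> (\<Oplus>\<^bsub>P\<^esub>k\<in>{..<n}. indexed_var k \<otimes>\<^bsub>P\<^esub> r k)"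
  using assms
proof (induction p rule: P_induct)
  case (const a)
  have "(\<Oplus>\<^bsub>P\<^esub>k\<in>{..<n}. indexed_var k \<otimes>\<^bsub>P\<^esub> \<zero>\<^bsub>P\<^esub>) = (\<Oplus>\<^bsub>P\<^esub>k\<in>{..<n}. \<zero>\<^bsub>P\<^esub>)"
    by (intro P.finsum_cong') auto
  moreover have "(indexed_const a :: nat multiset \<Rightarrow> 'a) {#} = a" by (simp add: indexed_const_def)
  ultimately show ?case using const by (intro exI[of _ "\<lambda>_. \<zero>\<^bsub>P\<^esub>"]) simp
next
  case (add p q)
  then obtain r t where r: "\<And>k. k < n \<Longrightarrow> r k \<in> carrier P" and t: "\<And>k. k < n \<Longrightarrow> t k \<in> carrier P"
    and p: "p = indexed_const (p {#}) \<oplus>\<^bsub>P\<^esub> (\<Oplus>\<^bsub>P\<^esub>k\<in>{..<n}. indexed_var k \<otimes>\<^bsub>P\<^esub> r k)"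
    and q: "q = indexed_const (q {#}) \<oplus>\<^bsub>P\<^esub> (\<Oplus>\<^bsub>P\<^esub>k\<in>{..<n}. indexed_var k \<otimes>\<^bsub>P\<^esub> t k)" by auto
  have c: "p {#} \<in> carrier R" "q {#} \<in> carrier R" using add by auto
  have R: "(\<Oplus>\<^bsub>P\<^esub>k\<in>{..<n}. indexed_var k \<otimes>\<^bsub>P\<^esub> r k) \<in> carrier P"
    and T: "(\<Oplus>\<^bsub>P\<^esub>k\<in>{..<n}. indexed_var k \<otimes>\<^bsub>P\<^esub> t k) \<in> carrier P"
    using r t by (auto intro!: P.finsum_closed)
  have "(\<Oplus>\<^bsub>P\<^esub>k\<in>{..<n}. indexed_var k \<otimes>\<^bsub>P\<^esub> (r k \<oplus>\<^bsub>P\<^esub> t k))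
      = (\<Oplus>\<^bsub>P\<^esub>k\<in>{..<n}. indexed_var k \<otimes>\<^bsub>P\<^esub> r k \<oplus>\<^bsub>P\<^esub> indexed_var k \<otimes>\<^bsub>P\<^esub> t k)"
    using r t by (intro P.finsum_cong') (auto simp: P.r_distr)
  also have "\<dots> = (\<Oplus>\<^bsub>P\<^esub>k\<in>{..<n}. indexed_var k \<otimes>\<^bsub>P\<^esub> r k) \<oplus>\<^bsub>P\<^esub> (\<Oplus>\<^bsub>P\<^esub>k\<in>{..<n}. indexed_var k \<otimes>\<^bsub>P\<^esub> t k)"
    using r t by (intro P.finsum_addf) auto
  finally have sum: "(\<Oplus>\<^bsub>P\<^esub>k\<in>{..<n}. indexed_var k \<otimes>\<^bsub>P\<^esub> (r k \<oplus>\<^bsub>P\<^esub> t k)) = \<dots>" .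
  have const: "indexed_const (p {#} \<oplus> q {#}) = (indexed_const (p {#}) \<oplus>\<^bsub>P\<^esub> indexed_const (q {#}) :: nat multiset \<Rightarrow> 'a)"
    by (rule ring_hom_add[OF const_hom c])
  have "p \<oplus>\<^bsub>P\<^esub> q = (indexed_const (p {#}) \<oplus>\<^bsub>P\<^esub> (\<Oplus>\<^bsub>P\<^esub>k\<in>{..<n}. indexed_var k \<otimes>\<^bsub>P\<^esub> r k))
     \<oplus>\<^bsub>P\<^esub> (indexed_const (q {#}) \<oplus>\<^bsub>P\<^esub> (\<Oplus>\<^bsub>P\<^esub>k\<in>{..<n}. indexed_var k \<otimes>\<^bsub>P\<^esub> t k))"
    using p q by simp
  also have "\<dots> = indexed_const ((p \<oplus>\<^bsub>P\<^esub> q) {#}) \<oplus>\<^bsub>P\<^esub> (\<Oplus>\<^bsub>P\<^esub>k\<in>{..<n}. indexed_var k \<otimes>\<^bsub>P\<^esub> (r k \<oplus>\<^bsub>P\<^esub> t k))"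
  proof -
    have "(a \<oplus>\<^bsub>P\<^esub> x) \<oplus>\<^bsub>P\<^esub> (b \<oplus>\<^bsub>P\<^esub> y) = (a \<oplus>\<^bsub>P\<^esub> b) \<oplus>\<^bsub>P\<^esub> (x \<oplus>\<^bsub>P\<^esub> y)"
      if "a \<in> carrier P" "b \<in> carrier P" "x \<in> carrier P" "y \<in> carrier P" for a b x y
      using that by (simp add: P.a_ac)
    from this[OF const_closed[OF c(1)] const_closed[OF c(2)] R T] show ?thesis
      unfolding sum add_coeff const .
  qed
  finally show ?case using r t by (intro exI[of _ "\<lambda>k. r k \<oplus>\<^bsub>P\<^esub> t k"]) auto
next
  case (var_mult p i)
  have "(indexed_var i \<otimes>\<^bsub>P\<^esub> p) {#} = \<zero>" using var_mult by (simp add: var_times indexed_pmult_def)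
  moreover have "(\<Oplus>\<^bsub>P\<^esub>k\<in>{..<n}. indexed_var k \<otimes>\<^bsub>P\<^esub> (if i = k then p else \<zero>\<^bsub>P\<^esub>)) = indexed_var i \<otimes>\<^bsub>P\<^esub> p"
  proof -
    have "(\<Oplus>\<^bsub>P\<^esub>k\<in>{..<n}. indexed_var k \<otimes>\<^bsub>P\<^esub> (if i = k then p else \<zero>\<^bsub>P\<^esub>))
      = (\<Oplus>\<^bsub>P\<^esub>k\<in>{..<n}. if i = k then indexed_var k \<otimes>\<^bsub>P\<^esub> p else \<zero>\<^bsub>P\<^esub>)"
      using var_mult by (intro P.finsum_cong') auto
    also have "\<dots> = indexed_var i \<otimes>\<^bsub>P\<^esub> p" using var_mult by (intro P.finsum_singleton) auto
    finally show ?thesis .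
  qed
  moreover have "indexed_const \<zero> = \<zero>\<^bsub>P\<^esub>" by (auto simp: fun_eq_iff const_coeff zero_coeff)
  ultimately show ?case using var_mult by (intro exI[of _ "\<lambda>k. if i = k then p else \<zero>\<^bsub>P\<^esub>"]) auto
qed

lemma (in cring) monomial_eval_mem_subring:
  assumes S: "subring S R" and v: "\<And>i. i < n \<Longrightarrow> v i \<in> S" and m: "set_mset m \<subseteq> {..<n}"
  shows "monomial_eval R n v m \<in> S"
  using m
proof (induction m)
  case empty
  then show ?case using subringE(3)[OF S] by simp
next
  case (add i m)
  have vR: "v j \<in> carrier R" if "j < n" for j using v[OF that] subringE(1)[OF S] by blast
  have "monomial_eval R n v (add_mset i m) = v i \<otimes> monomial_eval R n v m"
    by (rule monomial_eval_add_mset[OF vR]) (use add in auto)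
  then show ?case using subringE(6)[OF S, of "v i"] v add by simp
qed

lemma (in ring_hom_cring) hom_monomial_eval:
  assumes "\<And>i. i < n \<Longrightarrow> v i \<in> carrier R"
  shows "h (monomial_eval R n v m) = monomial_eval S n (\<lambda>i. h (v i)) m"
proof -
  have "h (monomial_eval R n v m) = finprod S (h \<circ> (\<lambda>i. v i [^]\<^bsub>R\<^esub> count m i)) {..<n}"
    unfolding monomial_eval_def by (rule hom_finprod) (use assms in auto)
  also have "\<dots> = monomial_eval S n (\<lambda>i. h (v i)) m"
    unfolding monomial_eval_def using assms by (intro S.finprod_cong') (auto simp: hom_pow)
  finally show ?thesis .
qed

text \<open>The inverse \<open>g\<close> of \<open>h\<close> followed by \<open>t \<mapsto> 0\<close> restricts to a Poisson homomorphism \<open>\<rho>\<close> from \<open>B\<close> to \<open>A\<close>.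
  It is bijective as soon as the polynomials \<open>s i = h t\<^sub>i\<close> generate \<open>B[t]\<close> over \<open>B\<close>: the
  polynomials that \<open>g\<close> followed by \<open>t \<mapsto> 0\<close> maps into the range of \<open>\<rho>\<close> form a subring containing \<open>B\<close>
  and the \<open>s i\<close>, and an element of the kernel of \<open>\<rho>\<close> is a constant in the
  ideal generated by the \<open>s i\<close>, hence \<open>0\<close>. That the \<open>s i\<close> generate is where centrality enters: the
  coefficients of \<open>g t\<^sub>i\<close> are Poisson central, so \<open>h\<close> maps them to constants up to nilpotent
  coefficients, and \<open>t\<^sub>i = h (g t\<^sub>i)\<close> is a polynomial in the \<open>s i\<close> up to nilpotent coefficients.\<close>

lemma poisson_cancellation:
  assumes A: "poisson_algebra K A" and B: "poisson_algebra K B"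
    and reg: "center_regular_mod_nil A"
    and h: "h \<in> poisson_iso K (poisson_poly A n) (poisson_poly B n)"
  shows "poisson_isomorphic K A B"
proof -
  have A_cring: "cring A" and B_cring: "cring B"
    using A B by (auto simp: poisson_algebra_def algebra_def)
  interpret RA: mpoly_cring A n "mpoly A n" by (rule mpoly_cring.intro[OF A_cring])
  interpret RB: mpoly_cring B n "mpoly B n" by (rule mpoly_cring.intro[OF B_cring])
  interpret A: poisson_algebra K A by fact
  interpret B: poisson_algebra K B by fact
  let ?PA = "mpoly A n" and ?PB = "mpoly B n"
  let ?cA = "ring.indexed_const A :: _ \<Rightarrow> nat multiset \<Rightarrow> _" and ?cB = "ring.indexed_const B :: _ \<Rightarrow> nat multiset \<Rightarrow> _"
  let ?xA = "ring.indexed_var A :: nat \<Rightarrow> _" and ?xB = "ring.indexed_var B :: nat \<Rightarrow> _"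
  let ?brA = "mpoly_conv A (pbracket A)" and ?brB = "mpoly_conv B (pbracket B)"
  have h_hom: "h \<in> ring_hom ?PA ?PB"
    using h by (simp add: poisson_iso_def ring_iso_def ring_hom_def poisson_poly_simps)
  have h_bij: "bij_betw h (carrier ?PA) (carrier ?PB)"
    using h by (simp add: poisson_iso_def ring_iso_def poisson_poly_simps)
  have h_br: "h (?brA p q) = ?brB (h p) (h q)" if "p \<in> carrier ?PA" "q \<in> carrier ?PA" for p q
    using h that by (simp add: poisson_iso_def poisson_poly_simps)
  define g where "g = inv_into (carrier ?PA) h"
  have g: "g \<in> poisson_iso K (poisson_poly B n) (poisson_poly A n)"
    using poisson_iso_inverse[OF h A.ring_poisson_poly A.poisson_poly_smult_closed A.poisson_poly_bracket_closed]
    by (simp add: g_def poisson_poly_simps)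
  have g_hom: "g \<in> ring_hom ?PB ?PA"
    using g by (simp add: poisson_iso_def ring_iso_def ring_hom_def poisson_poly_simps)
  have g_smult: "g (\<lambda>m. k \<odot>\<^bsub>B\<^esub> p m) = (\<lambda>m. k \<odot>\<^bsub>A\<^esub> g p m)" if "k \<in> carrier K" "p \<in> carrier ?PB" for k p
    using g that by (simp add: poisson_iso_def poisson_poly_simps)
  have g_br: "g (?brB p q) = ?brA (g p) (g q)" if "p \<in> carrier ?PB" "q \<in> carrier ?PB" for p q
    using g that by (simp add: poisson_iso_def poisson_poly_simps)
  have hg: "h (g q) = q" if "q \<in> carrier ?PB" for q
    using h_bij that by (simp add: g_def bij_betw_def f_inv_into_f)
  have gh: "g (h p) = p" if "p \<in> carrier ?PA" for p
    using h_bij that by (simp add: g_def bij_betw_def)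
  interpret h: ring_hom_cring ?PA ?PB h
    by (intro ring_hom_cring.intro ring_hom_cring_axioms.intro RA.P_cring RB.P_cring h_hom)
  interpret g: ring_hom_cring ?PB ?PA g
    by (intro ring_hom_cring.intro ring_hom_cring_axioms.intro RA.P_cring RB.P_cring g_hom)
  interpret cA: ring_hom_cring A ?PA ?cA
    by (intro ring_hom_cring.intro ring_hom_cring_axioms.intro RA.P_cring A_cring RA.const_hom)
  interpret cB: ring_hom_cring B ?PB ?cB
    by (intro ring_hom_cring.intro ring_hom_cring_axioms.intro RB.P_cring B_cring RB.const_hom)
  define s where "s i = h (?xA i)" for i
  have s: "s i \<in> carrier ?PB" if "i < n" for i
    unfolding s_def using RA.var_closed[OF that] by (rule h.hom_closed)

  \<comment> \<open>\<open>t\<^sub>i\<close> is Poisson central in \<open>B[t]\<close>, so \<open>g t\<^sub>i\<close> is central in \<open>A[t]\<close>; its bracket with a constant is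
    computed coefficientwise.\<close>
  have central: "g (?xB i) m \<in> poisson_center A" if i: "i < n" for i m
  proof -
    let ?p = "g (?xB i)"
    have x: "?xB i \<in> carrier ?PB" by (rule RB.var_closed[OF i])
    have p: "?p \<in> carrier ?PA" by (rule g.hom_closed[OF x])
    have "\<lbrace>?p m, a\<rbrace>\<^bsub>A\<^esub> = \<zero>\<^bsub>A\<^esub>" if a: "a \<in> carrier A" for a
    proof -
      have ca: "?cA a \<in> carrier ?PA" by (rule RA.const_closed[OF a])
      have hc: "h (?cA a) \<in> carrier ?PB" by (rule h.hom_closed[OF ca])
      have "?brB (?xB i) (h (?cA a)) = \<zero>\<^bsub>?PB\<^esub>"
        using B.poisson_poly_var_central(2)[of "h (?cA a)" n i] hc i by (simp add: poisson_poly_simps)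
      then have "?brA ?p (?cA a) = \<zero>\<^bsub>?PA\<^esub>"
        using g_br[OF x hc] gh[OF ca] by simp
      moreover have "ring.carrier_coeff A ?p" unfolding ring.carrier_coeff_def[OF RA.ring_axioms] using RA.P_coeff[OF p] by blast
      ultimately have "(\<lambda>m. \<lbrace>?p m, a\<rbrace>\<^bsub>A\<^esub>) = \<zero>\<^bsub>?PA\<^esub>"
        using RA.mpoly_conv_const_right[OF A.biadditive_pbracket a, of ?p] by simp
      then show ?thesis using RA.zero_coeff[of m] by (metis (no_types))
    qed
    then show ?thesis unfolding poisson_center_def using RA.P_coeff[OF p] by blast
  qed

  have nil_const: "\<exists>b\<in>carrier B. h (?cA a) \<ominus>\<^bsub>?PB\<^esub> ?cB b \<in> RB.coeff_ideal (nilradical B)"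
    if a: "a \<in> poisson_center A" for a
  proof -
    have aA: "a \<in> carrier A" using a by (simp add: poisson_center_def)
    obtain c where c: "c \<in> carrier A" "a \<ominus>\<^bsub>A\<^esub> a \<otimes>\<^bsub>A\<^esub> a \<otimes>\<^bsub>A\<^esub> c \<in> nilradical A"
      using reg a unfolding center_regular_mod_nil_def by blast
    let ?z = "a \<ominus>\<^bsub>A\<^esub> a \<otimes>\<^bsub>A\<^esub> a \<otimes>\<^bsub>A\<^esub> c"
    obtain k :: nat where k: "?z \<in> carrier A" "?z [^]\<^bsub>A\<^esub> k = \<zero>\<^bsub>A\<^esub>"
      using c(2) RA.nilradical_iff by blast
    have cl: "?cA a \<in> carrier ?PA" "?cA c \<in> carrier ?PA" "?cA ?z \<in> carrier ?PA"
      using aA c(1) k(1) by (auto intro: RA.const_closed)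
    have cz: "?cA ?z = ?cA a \<ominus>\<^bsub>?PA\<^esub> ?cA a \<otimes>\<^bsub>?PA\<^esub> ?cA a \<otimes>\<^bsub>?PA\<^esub> ?cA c"
      unfolding a_minus_def using aA c(1) by simp
    have hz: "h (?cA ?z) = h (?cA a) \<ominus>\<^bsub>?PB\<^esub> h (?cA a) \<otimes>\<^bsub>?PB\<^esub> h (?cA a) \<otimes>\<^bsub>?PB\<^esub> h (?cA c)"
      unfolding cz unfolding a_minus_def using cl by simp
    have "h (?cA ?z) [^]\<^bsub>?PB\<^esub> k = h (?cA (?z [^]\<^bsub>A\<^esub> k))"
      using ring_hom_ring.hom_nat_pow[OF ring_hom_ringI2[OF RA.P.ring_axioms RB.P.ring_axioms h_hom] cl(3), of k]
        ring_hom_ring.hom_nat_pow[OF ring_hom_ringI2[OF RA.ring_axioms RA.P.ring_axioms RA.const_hom] k(1), of k]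
      by simp
    also have "\<dots> = \<zero>\<^bsub>?PB\<^esub>" unfolding k(2) by simp
    finally have "h (?cA ?z) \<in> nilradical ?PB"
      unfolding RB.P.nilradical_iff using h.hom_closed[OF cl(3)] by blast
    then have "h (?cA a) \<ominus>\<^bsub>?PB\<^esub> ?cB (h (?cA a) {#}) \<in> RB.coeff_ideal (nilradical B)"
      using RB.regular_constant_mod_nil[OF h.hom_closed[OF cl(1)] h.hom_closed[OF cl(2)]] unfolding hz by simp
    then show ?thesis using RB.P_coeff[OF h.hom_closed[OF cl(1)]] by blast
  qed

  have gen: "S = carrier ?PB"
    if S: "subring S ?PB" and const: "?cB ` carrier B \<subseteq> S" and sS: "\<And>i. i < n \<Longrightarrow> s i \<in> S" for S
  proof (rule RB.subring_eq_carrier_mod_nil[OF S const])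
    fix i assume i: "i < n"
    have N: "ideal (RB.coeff_ideal (nilradical B)) ?PB"
      by (rule RB.ideal_coeff_ideal[OF ideal_nilradical[OF B_cring]])
    let ?V = "{q \<in> carrier ?PB. \<exists>t\<in>S. q \<ominus>\<^bsub>?PB\<^esub> t \<in> RB.coeff_ideal (nilradical B)}"
    have V: "subring ?V ?PB" by (rule RB.P.subring_add_ideal[OF S N])
    note V' = subringE[OF V]
    have SV: "q \<in> ?V" if q: "q \<in> S" for q
    proof -
      have qP: "q \<in> carrier ?PB" using subringE(1)[OF S] q by blast
      have "q \<ominus>\<^bsub>?PB\<^esub> q = \<zero>\<^bsub>?PB\<^esub>" using qP by (simp add: a_minus_def RB.P.r_neg)
      then have "q \<ominus>\<^bsub>?PB\<^esub> q \<in> RB.coeff_ideal (nilradical B)"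
        using additive_subgroup.zero_closed[OF ideal.axioms(1)[OF N]] by (simp only:)
      then show ?thesis using q qP by blast
    qed
    let ?p = "g (?xB i)"
    have x: "?xB i \<in> carrier ?PB" by (rule RB.var_closed[OF i])
    have p: "?p \<in> carrier ?PA" by (rule g.hom_closed[OF x])
    let ?t = "\<lambda>m. ?cA (?p m) \<otimes>\<^bsub>?PA\<^esub> monomial_eval ?PA n ?xA m"
    have cl: "?cA (?p m) \<in> carrier ?PA" "monomial_eval ?PA n ?xA m \<in> carrier ?PA" for m
      using RA.const_closed[OF RA.P_coeff[OF p]] RA.P.monomial_eval_closed[OF RA.var_closed] by auto
    have summand: "h (?t m) \<in> ?V" if m: "m \<in> {m. ?p m \<noteq> \<zero>\<^bsub>A\<^esub>}" for m
    proof -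
      obtain b where b: "b \<in> carrier B" "h (?cA (?p m)) \<ominus>\<^bsub>?PB\<^esub> ?cB b \<in> RB.coeff_ideal (nilradical B)"
        using nil_const[OF central[OF i]] by blast
      have "?cB b \<in> S" using const b(1) by blast
      then have 1: "h (?cA (?p m)) \<in> ?V" using h.hom_closed[OF cl(1)] b(2) by blast
      have mn: "set_mset m \<subseteq> {..<n}" using RA.support_vars[OF p] m by blast
      have "h (monomial_eval ?PA n ?xA m) = monomial_eval ?PB n s m"
        unfolding s_def by (rule h.hom_monomial_eval[OF RA.var_closed])
      also have "\<dots> \<in> S" by (rule RB.P.monomial_eval_mem_subring[OF S sS mn])
      finally have 2: "h (monomial_eval ?PA n ?xA m) \<in> ?V" by (rule SV)
      show ?thesis unfolding h.hom_mult[OF cl] by (rule V'(6)[OF 1 2])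
    qed
    have "?xB i = h ?p" by (rule hg[OF x, symmetric])
    also have "\<dots> = h (\<Oplus>\<^bsub>?PA\<^esub>m\<in>{m. ?p m \<noteq> \<zero>\<^bsub>A\<^esub>}. ?t m)"
      by (rule arg_cong[where f = h, OF RA.poly_expansion[OF p]])
    also have "\<dots> = (\<Oplus>\<^bsub>?PB\<^esub>m\<in>{m. ?p m \<noteq> \<zero>\<^bsub>A\<^esub>}. (h \<circ> ?t) m)"
      by (rule h.hom_finsum) (use cl in auto)
    also have "\<dots> \<in> ?V"
      by (rule RB.P.finsum_mem[OF V'(2) V'(7) V'(1)]) (simp_all only: o_apply summand)
    finally show "\<exists>t\<in>S. ?xB i \<ominus>\<^bsub>?PB\<^esub> t \<in> RB.coeff_ideal (nilradical B)" by blast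
  qed

  define \<rho> where "\<rho> b = g (?cB b) {#}" for b
  have cB: "?cB b \<in> carrier ?PB" if "b \<in> carrier B" for b by (rule RB.const_closed[OF that])
  have gcB: "g (?cB b) \<in> carrier ?PA" if "b \<in> carrier B" for b by (rule g.hom_closed[OF cB[OF that]])
  have \<rho>_hom: "\<rho> \<in> ring_hom B A"
  proof (rule ring_hom_memI)
    show "\<rho> b \<in> carrier A" if "b \<in> carrier B" for b
      unfolding \<rho>_def by (rule RA.P_coeff[OF gcB[OF that]])
    show "\<rho> (b \<otimes>\<^bsub>B\<^esub> b') = \<rho> b \<otimes>\<^bsub>A\<^esub> \<rho> b'" if "b \<in> carrier B" "b' \<in> carrier B" for b b'
      unfolding \<rho>_def cB.hom_mult[OF that] g.hom_mult[OF cB[OF that(1)] cB[OF that(2)]]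
      by (rule RA.mult_coeff_empty[OF gcB[OF that(1)] gcB[OF that(2)]])
    show "\<rho> (b \<oplus>\<^bsub>B\<^esub> b') = \<rho> b \<oplus>\<^bsub>A\<^esub> \<rho> b'" if "b \<in> carrier B" "b' \<in> carrier B" for b b'
      unfolding \<rho>_def cB.hom_add[OF that] g.hom_add[OF cB[OF that(1)] cB[OF that(2)]]
      by (rule RA.add_coeff)
    show "\<rho> \<one>\<^bsub>B\<^esub> = \<one>\<^bsub>A\<^esub>"
      unfolding \<rho>_def cB.hom_one g.hom_one RA.one_coeff by simp
  qed
  interpret \<rho>: ring_hom_cring B A \<rho>
    by (intro ring_hom_cring.intro ring_hom_cring_axioms.intro A_cring B_cring \<rho>_hom)

  have \<rho>_surj: "\<exists>b\<in>carrier B. g q {#} = \<rho> b" if q: "q \<in> carrier ?PB" for q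
  proof -
    let ?S = "{q \<in> carrier ?PB. \<exists>b\<in>carrier B. g q {#} = \<rho> b}"
    have mem: "q \<in> ?S" if "q \<in> carrier ?PB" "b \<in> carrier B" "g q {#} = \<rho> b" for q b
      using that by blast
    have "?S = carrier ?PB"
    proof (rule gen)
      show "subring ?S ?PB"
      proof (rule RB.P.subringI)
        have "g \<one>\<^bsub>?PB\<^esub> {#} = \<rho> \<one>\<^bsub>B\<^esub>" unfolding g.hom_one RA.one_coeff by simp
        then show "\<one>\<^bsub>?PB\<^esub> \<in> ?S" by (rule mem[OF RB.P.one_closed RB.one_closed])
        fix p assume "p \<in> ?S"
        then obtain b where b: "p \<in> carrier ?PB" "b \<in> carrier B" "g p {#} = \<rho> b" by blast
        have "g (\<ominus>\<^bsub>?PB\<^esub> p) {#} = \<rho> (\<ominus>\<^bsub>B\<^esub> b)"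
          unfolding g.hom_a_inv[OF b(1)] RA.minus_coeff[OF g.hom_closed[OF b(1)]] b(3) using b(2) by simp
        then show "\<ominus>\<^bsub>?PB\<^esub> p \<in> ?S"
          by (rule mem[OF RB.P.a_inv_closed[OF b(1)] RB.a_inv_closed[OF b(2)]])
      next
        fix p q assume "p \<in> ?S" "q \<in> ?S"
        then obtain b c where b: "p \<in> carrier ?PB" "b \<in> carrier B" "g p {#} = \<rho> b"
          and c: "q \<in> carrier ?PB" "c \<in> carrier B" "g q {#} = \<rho> c" by blast
        have "g (p \<otimes>\<^bsub>?PB\<^esub> q) {#} = \<rho> (b \<otimes>\<^bsub>B\<^esub> c)"
          unfolding g.hom_mult[OF b(1) c(1)] RA.mult_coeff_empty[OF g.hom_closed[OF b(1)] g.hom_closed[OF c(1)]] b(3) c(3)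
          by (rule \<rho>.hom_mult[OF b(2) c(2), symmetric])
        then show "p \<otimes>\<^bsub>?PB\<^esub> q \<in> ?S"
          by (rule mem[OF RB.P.m_closed[OF b(1) c(1)] RB.m_closed[OF b(2) c(2)]])
        have "g (p \<oplus>\<^bsub>?PB\<^esub> q) {#} = \<rho> (b \<oplus>\<^bsub>B\<^esub> c)"
          unfolding g.hom_add[OF b(1) c(1)] RA.add_coeff b(3) c(3)
          by (rule \<rho>.hom_add[OF b(2) c(2), symmetric])
        then show "p \<oplus>\<^bsub>?PB\<^esub> q \<in> ?S"
          by (rule mem[OF RB.P.a_closed[OF b(1) c(1)] RB.a_closed[OF b(2) c(2)]])
      qed auto
      show "?cB ` carrier B \<subseteq> ?S"
      proof (rule image_subsetI)
        fix b assume b: "b \<in> carrier B"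
        show "?cB b \<in> ?S" by (rule mem[OF cB[OF b] b]) (simp add: \<rho>_def)
      qed
      fix i assume i: "i < n"
      have "g (s i) {#} = \<rho> \<zero>\<^bsub>B\<^esub>"
        unfolding s_def gh[OF RA.var_closed[OF i]] RA.var_coeff by simp
      then show "s i \<in> ?S" by (rule mem[OF s[OF i] RB.zero_closed])
    qed
    then show ?thesis using q by blast
  qed

  have \<rho>_ker: "b = \<zero>\<^bsub>B\<^esub>" if b: "b \<in> carrier B" and zero: "\<rho> b = \<zero>\<^bsub>A\<^esub>" for b
  proof -
    obtain r where r: "\<And>k. k < n \<Longrightarrow> r k \<in> carrier ?PA"
      and dec: "g (?cB b) = ?cA (g (?cB b) {#}) \<oplus>\<^bsub>?PA\<^esub> (\<Oplus>\<^bsub>?PA\<^esub>k\<in>{..<n}. ?xA k \<otimes>\<^bsub>?PA\<^esub> r k)"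
      using RA.constant_plus_variables[OF gcB[OF b]] by blast
    have x: "?xA k \<in> carrier ?PA" if "k < n" for k by (rule RA.var_closed[OF that])
    have sum: "(\<Oplus>\<^bsub>?PA\<^esub>k\<in>{..<n}. ?xA k \<otimes>\<^bsub>?PA\<^esub> r k) \<in> carrier ?PA"
      using r x by (intro RA.P.finsum_closed) auto
    have "g (?cB b) {#} = \<zero>\<^bsub>A\<^esub>" using zero by (simp add: \<rho>_def)
    then have g_dec: "g (?cB b) = (\<Oplus>\<^bsub>?PA\<^esub>k\<in>{..<n}. ?xA k \<otimes>\<^bsub>?PA\<^esub> r k)"
      using dec sum by (simp only: cA.hom_zero RA.P.l_zero)
    have "?cB b = h (\<Oplus>\<^bsub>?PA\<^esub>k\<in>{..<n}. ?xA k \<otimes>\<^bsub>?PA\<^esub> r k)"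
      unfolding g_dec[symmetric] by (rule hg[OF cB[OF b], symmetric])
    also have "\<dots> = (\<Oplus>\<^bsub>?PB\<^esub>k\<in>{..<n}. (h \<circ> (\<lambda>k. ?xA k \<otimes>\<^bsub>?PA\<^esub> r k)) k)"
      by (rule h.hom_finsum) (use r x in auto)
    also have "\<dots> = (\<Oplus>\<^bsub>?PB\<^esub>k\<in>{..<n}. s k \<otimes>\<^bsub>?PB\<^esub> h (r k))"
      using r x by (intro RB.P.finsum_cong') (auto simp: s_def)
    finally have "?cB b = (\<Oplus>\<^bsub>?PB\<^esub>k\<in>{..<n}. s k \<otimes>\<^bsub>?PB\<^esub> h (r k))" .
    from RB.constant_in_generator_ideal_zero[OF s gen b h.hom_closed[OF r] this] show ?thesis .
  qed

  have "bij_betw \<rho> (carrier B) (carrier A)"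
    unfolding bij_betw_def
  proof
    show "inj_on \<rho> (carrier B)"
    proof (rule inj_onI)
      fix b c assume bc: "b \<in> carrier B" "c \<in> carrier B" "\<rho> b = \<rho> c"
      have "\<rho> (b \<ominus>\<^bsub>B\<^esub> c) = \<zero>\<^bsub>A\<^esub>"
        unfolding a_minus_def using bc by (simp add: RA.r_neg)
      then have "b \<ominus>\<^bsub>B\<^esub> c = \<zero>\<^bsub>B\<^esub>" using bc by (intro \<rho>_ker) auto
      then show "b = c" using bc by simp
    qed
    show "\<rho> ` carrier B = carrier A"
    proof
      show "carrier A \<subseteq> \<rho> ` carrier B"
      proof
        fix a assume a: "a \<in> carrier A"
        have ca: "?cA a \<in> carrier ?PA" by (rule RA.const_closed[OF a])
        obtain b where "b \<in> carrier B" "g (h (?cA a)) {#} = \<rho> b"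
          using \<rho>_surj[OF h.hom_closed[OF ca]] by blast
        moreover have "?cA a {#} = a" by (simp add: ring.indexed_const_def[OF RA.ring_axioms])
        ultimately show "a \<in> \<rho> ` carrier B" using gh[OF ca] by auto
      qed
    qed auto
  qed
  then have \<rho>_iso: "\<rho> \<in> ring_iso B A" using \<rho>_hom by (simp add: ring_iso_def)
  have \<rho>_smult: "\<rho> (k \<odot>\<^bsub>B\<^esub> b) = k \<odot>\<^bsub>A\<^esub> \<rho> b" if k: "k \<in> carrier K" and b: "b \<in> carrier B" for k b
  proof -
    have "?cB (k \<odot>\<^bsub>B\<^esub> b) = (\<lambda>m. k \<odot>\<^bsub>B\<^esub> ?cB b m)"
      using k by (auto simp: ring.indexed_const_def[OF RB.ring_axioms] fun_eq_iff)
    then show ?thesis unfolding \<rho>_def by (simp only: g_smult[OF k cB[OF b]])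
  qed
  have \<rho>_br: "\<rho> \<lbrace>b, c\<rbrace>\<^bsub>B\<^esub> = \<lbrace>\<rho> b, \<rho> c\<rbrace>\<^bsub>A\<^esub>" if b: "b \<in> carrier B" and c: "c \<in> carrier B" for b c
  proof -
    have "?cB \<lbrace>b, c\<rbrace>\<^bsub>B\<^esub> = ?brB (?cB b) (?cB c)"
      using B.poisson_poly_bracket_const[OF b c, of n] by (simp add: poisson_poly_simps)
    then have "\<rho> \<lbrace>b, c\<rbrace>\<^bsub>B\<^esub> = ?brA (g (?cB b)) (g (?cB c)) {#}"
      unfolding \<rho>_def by (simp only: g_br[OF cB[OF b] cB[OF c]])
    also have "\<dots> = (\<Oplus>\<^bsub>A\<^esub>u\<in>{{#}}. \<lbrace>g (?cB b) u, g (?cB c) ({#} - u)\<rbrace>\<^bsub>A\<^esub>)"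
      unfolding mpoly_conv_def by simp
    also have "\<dots> = \<lbrace>\<rho> b, \<rho> c\<rbrace>\<^bsub>A\<^esub>"
      using A.pbracket_closed[OF RA.P_coeff[OF gcB[OF b]] RA.P_coeff[OF gcB[OF c]]]
      by (simp add: \<rho>_def)
    finally show ?thesis .
  qed
  have "\<rho> \<in> poisson_iso K B A"
    using \<rho>_iso \<rho>_smult \<rho>_br by (simp add: poisson_iso_def)
  then have "inv_into (carrier B) \<rho> \<in> poisson_iso K A B"
    by (rule poisson_iso_inverse[OF _ RB.ring_axioms B.smult_closed B.pbracket_closed])
  then show ?thesis unfolding poisson_isomorphic_def by blast
qed

theorem corollary5p4:
  fixes K :: "('k, 'm) ring_scheme"
    and A :: "('k, 'a) poisson_alg"
  assumes "field K"
    and "poisson_algebra K A"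
  shows "(noetherian_ring A \<and>
          (artinian_ring (poisson_center_ring A) \<or>
           artinian_ring (poisson_center_ring (reduced_poisson A)))
            \<longrightarrow> strongly_poisson_cancellative K A TYPE('b))
       \<and> (artinian_ring A \<longrightarrow> strongly_poisson_cancellative K A TYPE('b))"
proof -
  interpret poisson_algebra K A by fact
  have "strongly_poisson_cancellative K A TYPE('b)" if "center_regular_mod_nil A"
    unfolding strongly_poisson_cancellative_def
    using poisson_cancellation[OF assms(2) _ that] by (auto simp: poisson_isomorphic_def[of K "poisson_poly _ _"])
  then show ?thesis
    using center_regular_if_artinian center_regular_if_center_artinian center_regular_if_reduced_center_artinian
    by blast
qed

end
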